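(* The category of regular monoids is equivalent to the category of bounded above normal categories (with CC-morphisms).
   Context: Conventions. Mappings, morphisms and functors are composed from left to right ($fg$ means first $f$, then $g$). For a category $\mathcal C$, $v\mathcal C$ denotes its class of objects and $\mathcal C(c,c')$ the set of morphisms from $c$ to $c'$. A monomorphism is a right cancellable morphism and an epimorphism is a left cancellable morphism. Semigroups. A semigroup $S$ is regular if for every $a\in S$ there is $x\in S$ with $axa=a$. Regular monoids are regarded as a full subcategory of a category of regular semigroups with semigroup homomorphisms; thus the morphisms of the category of regular monoids are all semigroup homomorphisms. Normal categories. A strict preorder is a category with at most one morphism between any two (possibly equal) objects in which the only isomorphisms are identities. A category with subobjects is a small category $\mathcal C$ with a subcategory $\mathcal P$ such that: $\mathcal P$ is a strict preorder with $v\mathcal P=v\mathcal C$; every $f\in\mathcal P$ is a monomorphism in $\mathcal C$; if $f,g\in\mathcal P$ and $f=hg$ with $h\in\mathcal C$, then $h\in\mathcal P$. Morphisms of $\mathcal P$ are called inclusions; $c\preceq c'$ means $\mathcal P(c,c')\neq\emptyset$, and $j(c,c')$ is then the unique inclusion. An inclusion $j\colon c\to c'$ splits if there is $q\colon c'\to c$ in $\mathcal C$ with $jq=1_c$; such a $q$ is called a retraction. A normal factorisation of a morphism $f$ is $f=quj$ with $q$ a retraction, $u$ an isomorphism, $j$ an inclusion. A cone with vertex $z\in v\mathcal C$ is a map $\gamma$ assigning to each $c\in v\mathcal C$ a morphism $\gamma(c)\in\mathcal C(c,z)$ such that $j(a,b)\gamma(b)=\gamma(a)$ whenever $a\preceq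 b$, and $\gamma(c)$ is an isomorphism for at least one $c$; the vertex is denoted $z_\gamma$. $\mathcal C$ is a normal category if it is a category with subobjects in which every inclusion splits, every morphism has a normal factorisation, and for each $c\in v\mathcal C$ there is a cone $\mu$ with vertex $c$ and $\mu(c)=1_c$. In a normal category, for a normal factorisation $f=quj$ the epimorphism $f^\circ:=qu$ does not depend on the factorisation. A normal category $\mathcal C$ is bounded above if there is $d\in v\mathcal C$ with $c\preceq d$ for every $c\in v\mathcal C$. Semigroup of cones. For a cone $\gamma$ and an epimorphism $f$ with domain $z_\gamma$, $\gamma\ast f$ is the cone $c\mapsto\gamma(c)f$. The set $\widehat{\mathcal C}$ of all cones in a normal category $\mathcal C$ is a regular semigroup under $\gamma\cdot\delta=\gamma\ast(\delta(z_\gamma))^\circ$. Let $\mathscr R$ be Green's relation on $\widehat{\mathcal C}$, $R_\gamma$ the $\mathscr R$-class of $\gamma$; $\widehat{\mathcal C}/\mathscr R$ is partially ordered by $R_\gamma\sqsubseteq R_\delta$ iff the principal right ideal generated by $\gamma$ is contained in that generated by $\delta$. CC-morphisms. Let $\mathcal C$ be a normal category and $\mathfrak D$ a down-set of $(\widehat{\mathcal C}/\mathscr R,\sqsubseteq)$. An object $c$ is connected by (or to) $\mathfrak d\in\mathfrak D$ if $\mathfrak d$ contains an idempotent cone with vertex $c$; this idempotent cone is then unique and is denoted $\epsilon(c,\mathfrak d)$. $\mathcal C$ is connected by $\mathfrak D$ if every $c\in v\mathcal C$ is connected by some $\mathfrak d\in\mathfrak D$; then the pair is denoted $\mathcal C_{\mathfrak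 D}$ and called a connected category. A CC-morphism from $\mathcal C_{\mathfrak D}$ to $\mathcal C'_{\mathfrak D'}$ is a pair $(F,G)$ where $F\colon\mathcal C\to\mathcal C'$ is an inclusion preserving functor and $G\colon\mathfrak D\to\mathfrak D'$ is an order preserving map such that whenever $c$ is connected to $\mathfrak d$, $F(c)$ is connected to $G(\mathfrak d)$ and $F(\epsilon(c,\mathfrak d)(c'))=\epsilon(F(c),G(\mathfrak d))(F(c'))$ for every $c'\in v\mathcal C$. Every normal category $\mathcal C$ (in particular every bounded above one) is treated as the connected category $\mathcal C_{\mathfrak D}$ with $\mathfrak D=\widehat{\mathcal C}/\mathscr R$, and morphisms between normal categories are CC-morphisms under this identification. *)

theory Defs
  imports "HOL-Algebra.Group"
begin

text \<open>Composition is written from left to right throughout: \<open>f \<Zcomp> g\<close> is first \<open>f\<close>, then \<open>g\<close>.\<close>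


section \<open>Categories, functors and equivalence\<close>

record ('o, 'm) cat =
  Ob  :: "'o set"
  Ar  :: "'m set"
  Dom :: "'m \<Rightarrow> 'o"
  Cod :: "'m \<Rightarrow> 'o"
  Ide :: "'o \<Rightarrow> 'm"
  Cmp :: "'m \<Rightarrow> 'm \<Rightarrow> 'm"  (infixl "\<Zcomp>\<index>" 70)

definition Hom :: "('o, 'm, 'z) cat_scheme \<Rightarrow> 'o \<Rightarrow> 'o \<Rightarrow> 'm set" where
  "Hom C a b = {f \<in> Ar C. Dom C f = a \<and> Cod C f = b}"

locale category =
  fixes C :: "('o, 'm, 'z) cat_scheme" (structure)
  assumes Dom_closed: "f \<in> Ar C \<Longrightarrow> Dom C f \<in> Ob C"
    and Cod_closed: "f \<in> Ar C \<Longrightarrow> Cod C f \<in> Ob C"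
    and Ide_Hom: "a \<in> Ob C \<Longrightarrow> Ide C a \<in> Hom C a a"
    and Cmp_Hom: "\<lbrakk>f \<in> Hom C a b; g \<in> Hom C b c\<rbrakk> \<Longrightarrow> f \<Zcomp> g \<in> Hom C a c"
    and Ide_left: "f \<in> Ar C \<Longrightarrow> Ide C (Dom C f) \<Zcomp> f = f"
    and Ide_right: "f \<in> Ar C \<Longrightarrow> f \<Zcomp> Ide C (Cod C f) = f"
    and Cmp_assoc: "\<lbrakk>f \<in> Hom C a b; g \<in> Hom C b c; h \<in> Hom C c d\<rbrakk>
          \<Longrightarrow> (f \<Zcomp> g) \<Zcomp> h = f \<Zcomp> (g \<Zcomp> h)"

definition is_iso :: "('o, 'm, 'z) cat_scheme \<Rightarrow> 'm \<Rightarrow> bool" where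
  "is_iso C f \<longleftrightarrow> f \<in> Ar C \<and>
     (\<exists>g \<in> Hom C (Cod C f) (Dom C f).
        f \<Zcomp>\<^bsub>C\<^esub> g = Ide C (Dom C f) \<and> g \<Zcomp>\<^bsub>C\<^esub> f = Ide C (Cod C f))"

definition is_mono :: "('o, 'm, 'z) cat_scheme \<Rightarrow> 'm \<Rightarrow> bool" where
  "is_mono C f \<longleftrightarrow> f \<in> Ar C \<and>
     (\<forall>a. \<forall>g \<in> Hom C a (Dom C f). \<forall>h \<in> Hom C a (Dom C f).
        g \<Zcomp>\<^bsub>C\<^esub> f = h \<Zcomp>\<^bsub>C\<^esub> f \<longrightarrow> g = h)"

record ('o, 'm, 'p, 'n) ftor =
  onOb :: "'o \<Rightarrow> 'p"
  onAr :: "'m \<Rightarrow> 'n"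

locale is_functor =
  fixes A :: "('o, 'm, 'y) cat_scheme" and B :: "('p, 'n, 'z) cat_scheme"
    and F :: "('o, 'm, 'p, 'n) ftor"
  assumes onOb_closed: "a \<in> Ob A \<Longrightarrow> onOb F a \<in> Ob B"
    and onAr_Hom: "f \<in> Hom A a b \<Longrightarrow> onAr F f \<in> Hom B (onOb F a) (onOb F b)"
    and onAr_Ide: "a \<in> Ob A \<Longrightarrow> onAr F (Ide A a) = Ide B (onOb F a)"
    and onAr_Cmp: "\<lbrakk>f \<in> Hom A a b; g \<in> Hom A b c\<rbrakk>
          \<Longrightarrow> onAr F (f \<Zcomp>\<^bsub>A\<^esub> g) = onAr F f \<Zcomp>\<^bsub>B\<^esub> onAr F g"

definition id_functor :: "('o, 'm, 'o, 'm) ftor" where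
  "id_functor = \<lparr>onOb = (\<lambda>a. a), onAr = (\<lambda>f. f)\<rparr>"

definition comp_functor ::
  "('o, 'm, 'p, 'n) ftor \<Rightarrow> ('p, 'n, 'q, 'r) ftor \<Rightarrow> ('o, 'm, 'q, 'r) ftor" where
  "comp_functor F G = \<lparr>onOb = (\<lambda>a. onOb G (onOb F a)), onAr = (\<lambda>f. onAr G (onAr F f))\<rparr>"

definition naturally_isomorphic ::
  "('o, 'm, 'y) cat_scheme \<Rightarrow> ('p, 'n, 'z) cat_scheme \<Rightarrow>
   ('o, 'm, 'p, 'n) ftor \<Rightarrow> ('o, 'm, 'p, 'n) ftor \<Rightarrow> bool" where
  "naturally_isomorphic A B F G \<longleftrightarrow> (\<exists>\<tau>.
     (\<forall>a \<in> Ob A. \<tau> a \<in> Hom B (onOb F a) (onOb G a) \<and> is_iso B (\<tau> a)) \<and>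
     (\<forall>f \<in> Ar A. onAr F f \<Zcomp>\<^bsub>B\<^esub> \<tau> (Cod A f) = \<tau> (Dom A f) \<Zcomp>\<^bsub>B\<^esub> onAr G f))"

definition equivalent_categories ::
  "('o, 'm, 'y) cat_scheme \<Rightarrow> ('p, 'n, 'z) cat_scheme \<Rightarrow> bool" where
  "equivalent_categories A B \<longleftrightarrow> category A \<and> category B \<and>
     (\<exists>F G. is_functor A B F \<and> is_functor B A G \<and>
        naturally_isomorphic A A id_functor (comp_functor F G) \<and>
        naturally_isomorphic B B (comp_functor G F) id_functor)"


section \<open>Normal categories\<close>

text \<open>\<open>Inc\<close> is the set of morphisms of the subcategory of inclusions, whose objects are all
  objects of the ambient category.\<close>

record ('o, 'm) subcat = "('o, 'm) cat" +
  Inc :: "'m set"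

definition inc_cat :: "('o, 'm, 'z) subcat_scheme \<Rightarrow> ('o, 'm) cat" where
  "inc_cat C = \<lparr>Ob = Ob C, Ar = Inc C, Dom = Dom C, Cod = Cod C, Ide = Ide C, Cmp = Cmp C\<rparr>"

definition strict_preorder :: "('o, 'm, 'z) cat_scheme \<Rightarrow> bool" where
  "strict_preorder P \<longleftrightarrow> category P \<and>
     (\<forall>a b. \<forall>f \<in> Hom P a b. \<forall>g \<in> Hom P a b. f = g) \<and>
     (\<forall>f. is_iso P f \<longrightarrow> f = Ide P (Dom P f))"

locale category_with_subobjects = category C
  for C :: "('o, 'm, 'z) subcat_scheme" (structure) +
  assumes Inc_Ar: "Inc C \<subseteq> Ar C"
    and Inc_strict_preorder: "strict_preorder (inc_cat C)"
    and Inc_mono: "f \<in> Inc C \<Longrightarrow> is_mono C f"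
    and Inc_factor: "\<lbrakk>f \<in> Inc C; g \<in> Inc C; h \<in> Ar C; Cod C h = Dom C g; f = h \<Zcomp> g\<rbrakk>
          \<Longrightarrow> h \<in> Inc C"

definition subobj :: "('o, 'm, 'z) subcat_scheme \<Rightarrow> 'o \<Rightarrow> 'o \<Rightarrow> bool" where
  "subobj C a b \<longleftrightarrow> Inc C \<inter> Hom C a b \<noteq> {}"

definition retraction_of :: "('o, 'm, 'z) subcat_scheme \<Rightarrow> 'm \<Rightarrow> 'm \<Rightarrow> bool" where
  "retraction_of C j q \<longleftrightarrow>
     j \<in> Inc C \<and> q \<in> Hom C (Cod C j) (Dom C j) \<and> j \<Zcomp>\<^bsub>C\<^esub> q = Ide C (Dom C j)"

definition normal_factorisation ::
  "('o, 'm, 'z) subcat_scheme \<Rightarrow> 'm \<Rightarrow> 'm \<Rightarrow> 'm \<Rightarrow> 'm \<Rightarrow> bool" where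
  "normal_factorisation C f q u j \<longleftrightarrow>
     (\<exists>i. retraction_of C i q) \<and> is_iso C u \<and> j \<in> Inc C \<and>
     Cod C q = Dom C u \<and> Cod C u = Dom C j \<and> f = q \<Zcomp>\<^bsub>C\<^esub> u \<Zcomp>\<^bsub>C\<^esub> j"

text \<open>Cones are extensional on the objects, so that equality of cones is equality of functions.\<close>

definition is_cone :: "('o, 'm, 'z) subcat_scheme \<Rightarrow> 'o \<Rightarrow> ('o \<Rightarrow> 'm) \<Rightarrow> bool" where
  "is_cone C z \<gamma> \<longleftrightarrow> z \<in> Ob C \<and> \<gamma> \<in> extensional (Ob C) \<and>
     (\<forall>c \<in> Ob C. \<gamma> c \<in> Hom C c z) \<and>
     (\<forall>j \<in> Inc C. j \<Zcomp>\<^bsub>C\<^esub> \<gamma> (Cod C j) = \<gamma> (Dom C j)) \<and>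
     (\<exists>c \<in> Ob C. is_iso C (\<gamma> c))"

locale normal_category = category_with_subobjects C
  for C :: "('o, 'm, 'z) subcat_scheme" (structure) +
  assumes Inc_splits: "j \<in> Inc C \<Longrightarrow> \<exists>q. retraction_of C j q"
    and ex_normal_factorisation: "f \<in> Ar C \<Longrightarrow> \<exists>q u j. normal_factorisation C f q u j"
    and ex_cone: "c \<in> Ob C \<Longrightarrow> \<exists>\<mu>. is_cone C c \<mu> \<and> \<mu> c = Ide C c"

definition bounded_above :: "('o, 'm, 'z) subcat_scheme \<Rightarrow> bool" where
  "bounded_above C \<longleftrightarrow> (\<exists>d \<in> Ob C. \<forall>c \<in> Ob C. subobj C c d)"


section \<open>The semigroup of cones\<close>

definition cones :: "('o, 'm, 'z) subcat_scheme \<Rightarrow> ('o \<Rightarrow> 'm) set" where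
  "cones C = {\<gamma>. \<exists>z. is_cone C z \<gamma>}"

definition vertex :: "('o, 'm, 'z) subcat_scheme \<Rightarrow> ('o \<Rightarrow> 'm) \<Rightarrow> 'o" where
  "vertex C \<gamma> = (THE z. is_cone C z \<gamma>)"

text \<open>The epimorphism \<open>f\<degree>\<close>.\<close>

definition epi_part :: "('o, 'm, 'z) subcat_scheme \<Rightarrow> 'm \<Rightarrow> 'm" where
  "epi_part C f = (THE e. \<exists>q u j. normal_factorisation C f q u j \<and> e = q \<Zcomp>\<^bsub>C\<^esub> u)"

definition cone_star ::
  "('o, 'm, 'z) subcat_scheme \<Rightarrow> ('o \<Rightarrow> 'm) \<Rightarrow> 'm \<Rightarrow> ('o \<Rightarrow> 'm)" where
  "cone_star C \<gamma> f = (\<lambda>c \<in> Ob C. \<gamma> c \<Zcomp>\<^bsub>C\<^esub> f)"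

definition cone_mult ::
  "('o, 'm, 'z) subcat_scheme \<Rightarrow> ('o \<Rightarrow> 'm) \<Rightarrow> ('o \<Rightarrow> 'm) \<Rightarrow> ('o \<Rightarrow> 'm)" where
  "cone_mult C \<gamma> \<delta> = cone_star C \<gamma> (epi_part C (\<delta> (vertex C \<gamma>)))"

text \<open>Principal right ideals and Green's relation \<open>\<R>\<close> of a semigroup with carrier \<open>S\<close> and
  multiplication \<open>m\<close>.\<close>

definition principal_right_ideal :: "'s set \<Rightarrow> ('s \<Rightarrow> 's \<Rightarrow> 's) \<Rightarrow> 's \<Rightarrow> 's set" where
  "principal_right_ideal S m a = insert a (m a ` S)"

definition green_R :: "'s set \<Rightarrow> ('s \<Rightarrow> 's \<Rightarrow> 's) \<Rightarrow> ('s \<times> 's) set" where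
  "green_R S m =
     {(a, b) \<in> S \<times> S. principal_right_ideal S m a = principal_right_ideal S m b}"

definition cone_classes :: "('o, 'm, 'z) subcat_scheme \<Rightarrow> ('o \<Rightarrow> 'm) set set" where
  "cone_classes C = cones C // green_R (cones C) (cone_mult C)"

definition class_le ::
  "('o, 'm, 'z) subcat_scheme \<Rightarrow> ('o \<Rightarrow> 'm) set \<Rightarrow> ('o \<Rightarrow> 'm) set \<Rightarrow> bool" where
  "class_le C \<dd> \<ee> \<longleftrightarrow> (\<exists>\<gamma> \<in> \<dd>. \<exists>\<delta> \<in> \<ee>.
     principal_right_ideal (cones C) (cone_mult C) \<gamma>
       \<subseteq> principal_right_ideal (cones C) (cone_mult C) \<delta>)"


section \<open>Connected categories and CC-morphisms\<close>

definition idempotent_cone_at ::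
  "('o, 'm, 'z) subcat_scheme \<Rightarrow> 'o \<Rightarrow> ('o \<Rightarrow> 'm) set \<Rightarrow> ('o \<Rightarrow> 'm) \<Rightarrow> bool" where
  "idempotent_cone_at C c \<dd> \<gamma> \<longleftrightarrow>
     \<gamma> \<in> \<dd> \<and> is_cone C c \<gamma> \<and> cone_mult C \<gamma> \<gamma> = \<gamma>"

definition connected_by ::
  "('o, 'm, 'z) subcat_scheme \<Rightarrow> 'o \<Rightarrow> ('o \<Rightarrow> 'm) set \<Rightarrow> bool" where
  "connected_by C c \<dd> \<longleftrightarrow> (\<exists>\<gamma>. idempotent_cone_at C c \<dd> \<gamma>)"

definition idem_cone ::
  "('o, 'm, 'z) subcat_scheme \<Rightarrow> 'o \<Rightarrow> ('o \<Rightarrow> 'm) set \<Rightarrow> ('o \<Rightarrow> 'm)" where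
  "idem_cone C c \<dd> = (THE \<gamma>. idempotent_cone_at C c \<dd> \<gamma>)"

locale connected_category = normal_category C
  for C :: "('o, 'm, 'z) subcat_scheme" (structure) +
  fixes \<DD> :: "('o \<Rightarrow> 'm) set set"
  assumes DD_classes: "\<DD> \<subseteq> cone_classes C"
    and DD_down: "\<lbrakk>\<dd> \<in> \<DD>; \<ee> \<in> cone_classes C; class_le C \<ee> \<dd>\<rbrakk> \<Longrightarrow> \<ee> \<in> \<DD>"
    and DD_connected: "c \<in> Ob C \<Longrightarrow> \<exists>\<dd> \<in> \<DD>. connected_by C c \<dd>"

type_synonym ('o, 'm, 'p, 'n) cc_pair =
  "('o, 'm, 'p, 'n) ftor \<times> (('o \<Rightarrow> 'm) set \<Rightarrow> ('p \<Rightarrow> 'n) set)"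

text \<open>The three maps are extensional, so that equality of CC-morphisms is equality of pairs.\<close>

locale cc_morphism =
  source: connected_category C \<DD> + target: connected_category C' \<DD>'
  for C :: "('o, 'm, 'y) subcat_scheme" and \<DD>
    and C' :: "('p, 'n, 'z) subcat_scheme" and \<DD>' +
  fixes FG :: "('o, 'm, 'p, 'n) cc_pair"
  assumes functor_F: "is_functor C C' (fst FG)"
    and F_extensional: "onOb (fst FG) \<in> extensional (Ob C)" "onAr (fst FG) \<in> extensional (Ar C)"
    and F_Inc: "j \<in> Inc C \<Longrightarrow> onAr (fst FG) j \<in> Inc C'"
    and G_closed: "snd FG \<in> \<DD> \<rightarrow>\<^sub>E \<DD>'"
    and G_mono: "\<lbrakk>\<dd> \<in> \<DD>; \<ee> \<in> \<DD>; class_le C \<dd> \<ee>\<rbrakk> \<Longrightarrow> class_le C' (snd FG \<dd>) (snd FG \<ee>)"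
    and FG_connected: "\<lbrakk>c \<in> Ob C; \<dd> \<in> \<DD>; connected_by C c \<dd>\<rbrakk>
          \<Longrightarrow> connected_by C' (onOb (fst FG) c) (snd FG \<dd>)"
    and FG_idem_cone: "\<lbrakk>c \<in> Ob C; \<dd> \<in> \<DD>; connected_by C c \<dd>; c' \<in> Ob C\<rbrakk>
          \<Longrightarrow> onAr (fst FG) (idem_cone C c \<dd> c')
              = idem_cone C' (onOb (fst FG) c) (snd FG \<dd>) (onOb (fst FG) c')"

definition cc_id :: "('o, 'm, 'z) subcat_scheme \<Rightarrow> ('o \<Rightarrow> 'm) set set \<Rightarrow> ('o, 'm, 'o, 'm) cc_pair"
  where "cc_id C \<DD> = (\<lparr>onOb = (\<lambda>c \<in> Ob C. c), onAr = (\<lambda>f \<in> Ar C. f)\<rparr>, (\<lambda>\<dd> \<in> \<DD>. \<dd>))"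

definition cc_comp ::
  "('o, 'm, 'z) subcat_scheme \<Rightarrow> ('o \<Rightarrow> 'm) set set \<Rightarrow>
   ('o, 'm, 'p, 'n) cc_pair \<Rightarrow> ('p, 'n, 'q, 'r) cc_pair \<Rightarrow> ('o, 'm, 'q, 'r) cc_pair" where
  "cc_comp C \<DD> FG FG' =
     (\<lparr>onOb = compose (Ob C) (onOb (fst FG')) (onOb (fst FG)),
       onAr = compose (Ar C) (onAr (fst FG')) (onAr (fst FG))\<rparr>,
      compose \<DD> (snd FG') (snd FG))"


subsection \<open>A normal category is connected by the set of all \<open>\<R>\<close>-classes of cones\<close>

lemma vertex_eq: "is_cone C z \<gamma> \<Longrightarrow> vertex C \<gamma> = z"
  unfolding vertex_def is_cone_def Hom_def by (rule the_equality) auto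

context normal_category
begin

lemma Inc_split_epi_identity:
  assumes j: "j \<in> Inc C" and h: "h \<in> Hom C (Cod C j) (Dom C j)"
    and hj: "h \<Zcomp> j = Ide C (Cod C j)"
  shows "Cod C j = Dom C j" "j = Ide C (Dom C j)" "h = Ide C (Dom C j)"
proof -
  have inc: "category (inc_cat C)"
      "\<And>f. is_iso (inc_cat C) f \<Longrightarrow> f = Ide C (Dom C f)"
    using Inc_strict_preorder by (auto simp: strict_preorder_def inc_cat_def)
  have jAr: "j \<in> Ar C" using j Inc_Ar by blast
  let ?a = "Dom C j" and ?b = "Cod C j"
  have jH: "j \<in> Hom C ?a ?b" using jAr by (simp add: Hom_def)
  have ab: "?a \<in> Ob C" "?b \<in> Ob C" using jAr Dom_closed Cod_closed by auto
  have idb: "Ide C ?b \<in> Inc C"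
    using category.Ide_Hom[OF inc(1), of ?b] ab by (auto simp: inc_cat_def Hom_def)
  have hI: "h \<in> Inc C"
    using Inc_factor[OF idb j, of h] h hj by (auto simp: Hom_def)
  have "(j \<Zcomp> h) \<Zcomp> j = j \<Zcomp> (h \<Zcomp> j)"
    using Cmp_assoc[OF jH h jH] .
  also have "\<dots> = Ide C ?a \<Zcomp> j" using hj Ide_left Ide_right jAr by simp
  finally have "j \<Zcomp> h = Ide C ?a"
    using Inc_mono[OF j] Cmp_Hom[OF jH h] Ide_Hom[OF ab(1)] unfolding is_mono_def by blast
  then have "is_iso (inc_cat C) j"
    using j hI h hj by (auto simp: is_iso_def inc_cat_def Hom_def)
  then show jid: "j = Ide C ?a" using inc(2) by blast
  have "Cod C (Ide C ?a) = ?a" using Ide_Hom[OF ab(1)] by (simp add: Hom_def)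
  with jid show ba: "?b = ?a" by simp
  have hA: "h \<in> Ar C" "Cod C h = ?a" using h by (auto simp: Hom_def)
  have "h \<Zcomp> Ide C ?a = h" using Ide_right[OF hA(1)] hA(2) by simp
  then have "h \<Zcomp> j = h" by (simp only: jid[symmetric])
  then show "h = Ide C ?a" using hj ba by simp
qed

lemma epi_part_Ide:
  assumes c: "c \<in> Ob C"
  shows "epi_part C (Ide C c) = Ide C c"
proof -
  have idc: "Ide C c \<in> Ar C" "Dom C (Ide C c) = c" "Cod C (Ide C c) = c"
    using Ide_Hom[OF c] by (auto simp: Hom_def)
  have *: "q \<Zcomp> u = Ide C c" if nf: "normal_factorisation C (Ide C c) q u j" for q u j
  proof -
    from nf obtain i where i: "retraction_of C i q" and u: "is_iso C u" and j: "j \<in> Inc C"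
      and qu: "Cod C q = Dom C u" and uj: "Cod C u = Dom C j"
      and e: "Ide C c = q \<Zcomp> u \<Zcomp> j"
      by (auto simp: normal_factorisation_def)
    have q: "q \<in> Hom C (Dom C q) (Dom C u)" using i qu by (auto simp: retraction_of_def Hom_def)
    have u': "u \<in> Hom C (Dom C u) (Dom C j)" using u uj by (auto simp: is_iso_def Hom_def)
    have j': "j \<in> Hom C (Dom C j) (Cod C j)" using j Inc_Ar by (auto simp: Hom_def)
    have h: "q \<Zcomp> u \<in> Hom C (Dom C q) (Dom C j)" using Cmp_Hom[OF q u'] .
    have "q \<Zcomp> u \<Zcomp> j \<in> Hom C (Dom C q) (Cod C j)" using Cmp_Hom[OF h j'] .
    then have dc: "Dom C q = c" "Cod C j = c" using e idc by (auto simp: Hom_def)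
    show ?thesis
      using Inc_split_epi_identity[OF j, of "q \<Zcomp> u"] h dc e by simp
  qed
  obtain q u j where "normal_factorisation C (Ide C c) q u j"
    using ex_normal_factorisation[OF idc(1)] by blast
  then have "\<exists>q u j. normal_factorisation C (Ide C c) q u j \<and> Ide C c = q \<Zcomp> u"
    using * by metis
  then show ?thesis
    unfolding epi_part_def by (rule the_equality) (use * in blast)
qed

lemma connected_category_all: "connected_category C (cone_classes C)"
proof (unfold_locales)
  fix c assume c: "c \<in> Ob C"
  obtain \<mu> where \<mu>: "is_cone C c \<mu>" "\<mu> c = Ide C c" using ex_cone[OF c] by blast
  have "cone_mult C \<mu> \<mu> = \<mu>"
  proof
    fix x
    show "cone_mult C \<mu> \<mu> x = \<mu> x"
    proof (cases "x \<in> Ob C")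
      case True
      then have "\<mu> x \<in> Ar C" "Cod C (\<mu> x) = c" using \<mu>(1) by (auto simp: is_cone_def Hom_def)
      then have "\<mu> x \<Zcomp> Ide C c = \<mu> x" using Ide_right[of "\<mu> x"] by simp
      then show ?thesis
        using True \<mu> by (simp add: cone_mult_def cone_star_def vertex_eq epi_part_Ide c)
    next
      case False
      then show ?thesis
        using \<mu>(1) by (simp add: cone_mult_def cone_star_def is_cone_def extensional_def)
    qed
  qed
  moreover have "\<mu> \<in> cones C" using \<mu>(1) by (auto simp: cones_def)
  ultimately have
    "idempotent_cone_at C c (green_R (cones C) (cone_mult C) `` {\<mu>}) \<mu>"
    "green_R (cones C) (cone_mult C) `` {\<mu>} \<in> cone_classes C"
    using \<mu>(1) unfolding cone_classes_def
    by (simp add: idempotent_cone_at_def green_R_def, blast intro: quotientI)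
  then show "\<exists>\<dd> \<in> cone_classes C. connected_by C c \<dd>"
    unfolding connected_by_def by blast
qed auto

end


section \<open>The two categories\<close>

text \<open>Both categories are taken relative to a universe \<open>'u\<close>: the elements of the monoids, and the
  objects and morphisms of the normal categories, are elements of the type \<open>'u\<close>. A morphism is
  tagged with its source and target. Records which differ only outside their carriers are
  distinct (isomorphic) objects. Only for infinite \<open>'u\<close> is the universe closed under the passage
  from a monoid to a category, as a finite monoid can have fewer elements than the category of
  its principal left ideals has morphisms.\<close>

definition regular_monoid :: "('a, 'z) monoid_scheme \<Rightarrow> bool" where
  "regular_monoid S \<longleftrightarrow> monoid S \<and>
     (\<forall>a \<in> carrier S. \<exists>x \<in> carrier S. a \<otimes>\<^bsub>S\<^esub> x \<otimes>\<^bsub>S\<^esub> a = a)"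

text \<open>The set \<open>hom S T\<close> consists of all semigroup homomorphisms; they need not preserve the
  identity element.\<close>

type_synonym 'u monoid_arrow = "'u monoid \<times> ('u \<Rightarrow> 'u) \<times> 'u monoid"

definition regular_monoids_cat :: "('u monoid, 'u monoid_arrow) cat" where
  "regular_monoids_cat =
     \<lparr>Ob = {S. regular_monoid S},
      Ar = {(S, h, T). regular_monoid S \<and> regular_monoid T \<and>
                       h \<in> hom S T \<and> h \<in> extensional (carrier S)},
      Dom = (\<lambda>(S, h, T). S),
      Cod = (\<lambda>(S, h, T). T),
      Ide = (\<lambda>S. (S, (\<lambda>x \<in> carrier S. x), S)),
      Cmp = (\<lambda>(S, h, T) (T', k, U). (S, compose (carrier S) k h, U))\<rparr>"

type_synonym 'u small_subcat = "('u, 'u) subcat"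

type_synonym 'u cc_arrow = "'u small_subcat \<times> ('u, 'u, 'u, 'u) cc_pair \<times> 'u small_subcat"

definition bounded_normal_categories_cat :: "('u small_subcat, 'u cc_arrow) cat" where
  "bounded_normal_categories_cat =
     \<lparr>Ob = {C. normal_category C \<and> bounded_above C},
      Ar = {(C, FG, C'). normal_category C \<and> bounded_above C \<and>
                         normal_category C' \<and> bounded_above C' \<and>
                         cc_morphism C (cone_classes C) C' (cone_classes C') FG},
      Dom = (\<lambda>(C, FG, C'). C),
      Cod = (\<lambda>(C, FG, C'). C'),
      Ide = (\<lambda>C. (C, cc_id C (cone_classes C), C)),
      Cmp = (\<lambda>(C, FG, C') (D, FG', D'). (C, cc_comp C (cone_classes C) FG FG', D'))\<rparr>"

end

theory Submission
  imports Defs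
begin

text \<open>A bounded above normal category \<open>C\<close> with greatest object \<open>d\<close> is sent to the monoid
  \<open>C(d, d)\<close>. Every \<open>f\<close> in it factors uniquely as a split epimorphism followed by an inclusion,
  and composing the inclusions into \<open>d\<close> with the split epimorphism gives a cone; this identifies
  \<open>C(d, d)\<close> with the semigroup of all cones. A CC-morphism \<open>(F, G)\<close> into \<open>C'\<close> acts by
  \<open>f \<mapsto> q F(f) j\<close>, where \<open>j\<close> is the inclusion of \<open>F(d)\<close> in \<open>d'\<close> and \<open>q\<close> is the value at \<open>d'\<close> of the
  idempotent cone \<open>\<epsilon>(F(d), G[1])\<close>, which retracts \<open>d'\<close> onto \<open>F(d)\<close>. This functor is fully
  faithful: both \<open>F\<close> and \<open>G\<close> can be written down in terms of the resulting homomorphism. It is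
  essentially surjective because a regular monoid is the endomorphism monoid of the greatest
  object in its category of principal left ideals.\<close>


section \<open>Categories and equivalences\<close>

text \<open>The obstacle is that nothing preserves the top: \<open>F(d)\<close> may be a proper
  subobject of \<open>d'\<close>, and a homomorphism need not send 1 to 1. The two defects match.
  The idempotent attached to the class of 1 is \<open>q j\<close>, which is also the value of
  \<open>f \<mapsto> q F(f) j\<close> at 1, and \<open>j q\<close> being an identity makes this map
  multiplicative. To recover \<open>(F, G)\<close>, an object is represented by an idempotent of
  \<open>C(d, d)\<close> with that image, an R-class by an idempotent in it. Such an
  \<open>e\<close> is matched with an idempotent \<open>e'\<close> of prescribed image and class,
  but \<open>F\<close> itself only shows the restriction \<open>j e'\<close> of \<open>e'\<close> to
  \<open>F(d)\<close>. The order on classes closes the gap: \<open>e\<close> lies below 1, so order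
  preservation of \<open>G\<close> gives \<open>q j e' = e'\<close>, and \<open>e'\<close> turns out
  to be the value of the homomorphism at \<open>e\<close>.\<close>

context category
begin

lemma Ide_simps [simp]:
  assumes "a \<in> Ob C"
  shows "Ide C a \<in> Ar C" "Dom C (Ide C a) = a" "Cod C (Ide C a) = a"
  using Ide_Hom[OF assms] by (auto simp: Hom_def)

lemma Cmp_simps [simp]:
  assumes "f \<in> Ar C" "g \<in> Ar C" "Cod C f = Dom C g"
  shows "f \<Zcomp> g \<in> Ar C" "Dom C (f \<Zcomp> g) = Dom C f" "Cod C (f \<Zcomp> g) = Cod C g"
  using Cmp_Hom[of f "Dom C f" "Dom C g" g "Cod C g"] assms by (auto simp: Hom_def)

lemma Ide_left' [simp]: "\<lbrakk>f \<in> Ar C; Dom C f = a\<rbrakk> \<Longrightarrow> Ide C a \<Zcomp> f = f"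
  using Ide_left by blast

lemma Ide_right' [simp]: "\<lbrakk>f \<in> Ar C; Cod C f = a\<rbrakk> \<Longrightarrow> f \<Zcomp> Ide C a = f"
  using Ide_right by blast

lemma assoc:
  "\<lbrakk>f \<in> Ar C; g \<in> Ar C; h \<in> Ar C; Cod C f = Dom C g; Cod C g = Dom C h\<rbrakk>
    \<Longrightarrow> (f \<Zcomp> g) \<Zcomp> h = f \<Zcomp> (g \<Zcomp> h)"
  using Cmp_assoc by (simp add: Hom_def)

text \<open>With \<open>assoc\<close> composites nest to the right, where an equation
  \<open>f g = k\<close> matches only if \<open>g\<close> comes last. This form lets it act in the
  middle of a chain.\<close>

lemma assoc_subst:
  "\<lbrakk>f \<Zcomp> g = k; f \<in> Ar C; g \<in> Ar C; h \<in> Ar C; Cod C f = Dom C g; Cod C g = Dom C h\<rbrakk>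
    \<Longrightarrow> f \<Zcomp> (g \<Zcomp> h) = k \<Zcomp> h"
  using assoc by metis

lemma is_isoI:
  "\<lbrakk>f \<in> Hom C a b; g \<in> Hom C b a; f \<Zcomp> g = Ide C a; g \<Zcomp> f = Ide C b\<rbrakk> \<Longrightarrow> is_iso C f"
  by (auto simp: is_iso_def Hom_def)

lemma is_isoE:
  assumes "is_iso C f" "f \<in> Hom C a b"
  obtains g where "g \<in> Hom C b a" "f \<Zcomp> g = Ide C a" "g \<Zcomp> f = Ide C b"
  using assms by (auto simp: is_iso_def Hom_def)

end

text \<open>The quasi-inverse sends \<open>f\<close> to the unique lift along \<open>\<Phi>\<close>
  of \<open>\<theta> f \<eta>\<close>. Each equation in \<open>B\<close> is checked in
  \<open>A\<close> after applying \<open>\<Phi>\<close>, where it reduces to \<open>\<theta>\<close>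
  and \<open>\<eta>\<close> being mutually inverse, and is then reflected by faithfulness.\<close>

lemma fully_faithful_surjective_equivalence:
  assumes "category A" "category B" and funct: "is_functor B A \<Phi>"
    and faithful: "\<And>a b f g. \<lbrakk>a \<in> Ob B; b \<in> Ob B; f \<in> Hom B a b; g \<in> Hom B a b;
          onAr \<Phi> f = onAr \<Phi> g\<rbrakk> \<Longrightarrow> f = g"
    and full: "\<And>a b h. \<lbrakk>a \<in> Ob B; b \<in> Ob B; h \<in> Hom A (onOb \<Phi> a) (onOb \<Phi> b)\<rbrakk>
          \<Longrightarrow> \<exists>f \<in> Hom B a b. onAr \<Phi> f = h"
    and surjective: "\<And>a. a \<in> Ob A \<Longrightarrow> \<exists>b \<in> Ob B. \<exists>\<eta> \<in> Hom A a (onOb \<Phi> b). is_iso A \<eta>"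
  shows "equivalent_categories A B"
proof -
  interpret A: category A by fact
  interpret B: category B by fact
  interpret \<Phi>: is_functor B A \<Phi> by fact
  have "\<forall>a \<in> Ob A. \<exists>b \<eta> \<theta>. b \<in> Ob B \<and> \<eta> \<in> Hom A a (onOb \<Phi> b) \<and> \<theta> \<in> Hom A (onOb \<Phi> b) a \<and>
      \<eta> \<Zcomp>\<^bsub>A\<^esub> \<theta> = Ide A a \<and> \<theta> \<Zcomp>\<^bsub>A\<^esub> \<eta> = Ide A (onOb \<Phi> b)"
    by (metis surjective A.is_isoE)
  then obtain P \<eta> \<theta> where P: "\<And>a. a \<in> Ob A \<Longrightarrow> P a \<in> Ob B"
    and \<eta>: "\<And>a. a \<in> Ob A \<Longrightarrow> \<eta> a \<in> Hom A a (onOb \<Phi> (P a))"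
    and \<theta>: "\<And>a. a \<in> Ob A \<Longrightarrow> \<theta> a \<in> Hom A (onOb \<Phi> (P a)) a"
    and \<eta>\<theta>: "\<And>a. a \<in> Ob A \<Longrightarrow> \<eta> a \<Zcomp>\<^bsub>A\<^esub> \<theta> a = Ide A a"
    and \<theta>\<eta>: "\<And>a. a \<in> Ob A \<Longrightarrow> \<theta> a \<Zcomp>\<^bsub>A\<^esub> \<eta> a = Ide A (onOb \<Phi> (P a))"
    by metis
  define lift where "lift a b h = (SOME f. f \<in> Hom B a b \<and> onAr \<Phi> f = h)" for a b h
  have lift: "lift a b h \<in> Hom B a b \<and> onAr \<Phi> (lift a b h) = h"
    if "a \<in> Ob B" "b \<in> Ob B" "h \<in> Hom A (onOb \<Phi> a) (onOb \<Phi> b)" for a b h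
    unfolding lift_def by (rule someI_ex) (use full[OF that] in blast)
  have lift_eq: "lift a b h = f"
    if "a \<in> Ob B" "b \<in> Ob B" "f \<in> Hom B a b" "onAr \<Phi> f = h" for a b h f
    using that lift[of a b h] faithful \<Phi>.onAr_Hom by blast
  define conj where "conj f = \<theta> (Dom A f) \<Zcomp>\<^bsub>A\<^esub> f \<Zcomp>\<^bsub>A\<^esub> \<eta> (Cod A f)" for f
  have conj: "conj f \<in> Hom A (onOb \<Phi> (P a)) (onOb \<Phi> (P b))"
    and conj_eq: "conj f = \<theta> a \<Zcomp>\<^bsub>A\<^esub> f \<Zcomp>\<^bsub>A\<^esub> \<eta> b"
    if "f \<in> Hom A a b" for f a b
  proof -
    have "a \<in> Ob A" "b \<in> Ob A" using that A.Dom_closed A.Cod_closed by (auto simp: Hom_def)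
    moreover have "Dom A f = a" "Cod A f = b" using that by (auto simp: Hom_def)
    ultimately show "conj f = \<theta> a \<Zcomp>\<^bsub>A\<^esub> f \<Zcomp>\<^bsub>A\<^esub> \<eta> b"
        "conj f \<in> Hom A (onOb \<Phi> (P a)) (onOb \<Phi> (P b))"
      using A.Cmp_Hom[OF A.Cmp_Hom[OF \<theta> that] \<eta>] by (auto simp: conj_def)
  qed
  define F where "F = \<lparr>onOb = P, onAr = (\<lambda>f. lift (P (Dom A f)) (P (Cod A f)) (conj f))\<rparr>"
  have F_Ar: "onAr F f \<in> Hom B (P a) (P b)" "onAr \<Phi> (onAr F f) = \<theta> a \<Zcomp>\<^bsub>A\<^esub> f \<Zcomp>\<^bsub>A\<^esub> \<eta> b"
    if "f \<in> Hom A a b" for f a b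
  proof -
    have ab: "a \<in> Ob A" "b \<in> Ob A" using that A.Dom_closed A.Cod_closed by (auto simp: Hom_def)
    have "onAr F f = lift (P a) (P b) (conj f)" using that by (auto simp: F_def Hom_def)
    then show "onAr F f \<in> Hom B (P a) (P b)" "onAr \<Phi> (onAr F f) = \<theta> a \<Zcomp>\<^bsub>A\<^esub> f \<Zcomp>\<^bsub>A\<^esub> \<eta> b"
      using lift[OF P P conj[OF that]] ab conj_eq[OF that] by auto
  qed
  have typing: "\<eta> a \<in> Ar A" "Dom A (\<eta> a) = a" "Cod A (\<eta> a) = onOb \<Phi> (P a)"
      "\<theta> a \<in> Ar A" "Dom A (\<theta> a) = onOb \<Phi> (P a)" "Cod A (\<theta> a) = a" if "a \<in> Ob A" for a
    using \<eta>[OF that] \<theta>[OF that] by (auto simp: Hom_def)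
  have F: "is_functor A B F"
  proof
    fix a assume a: "a \<in> Ob A"
    then show "onOb F a \<in> Ob B" by (simp add: F_def P)
    have "onAr \<Phi> (Ide B (P a)) = \<theta> a \<Zcomp>\<^bsub>A\<^esub> Ide A a \<Zcomp>\<^bsub>A\<^esub> \<eta> a"
      using a typing by (simp add: \<theta>\<eta> \<Phi>.onAr_Ide P)
    then show "onAr F (Ide A a) = Ide B (onOb F a)"
      using faithful[OF P[OF a] P[OF a]] F_Ar[OF A.Ide_Hom[OF a]] B.Ide_Hom[OF P[OF a]]
      by (auto simp: F_def)
  next
    fix f a b assume "f \<in> Hom A a b"
    then show "onAr F f \<in> Hom B (onOb F a) (onOb F b)" using F_Ar by (simp add: F_def)
  next
    fix f a b g c assume f: "f \<in> Hom A a b" and g: "g \<in> Hom A b c"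
    have ab: "a \<in> Ob A" "b \<in> Ob A" "c \<in> Ob A"
      using f g A.Dom_closed A.Cod_closed by (auto simp: Hom_def)
    have "onAr \<Phi> (onAr F f \<Zcomp>\<^bsub>B\<^esub> onAr F g)
        = (\<theta> a \<Zcomp>\<^bsub>A\<^esub> f \<Zcomp>\<^bsub>A\<^esub> \<eta> b) \<Zcomp>\<^bsub>A\<^esub> (\<theta> b \<Zcomp>\<^bsub>A\<^esub> g \<Zcomp>\<^bsub>A\<^esub> \<eta> c)"
      using \<Phi>.onAr_Cmp[OF F_Ar(1)[OF f] F_Ar(1)[OF g]] F_Ar(2)[OF f] F_Ar(2)[OF g] by simp
    also have "\<dots> = \<theta> a \<Zcomp>\<^bsub>A\<^esub> (f \<Zcomp>\<^bsub>A\<^esub> g) \<Zcomp>\<^bsub>A\<^esub> \<eta> c"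
      using f g ab typing by (simp add: Hom_def A.assoc A.assoc_subst[OF \<eta>\<theta>])
    finally have "onAr \<Phi> (onAr F f \<Zcomp>\<^bsub>B\<^esub> onAr F g) = onAr \<Phi> (onAr F (f \<Zcomp>\<^bsub>A\<^esub> g))"
      using F_Ar(2)[OF A.Cmp_Hom[OF f g]] by simp
    then show "onAr F (f \<Zcomp>\<^bsub>A\<^esub> g) = onAr F f \<Zcomp>\<^bsub>B\<^esub> onAr F g"
      using faithful[OF P P F_Ar(1)[OF A.Cmp_Hom[OF f g]] B.Cmp_Hom[OF F_Ar(1)[OF f] F_Ar(1)[OF g]]]
        ab by simp
  qed
  have unit: "naturally_isomorphic A A id_functor (comp_functor F \<Phi>)"
    unfolding naturally_isomorphic_def
  proof (intro exI[of _ \<eta>] conjI ballI)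
    fix a assume a: "a \<in> Ob A"
    show "\<eta> a \<in> Hom A (onOb id_functor a) (onOb (comp_functor F \<Phi>) a)"
      using \<eta>[OF a] by (simp add: id_functor_def comp_functor_def F_def)
    show "is_iso A (\<eta> a)" using A.is_isoI[OF \<eta>[OF a] \<theta>[OF a] \<eta>\<theta>[OF a] \<theta>\<eta>[OF a]] .
  next
    fix f assume f: "f \<in> Ar A"
    then have fH: "f \<in> Hom A (Dom A f) (Cod A f)" by (simp add: Hom_def)
    have "Dom A f \<in> Ob A" "Cod A f \<in> Ob A" using f A.Dom_closed A.Cod_closed by auto
    then show "onAr id_functor f \<Zcomp>\<^bsub>A\<^esub> \<eta> (Cod A f)
        = \<eta> (Dom A f) \<Zcomp>\<^bsub>A\<^esub> onAr (comp_functor F \<Phi>) f"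
      using f typing F_Ar(2)[OF fH]
      by (simp add: id_functor_def comp_functor_def A.assoc A.assoc_subst[OF \<eta>\<theta>])
  qed
  \<comment> \<open>The counit is the lift of \<open>\<theta>\<close>; lifting \<open>\<eta>\<close>
    as well yields its inverse.\<close>
  define \<tau> where "\<tau> b = lift (P (onOb \<Phi> b)) b (\<theta> (onOb \<Phi> b))" for b
  have \<tau>: "\<tau> b \<in> Hom B (P (onOb \<Phi> b)) b" "onAr \<Phi> (\<tau> b) = \<theta> (onOb \<Phi> b)" if "b \<in> Ob B" for b
    using lift[OF P that \<theta>] \<Phi>.onOb_closed[OF that] by (auto simp: \<tau>_def)
  have \<tau>_iso: "is_iso B (\<tau> b)" if b: "b \<in> Ob B" for b
  proof -
    have pb: "onOb \<Phi> b \<in> Ob A" using \<Phi>.onOb_closed[OF b] .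
    note Pb = P[OF pb]
    obtain \<sigma> where \<sigma>: "\<sigma> \<in> Hom B b (P (onOb \<Phi> b))" "onAr \<Phi> \<sigma> = \<eta> (onOb \<Phi> b)"
      using full[OF b Pb \<eta>[OF pb]] by blast
    have "\<tau> b \<Zcomp>\<^bsub>B\<^esub> \<sigma> = Ide B (P (onOb \<Phi> b))"
      by (rule faithful[OF Pb Pb B.Cmp_Hom[OF \<tau>(1)[OF b] \<sigma>(1)] B.Ide_Hom[OF Pb]])
        (simp add: \<Phi>.onAr_Cmp[OF \<tau>(1)[OF b] \<sigma>(1)] \<tau> \<sigma> b \<theta>\<eta> pb \<Phi>.onAr_Ide Pb)
    moreover have "\<sigma> \<Zcomp>\<^bsub>B\<^esub> \<tau> b = Ide B b"
      by (rule faithful[OF b b B.Cmp_Hom[OF \<sigma>(1) \<tau>(1)[OF b]] B.Ide_Hom[OF b]])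
        (simp add: \<Phi>.onAr_Cmp[OF \<sigma>(1) \<tau>(1)[OF b]] \<tau> \<sigma> b \<eta>\<theta> pb \<Phi>.onAr_Ide)
    ultimately show ?thesis using B.is_isoI[OF \<tau>(1)[OF b] \<sigma>(1)] by blast
  qed
  have counit: "naturally_isomorphic B B (comp_functor \<Phi> F) id_functor"
    unfolding naturally_isomorphic_def
  proof (intro exI[of _ \<tau>] conjI ballI)
    fix b assume b: "b \<in> Ob B"
    show "\<tau> b \<in> Hom B (onOb (comp_functor \<Phi> F) b) (onOb id_functor b)"
      using \<tau>[OF b] by (simp add: id_functor_def comp_functor_def F_def)
    show "is_iso B (\<tau> b)" using \<tau>_iso[OF b] .
  next
    fix g assume g: "g \<in> Ar B"
    define a b where "a = Dom B g" and "b = Cod B g"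
    have gH: "g \<in> Hom B a b" using g by (simp add: Hom_def a_def b_def)
    have ab: "a \<in> Ob B" "b \<in> Ob B" using g B.Dom_closed B.Cod_closed by (auto simp: a_def b_def)
    note pab = \<Phi>.onOb_closed[OF ab(1)] \<Phi>.onOb_closed[OF ab(2)]
    note pg = \<Phi>.onAr_Hom[OF gH]
    note Fg = F_Ar[OF pg]
    have "onAr F (onAr \<Phi> g) \<Zcomp>\<^bsub>B\<^esub> \<tau> b = \<tau> a \<Zcomp>\<^bsub>B\<^esub> g"
    proof (rule faithful[OF P[OF pab(1)] ab(2) B.Cmp_Hom[OF Fg(1) \<tau>(1)[OF ab(2)]]
          B.Cmp_Hom[OF \<tau>(1)[OF ab(1)] gH]])
      show "onAr \<Phi> (onAr F (onAr \<Phi> g) \<Zcomp>\<^bsub>B\<^esub> \<tau> b) = onAr \<Phi> (\<tau> a \<Zcomp>\<^bsub>B\<^esub> g)"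
        using pg pab typing
        by (simp add: \<Phi>.onAr_Cmp[OF Fg(1) \<tau>(1)[OF ab(2)]] \<Phi>.onAr_Cmp[OF \<tau>(1)[OF ab(1)] gH]
            Fg(2) \<tau>(2) ab Hom_def A.assoc \<eta>\<theta>)
    qed
    then show "onAr (comp_functor \<Phi> F) g \<Zcomp>\<^bsub>B\<^esub> \<tau> (Cod B g)
        = \<tau> (Dom B g) \<Zcomp>\<^bsub>B\<^esub> onAr id_functor g"
      by (simp add: id_functor_def comp_functor_def a_def b_def)
  qed
  show ?thesis
    unfolding equivalent_categories_def
    using A.category_axioms B.category_axioms F funct unit counit by blast
qed


section \<open>Factorisations and cones in normal categories\<close>

context category_with_subobjects
begin

lemma inc_category: "category (inc_cat C)"
  using Inc_strict_preorder by (simp add: strict_preorder_def)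

lemma Inc_in_Ar [simp]: "j \<in> Inc C \<Longrightarrow> j \<in> Ar C"
  using Inc_Ar by blast

lemma Inc_unique:
  assumes "i \<in> Inc C" "j \<in> Inc C" "Dom C i = Dom C j" "Cod C i = Cod C j"
  shows "i = j"
proof -
  have "\<forall>a b. \<forall>f \<in> Hom (inc_cat C) a b. \<forall>g \<in> Hom (inc_cat C) a b. f = g"
    using Inc_strict_preorder by (simp add: strict_preorder_def)
  then show ?thesis using assms by (auto simp: Hom_def inc_cat_def)
qed

lemma Ide_Inc [simp]: "a \<in> Ob C \<Longrightarrow> Ide C a \<in> Inc C"
  using category.Ide_Hom[OF inc_category, of a] by (simp add: Hom_def inc_cat_def)

lemma Cmp_Inc [simp]:
  "\<lbrakk>i \<in> Inc C; j \<in> Inc C; Cod C i = Dom C j\<rbrakk> \<Longrightarrow> i \<Zcomp> j \<in> Inc C"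
  using category.Cmp_Hom[OF inc_category, of i "Dom C i" "Dom C j" j "Cod C j"]
  by (simp add: Hom_def inc_cat_def)

text \<open>Parallel inclusions coincide, so opposite inclusions are mutually inverse in the
  inclusion category, whose only isomorphisms are identities.\<close>

lemma Inc_antisym:
  assumes "i \<in> Inc C" "j \<in> Inc C" "Cod C i = Dom C j" "Cod C j = Dom C i"
  shows "Dom C i = Cod C i"
proof -
  note * = assms Dom_closed Cod_closed
  have "i \<Zcomp> j = Ide C (Dom C i)" "j \<Zcomp> i = Ide C (Cod C i)"
    using * by (auto intro!: Inc_unique)
  then have "is_iso (inc_cat C) i"
    using assms by (auto simp: is_iso_def inc_cat_def Hom_def)
  then have "i = Ide C (Dom C i)"
    using Inc_strict_preorder by (auto simp: strict_preorder_def inc_cat_def)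
  then show ?thesis using * by (metis Ide_simps(3) Inc_in_Ar)
qed

lemma Inc_cancel:
  assumes "j \<in> Inc C" "f \<in> Ar C" "g \<in> Ar C" "Cod C f = Dom C j" "Cod C g = Dom C j"
    "Dom C f = Dom C g" "f \<Zcomp> j = g \<Zcomp> j"
  shows "f = g"
  using Inc_mono[OF assms(1)] assms unfolding is_mono_def Hom_def by blast

text \<open>In a normal category these are the composites of a retraction and an isomorphism, that
  is, the possible values of \<open>epi_part\<close>. In this form closure under composition is
  immediate.\<close>

definition split_epi :: "'m \<Rightarrow> bool" where
  "split_epi e \<longleftrightarrow> e \<in> Ar C \<and> (\<exists>s \<in> Hom C (Cod C e) (Dom C e). s \<Zcomp> e = Ide C (Cod C e))"

lemma split_epi_in_Ar [simp]: "split_epi e \<Longrightarrow> e \<in> Ar C"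
  by (simp add: split_epi_def)

lemma split_epiI:
  "\<lbrakk>e \<in> Ar C; s \<in> Ar C; Dom C s = Cod C e; Cod C s = Dom C e; s \<Zcomp> e = Ide C (Cod C e)\<rbrakk>
    \<Longrightarrow> split_epi e"
  unfolding split_epi_def Hom_def by blast

lemma split_epiE:
  assumes "split_epi e"
  obtains s where "s \<in> Ar C" "Dom C s = Cod C e" "Cod C s = Dom C e" "s \<Zcomp> e = Ide C (Cod C e)"
  using assms unfolding split_epi_def Hom_def by blast

lemma split_epi_Cmp:
  assumes "split_epi e" "split_epi f" "Cod C e = Dom C f"
  shows "split_epi (e \<Zcomp> f)"
proof -
  obtain s where s: "s \<in> Ar C" "Dom C s = Cod C e" "Cod C s = Dom C e" "s \<Zcomp> e = Ide C (Cod C e)"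
    using split_epiE[OF assms(1)] .
  obtain t where t: "t \<in> Ar C" "Dom C t = Cod C f" "Cod C t = Dom C f" "t \<Zcomp> f = Ide C (Cod C f)"
    using split_epiE[OF assms(2)] .
  show ?thesis
    by (rule split_epiI[of _ "t \<Zcomp> s"])
      (use assms s t in \<open>simp_all add: assoc assoc_subst[OF s(4)]\<close>)
qed

text \<open>The inclusion part of a factorisation is compared first: cancelling one of the split
  epimorphisms exhibits each of the two inclusions as a left multiple of the other.\<close>

lemma split_epi_factor:
  assumes e: "split_epi e" and f: "f \<in> Ar C" and i: "i \<in> Inc C" and j: "j \<in> Inc C"
    and comp: "Cod C e = Dom C i" "Cod C f = Dom C j" and eq: "e \<Zcomp> i = f \<Zcomp> j"
  obtains k where "k \<in> Inc C" "Dom C k = Dom C i" "Cod C k = Dom C j" "i = k \<Zcomp> j"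
proof -
  obtain s where s: "s \<in> Ar C" "Dom C s = Cod C e" "Cod C s = Dom C e" "s \<Zcomp> e = Ide C (Cod C e)"
    using split_epiE[OF e] .
  have eAr: "e \<in> Ar C" using e by simp
  have "Dom C (e \<Zcomp> i) = Dom C e" "Dom C (f \<Zcomp> j) = Dom C f" using eAr f i j comp by auto
  then have d: "Dom C e = Dom C f" using eq by simp
  have "i = s \<Zcomp> (e \<Zcomp> i)" using eAr s i comp by (simp add: assoc_subst[OF s(4)])
  also have "\<dots> = (s \<Zcomp> f) \<Zcomp> j" using s f j comp d eq by (simp add: assoc)
  finally have *: "i = (s \<Zcomp> f) \<Zcomp> j" .
  then have "s \<Zcomp> f \<in> Inc C" using Inc_factor[OF i j _ _ *] s f comp d by simp
  with * show thesis using that[of "s \<Zcomp> f"] s f comp d by simp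
qed

text \<open>Comparison in both directions gives opposite inclusions of the middle objects, which
  antisymmetry identifies. Then \<open>i\<close> and \<open>j\<close> are parallel inclusions, hence
  equal, and as a monomorphism this inclusion cancels.\<close>

lemma factorisation_unique:
  assumes e: "split_epi e" and f: "split_epi f" and i: "i \<in> Inc C" and j: "j \<in> Inc C"
    and comp: "Cod C e = Dom C i" "Cod C f = Dom C j" and eq: "e \<Zcomp> i = f \<Zcomp> j"
  shows "e = f" "i = j"
proof -
  note Ar = split_epi_in_Ar[OF e] split_epi_in_Ar[OF f]
  obtain k where k: "k \<in> Inc C" "Dom C k = Dom C i" "Cod C k = Dom C j" "i = k \<Zcomp> j"
    using split_epi_factor[OF e Ar(2) i j comp eq] .
  obtain k' where k': "k' \<in> Inc C" "Dom C k' = Dom C j" "Cod C k' = Dom C i" "j = k' \<Zcomp> i"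
    using split_epi_factor[OF f Ar(1) j i comp(2,1) eq[symmetric]] .
  have d: "Dom C i = Dom C j" using Inc_antisym[OF k(1) k'(1)] k(2,3) k'(2,3) by simp
  have c: "Dom C (e \<Zcomp> i) = Dom C e" "Dom C (f \<Zcomp> j) = Dom C f" 
    "Cod C (e \<Zcomp> i) = Cod C i" "Cod C (f \<Zcomp> j) = Cod C j"
    using Ar i j comp by auto
  have d': "Dom C e = Dom C f" "Cod C i = Cod C j" using c eq by metis+
  show ij: "i = j" by (rule Inc_unique) (use i j d d' in auto)
  show "e = f" by (rule Inc_cancel[OF i]) (use Ar i j comp d' eq ij in auto)
qed

end

section \<open>Normal factorisations and uniqueness of the epimorphic part\<close>

context normal_category
begin

text \<open>The last conclusion keeps the retraction and the isomorphism behind \<open>e\<close>,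
  because \<open>split_epi_iso\<close> has to take \<open>e\<close> apart again.\<close>

lemma ex_factorisation:
  assumes f: "f \<in> Ar C"
  obtains e j where "split_epi e" "j \<in> Inc C" "Cod C e = Dom C j" "Dom C e = Dom C f"
    "Cod C j = Cod C f" "f = e \<Zcomp> j" "\<exists>q u. normal_factorisation C f q u j \<and> e = q \<Zcomp> u"
proof -
  obtain q u j where nf: "normal_factorisation C f q u j"
    using ex_normal_factorisation[OF f] by blast
  then obtain i where i: "retraction_of C i q" and u: "is_iso C u" and j: "j \<in> Inc C"
    and c: "Cod C q = Dom C u" "Cod C u = Dom C j" and eq: "f = q \<Zcomp> u \<Zcomp> j"
    by (auto simp: normal_factorisation_def)
  have q: "q \<in> Ar C" "split_epi q"
    using i by (auto simp: retraction_of_def Hom_def intro: split_epiI[of _ i])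
  have u': "u \<in> Ar C" "split_epi u" using u by (auto simp: is_iso_def split_epi_def)
  have e: "split_epi (q \<Zcomp> u)" using split_epi_Cmp[OF q(2) u'(2) c(1)] .
  show thesis
    by (rule that[OF e j]) (use q u' j c eq nf in auto)
qed

text \<open>Resolves the definite description in \<open>epi_part\<close> from any factorisation into
  a split epimorphism and an inclusion, without exhibiting a retraction and an isomorphism.\<close>

lemma epi_part_unique:
  assumes e: "split_epi e" and j: "j \<in> Inc C" and c: "Cod C e = Dom C j"
  shows "epi_part C (e \<Zcomp> j) = e"
proof -
  have *: "q \<Zcomp> u = e" if "normal_factorisation C (e \<Zcomp> j) q u i" for q u i
  proof -
    from that obtain k where k: "retraction_of C k q" and u: "is_iso C u" and i: "i \<in> Inc C"
      and c': "Cod C q = Dom C u" "Cod C u = Dom C i" and eq: "e \<Zcomp> j = q \<Zcomp> u \<Zcomp> i"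
      by (auto simp: normal_factorisation_def)
    have q: "q \<in> Ar C" "split_epi q"
      using k by (auto simp: retraction_of_def Hom_def intro: split_epiI[of _ k])
    have u': "u \<in> Ar C" "split_epi u" using u by (auto simp: is_iso_def split_epi_def)
    show ?thesis
      using factorisation_unique(1)[OF e split_epi_Cmp[OF q(2) u'(2) c'(1)] j i c _ eq] q u' c'
      by simp
  qed
  have ej: "e \<Zcomp> j \<in> Ar C" using e j c by simp
  obtain q u i where nf: "normal_factorisation C (e \<Zcomp> j) q u i"
    using ex_normal_factorisation[OF ej] by blast
  show ?thesis
    unfolding epi_part_def
    by (rule the_equality) (use * nf in metis)+
qed

text \<open>Comparing a normal factorisation \<open>q u j\<close> of \<open>e\<close> with
  \<open>e\<close> followed by an identity gives \<open>e = q u\<close>. The inclusion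
  \<open>i\<close> that \<open>q\<close> retracts then satisfies \<open>i e = u\<close>. This
  supplies the isomorphism that every cone must contain.\<close>

lemma split_epi_iso:
  assumes e: "split_epi e"
  obtains i where "i \<in> Inc C" "Cod C i = Dom C e" "is_iso C (i \<Zcomp> e)"
proof -
  have eAr: "e \<in> Ar C" using e by simp
  have "e = e \<Zcomp> Ide C (Cod C e)" using eAr by simp
  then have ee: "epi_part C e = e"
    using epi_part_unique[OF e, of "Ide C (Cod C e)"] eAr Cod_closed by auto
  obtain f j where f: "split_epi f" "j \<in> Inc C" "Cod C f = Dom C j" "e = f \<Zcomp> j"
    and ex: "\<exists>q u. normal_factorisation C e q u j \<and> f = q \<Zcomp> u"
    using ex_factorisation[OF eAr] by metis
  obtain q u where nf: "normal_factorisation C e q u j" "f = q \<Zcomp> u" using ex by blast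
  have equ: "e = q \<Zcomp> u" using epi_part_unique[OF f(1-3)] f(4) ee nf(2) by metis
  obtain i where i: "retraction_of C i q" and u: "is_iso C u" and c: "Cod C q = Dom C u"
    using nf by (auto simp: normal_factorisation_def)
  have i': "i \<in> Inc C" "q \<in> Ar C" "Dom C q = Cod C i" "Cod C q = Dom C i"
      "i \<Zcomp> q = Ide C (Dom C i)" "u \<in> Ar C"
    using i u by (auto simp: retraction_of_def Hom_def is_iso_def)
  have "i \<Zcomp> e = u" using i' c equ by (simp add: assoc_subst[OF i'(5)])
  then show thesis using that[of i] i' u equ c by simp
qed

end

text \<open>Junk values when the inclusion, respectively a greatest object, does not exist.\<close>

definition inclusion :: "('o, 'm, 'z) subcat_scheme \<Rightarrow> 'o \<Rightarrow> 'o \<Rightarrow> 'm" where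
  "inclusion C a b = (THE j. j \<in> Inc C \<and> Dom C j = a \<and> Cod C j = b)"

definition top_ob :: "('o, 'm, 'z) subcat_scheme \<Rightarrow> 'o" where
  "top_ob C = (THE d. d \<in> Ob C \<and> (\<forall>c \<in> Ob C. subobj C c d))"

definition top_inc :: "('o, 'm, 'z) subcat_scheme \<Rightarrow> 'o \<Rightarrow> 'm" where
  "top_inc C c = inclusion C c (top_ob C)"

definition top_end :: "('o, 'm, 'z) subcat_scheme \<Rightarrow> 'm set" where
  "top_end C = Hom C (top_ob C) (top_ob C)"

definition image_ob :: "('o, 'm, 'z) subcat_scheme \<Rightarrow> 'm \<Rightarrow> 'o" where
  "image_ob C f = Cod C (epi_part C f)"

text \<open>The epimorphic part is taken instead of \<open>f\<close> so that the components end at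
  the image of \<open>f\<close>, where one of them can be an isomorphism.\<close>

definition principal_cone :: "('o, 'm, 'z) subcat_scheme \<Rightarrow> 'm \<Rightarrow> ('o \<Rightarrow> 'm)" where
  "principal_cone C f = (\<lambda>c \<in> Ob C. top_inc C c \<Zcomp>\<^bsub>C\<^esub> epi_part C f)"

text \<open>Containment of principal right ideals in the monoid \<open>top_end C\<close>.\<close>

definition right_le :: "('o, 'm, 'z) subcat_scheme \<Rightarrow> 'm \<Rightarrow> 'm \<Rightarrow> bool" where
  "right_le C f g \<longleftrightarrow> (\<exists>x \<in> top_end C. f = g \<Zcomp>\<^bsub>C\<^esub> x)"

text \<open>The R-class of \<open>f\<close> in the monoid \<open>top_end C\<close>, carried over to
  cones; \<open>green_R_class\<close> matches it with the R-class in the semigroup of cones.\<close>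

definition cone_class :: "('o, 'm, 'z) subcat_scheme \<Rightarrow> 'm \<Rightarrow> ('o \<Rightarrow> 'm) set" where
  "cone_class C f = principal_cone C ` {g \<in> top_end C. right_le C f g \<and> right_le C g f}"

lemma (in category_with_subobjects) top_ob_eq:
  assumes z: "z \<in> Ob C" "\<And>c. c \<in> Ob C \<Longrightarrow> subobj C c z"
  shows "top_ob C = z"
  unfolding top_ob_def
proof (rule the_equality)
  fix y assume "y \<in> Ob C \<and> (\<forall>c \<in> Ob C. subobj C c y)"
  then have "subobj C y z" "subobj C z y" using z by auto
  then show "y = z" using Inc_antisym by (fastforce simp: subobj_def Hom_def)
qed (use z in blast)

section \<open>Cones as endomorphisms of the greatest object\<close>

locale bounded_normal_category = normal_category C
  for C :: "('o, 'm, 'z) subcat_scheme" (structure) +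
  assumes bounded: "bounded_above C"
begin

abbreviation "d \<equiv> top_ob C"
abbreviation "\<j> c \<equiv> top_inc C c"
abbreviation "M \<equiv> top_end C"

lemma inclusion_eq: "j \<in> Inc C \<Longrightarrow> inclusion C (Dom C j) (Cod C j) = j"
  unfolding inclusion_def by (rule the_equality) (auto intro: Inc_unique)

lemma top_ob: "d \<in> Ob C" "c \<in> Ob C \<Longrightarrow> subobj C c d"
proof -
  obtain z where z: "z \<in> Ob C" "\<And>c. c \<in> Ob C \<Longrightarrow> subobj C c z"
    using bounded by (auto simp: bounded_above_def)
  then have "d = z" by (rule top_ob_eq)
  with z show "d \<in> Ob C" "c \<in> Ob C \<Longrightarrow> subobj C c d" by auto
qed

declare top_ob(1) [simp]

lemma top_inc [simp]:
  assumes "c \<in> Ob C"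
  shows "\<j> c \<in> Inc C" "\<j> c \<in> Ar C" "Dom C (\<j> c) = c" "Cod C (\<j> c) = d"
proof -
  obtain j where j: "j \<in> Inc C" "Dom C j = c" "Cod C j = d"
    using top_ob(2)[OF assms] by (auto simp: subobj_def Hom_def)
  then have "\<j> c = j" using inclusion_eq[of j] by (simp add: top_inc_def)
  with j show "\<j> c \<in> Inc C" "\<j> c \<in> Ar C" "Dom C (\<j> c) = c" "Cod C (\<j> c) = d" by auto
qed

lemma top_inc_eq: "\<lbrakk>j \<in> Inc C; Cod C j = d\<rbrakk> \<Longrightarrow> \<j> (Dom C j) = j"
  using inclusion_eq[of j] by (simp add: top_inc_def)

lemma top_inc_top [simp]: "\<j> d = Ide C d"
  using top_inc_eq[of "Ide C d"] by simp

lemma Inc_top_inc: "j \<in> Inc C \<Longrightarrow> j \<Zcomp> \<j> (Cod C j) = \<j> (Dom C j)"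
  using top_inc_eq[of "j \<Zcomp> \<j> (Cod C j)"] Cod_closed by simp

lemma top_end_iff: "f \<in> M \<longleftrightarrow> f \<in> Ar C \<and> Dom C f = d \<and> Cod C f = d"
  by (auto simp: top_end_def Hom_def)

lemma top_end_Cmp [simp]: "\<lbrakk>f \<in> M; g \<in> M\<rbrakk> \<Longrightarrow> f \<Zcomp> g \<in> M"
  by (simp add: top_end_iff)

lemma top_end_Ide [simp]: "Ide C d \<in> M"
  by (simp add: top_end_iff)

lemma retraction:
  assumes "c \<in> Ob C"
  obtains r where "r \<in> Ar C" "Dom C r = d" "Cod C r = c" "\<j> c \<Zcomp> r = Ide C c"
  using Inc_splits[OF top_inc(1)[OF assms]] assms that by (auto simp: retraction_of_def Hom_def)

lemma image_eq:
  assumes "split_epi e" "Dom C e = d" "Cod C e = c"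
  shows "epi_part C (e \<Zcomp> \<j> c) = e" "image_ob C (e \<Zcomp> \<j> c) = c"
proof -
  have "c \<in> Ob C" using assms Cod_closed split_epi_in_Ar by blast
  then show "epi_part C (e \<Zcomp> \<j> c) = e" using epi_part_unique assms by simp
  then show "image_ob C (e \<Zcomp> \<j> c) = c" using assms by (simp add: image_ob_def)
qed

lemma image:
  assumes f: "f \<in> M"
  shows "split_epi (epi_part C f)" "epi_part C f \<in> Ar C" "Dom C (epi_part C f) = d"
    "Cod C (epi_part C f) = image_ob C f" "image_ob C f \<in> Ob C"
    "epi_part C f \<Zcomp> \<j> (image_ob C f) = f"
proof -
  have fA: "f \<in> Ar C" "Dom C f = d" "Cod C f = d" using f by (auto simp: top_end_iff)
  obtain e j where e: "split_epi e" "j \<in> Inc C" "Cod C e = Dom C j" "Dom C e = Dom C f"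
    "Cod C j = Cod C f" "f = e \<Zcomp> j"
    using ex_factorisation[OF fA(1)] by metis
  have 1: "epi_part C f = e" using e epi_part_unique by simp
  then have 2: "image_ob C f = Dom C j" using e by (simp add: image_ob_def)
  then have "\<j> (image_ob C f) = j" using top_inc_eq[OF e(2)] e(5) fA by simp
  with 1 2 e fA show "split_epi (epi_part C f)" "epi_part C f \<in> Ar C" "Dom C (epi_part C f) = d"
    "Cod C (epi_part C f) = image_ob C f" "image_ob C f \<in> Ob C"
    "epi_part C f \<Zcomp> \<j> (image_ob C f) = f"
    using Cod_closed[of e] by auto
qed

text \<open>The required isomorphism component comes from \<open>split_epi_iso\<close>: the split
  epimorphism at \<open>d\<close> becomes invertible on some subobject of \<open>d\<close>.\<close>

lemma is_cone_principal_cone: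
  assumes f: "f \<in> M"
  shows "is_cone C (image_ob C f) (principal_cone C f)"
  unfolding is_cone_def
proof (intro conjI ballI)
  note im = image[OF f]
  show "image_ob C f \<in> Ob C" using im by simp
  show "principal_cone C f \<in> extensional (Ob C)" by (simp add: principal_cone_def)
  show "principal_cone C f c \<in> Hom C c (image_ob C f)" if "c \<in> Ob C" for c
    using that im by (simp add: principal_cone_def Hom_def)
  show "j \<Zcomp> principal_cone C f (Cod C j) = principal_cone C f (Dom C j)" if "j \<in> Inc C" for j
    using that im Dom_closed Cod_closed
    by (simp add: principal_cone_def assoc_subst[OF Inc_top_inc[OF that]])
  obtain i where i: "i \<in> Inc C" "Cod C i = d" "is_iso C (i \<Zcomp> epi_part C f)"
    using split_epi_iso[OF im(1)] im by metis
  then have "principal_cone C f (Dom C i) = i \<Zcomp> epi_part C f"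
    using top_inc_eq[OF i(1,2)] Dom_closed[of i] by (simp add: principal_cone_def)
  then show "\<exists>c \<in> Ob C. is_iso C (principal_cone C f c)"
    using i Dom_closed[of i] by (intro bexI[of _ "Dom C i"]) auto
qed

lemma vertex_principal_cone [simp]: "f \<in> M \<Longrightarrow> vertex C (principal_cone C f) = image_ob C f"
  using is_cone_principal_cone vertex_eq by metis

lemma principal_cone_top [simp]: "f \<in> M \<Longrightarrow> principal_cone C f d = epi_part C f"
  using image(2,3) by (simp add: principal_cone_def)

text \<open>\<open>f\<close> is recovered as the component at \<open>d\<close> followed by the
  inclusion of its codomain into \<open>d\<close>.\<close>

lemma principal_cone_eq_iff [simp]:
  "\<lbrakk>f \<in> M; g \<in> M\<rbrakk> \<Longrightarrow> principal_cone C f = principal_cone C g \<longleftrightarrow> f = g"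
  by (metis image(4,6) principal_cone_top)

text \<open>Every object being a subobject of \<open>d\<close>, a cone consists of the restrictions
  of its component at \<open>d\<close>. If \<open>s\<close> inverts the component at
  \<open>c\<close>, then \<open>s\<close> followed by \<open>\<j> c\<close> is a section of
  \<open>\<gamma> d\<close>, which is therefore a split epimorphism onto the vertex.\<close>

lemma cone_is_principal:
  assumes \<gamma>: "is_cone C z \<gamma>"
  obtains f where "f \<in> M" "\<gamma> = principal_cone C f" "image_ob C f = z"
proof -
  have z: "z \<in> Ob C" using \<gamma> by (simp add: is_cone_def)
  have \<gamma>H: "\<gamma> c \<in> Ar C" "Dom C (\<gamma> c) = c" "Cod C (\<gamma> c) = z" if "c \<in> Ob C" for c
    using \<gamma> that by (auto simp: is_cone_def Hom_def)
  have \<gamma>j: "\<gamma> c = \<j> c \<Zcomp> \<gamma> d" if "c \<in> Ob C" for c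
    using \<gamma> that top_inc[OF that] unfolding is_cone_def by metis
  obtain c where c: "c \<in> Ob C" "is_iso C (\<gamma> c)" using \<gamma> by (auto simp: is_cone_def)
  obtain s where s: "s \<in> Ar C" "Dom C s = z" "Cod C s = c" "s \<Zcomp> \<gamma> c = Ide C z"
    using c \<gamma>H[OF c(1)] by (auto simp: is_iso_def Hom_def)
  have "split_epi (\<gamma> d)"
    by (rule split_epiI[of _ "s \<Zcomp> \<j> c"])
      (use s c \<gamma>H \<gamma>j[OF c(1), symmetric] in \<open>simp_all add: assoc\<close>)
  then have im: "epi_part C (\<gamma> d \<Zcomp> \<j> z) = \<gamma> d" "image_ob C (\<gamma> d \<Zcomp> \<j> z) = z"
    using image_eq \<gamma>H by auto
  have "principal_cone C (\<gamma> d \<Zcomp> \<j> z) c = \<gamma> c" for c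
    using \<gamma>j[symmetric] im \<gamma>
    by (cases "c \<in> Ob C") (simp_all add: principal_cone_def is_cone_def extensional_def)
  then have "\<gamma> = principal_cone C (\<gamma> d \<Zcomp> \<j> z)" by (intro ext) simp
  then show thesis using that[of "\<gamma> d \<Zcomp> \<j> z"] im \<gamma>H z by (simp add: top_end_iff)
qed

lemma cones_eq: "cones C = principal_cone C ` M"
proof
  show "cones C \<subseteq> principal_cone C ` M"
  proof
    fix \<gamma> assume "\<gamma> \<in> cones C"
    then obtain z where "is_cone C z \<gamma>" by (auto simp: cones_def)
    then obtain f where "f \<in> M" "\<gamma> = principal_cone C f" using cone_is_principal by metis
    then show "\<gamma> \<in> principal_cone C ` M" by simp
  qed
  show "principal_cone C ` M \<subseteq> cones C"
    using is_cone_principal_cone by (auto simp: cones_def)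
qed

lemma cones_iff: "\<gamma> \<in> cones C \<longleftrightarrow> (\<exists>f \<in> M. \<gamma> = principal_cone C f)"
  using cones_eq by blast

text \<open>Write \<open>f = a j\<close> and \<open>g = b k\<close> with split epimorphisms
  \<open>a\<close>, \<open>b\<close> and inclusions \<open>j\<close>, \<open>k\<close>. The
  component of the second cone at the image of \<open>f\<close> is \<open>j b\<close>. Factoring it
  as \<open>e i\<close> gives \<open>f g = (a e) (i k)\<close>, so the epimorphic part of the
  product is \<open>a e\<close>, which is what the multiplication of cones produces.\<close>

lemma cone_mult_principal_cone:
  assumes f: "f \<in> M" and g: "g \<in> M"
  shows "cone_mult C (principal_cone C f) (principal_cone C g) = principal_cone C (f \<Zcomp> g)"
proof -
  note imf = image[OF f] and img = image[OF g]
  let ?m = "\<j> (image_ob C f) \<Zcomp> epi_part C g"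
  have m: "?m \<in> Ar C" "Dom C ?m = image_ob C f" "Cod C ?m = image_ob C g" using imf img by auto
  obtain e i where e: "split_epi e" "i \<in> Inc C" "Cod C e = Dom C i" "Dom C e = image_ob C f"
    "Cod C i = image_ob C g" "?m = e \<Zcomp> i"
    using ex_factorisation[OF m(1)] m by metis
  have em: "epi_part C ?m = e" using e epi_part_unique by simp
  have ej: "i \<Zcomp> \<j> (image_ob C g) = \<j> (Dom C i)" using Inc_top_inc[OF e(2)] e by simp
  have Di: "Dom C i \<in> Ob C" using e Dom_closed by simp
  have eA: "e \<in> Ar C" using e by simp
  have "f \<Zcomp> g = (epi_part C f \<Zcomp> \<j> (image_ob C f)) \<Zcomp> (epi_part C g \<Zcomp> \<j> (image_ob C g))"
    using imf(6) img(6) by simp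
  also have "\<dots> = epi_part C f \<Zcomp> (?m \<Zcomp> \<j> (image_ob C g))"
    using imf(1-5) img(1-5) by (simp add: assoc)
  also have "\<dots> = (epi_part C f \<Zcomp> e) \<Zcomp> \<j> (Dom C i)"
    unfolding e(6) using imf(1-5) img(1-5) e(1-5) Di eA ej by (simp add: assoc)
  finally have fg: "f \<Zcomp> g = (epi_part C f \<Zcomp> e) \<Zcomp> \<j> (Dom C i)" .
  have "epi_part C (f \<Zcomp> g) = epi_part C f \<Zcomp> e"
    unfolding fg
    by (rule image_eq) (use split_epi_Cmp[OF imf(1) e(1)] imf(1-5) e(1-5) eA in simp_all)
  moreover have "principal_cone C g (image_ob C f) = ?m" using imf by (simp add: principal_cone_def)
  then have "cone_mult C (principal_cone C f) (principal_cone C g) = cone_star C (principal_cone C f) e"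
    by (simp add: cone_mult_def f em)
  ultimately show ?thesis
    using imf(1-5) e(1-5) eA
    by (auto simp: cone_star_def principal_cone_def assoc intro!: restrict_ext)
qed

section \<open>Principal right ideals, R-classes and their order\<close>

lemma right_le_refl [simp]: "f \<in> M \<Longrightarrow> right_le C f f"
  unfolding right_le_def by (rule bexI[of _ "Ide C d"]) (auto simp: top_end_iff)

lemma right_le_Cmp [simp]: "x \<in> M \<Longrightarrow> right_le C (f \<Zcomp> x) f"
  unfolding right_le_def by blast

lemma right_le_trans:
  assumes "right_le C f g" "right_le C g h" "h \<in> M"
  shows "right_le C f h"
proof -
  obtain x y where "x \<in> M" "y \<in> M" "f = g \<Zcomp> x" "g = h \<Zcomp> y"
    using assms by (auto simp: right_le_def)
  then show ?thesis
    unfolding right_le_def using assms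
    by (intro bexI[of _ "y \<Zcomp> x"]) (auto simp: top_end_iff assoc)
qed

lemma right_le_Ide [simp]: "f \<in> M \<Longrightarrow> right_le C f (Ide C d)"
  unfolding right_le_def by (rule bexI[of _ f]) (auto simp: top_end_iff)

lemma right_le_idem_iff:
  assumes "e \<in> M" "f \<in> M" "e \<Zcomp> e = e"
  shows "right_le C f e \<longleftrightarrow> e \<Zcomp> f = f"
proof
  assume "right_le C f e"
  then obtain x where "x \<in> M" "f = e \<Zcomp> x" by (auto simp: right_le_def)
  then show "e \<Zcomp> f = f" using assms by (simp add: top_end_iff assoc_subst[OF assms(3)])
next
  assume "e \<Zcomp> f = f"
  then show "right_le C f e" unfolding right_le_def using assms by (intro bexI[of _ f]) simp_all
qed

text \<open>\<open>cone_mult_principal_cone\<close> turns the principal right ideal of the cone of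
  \<open>h\<close> into the image of \<open>h M\<close>, and injectivity of the map to cones lets
  containment be read back.\<close>

lemma principal_right_ideal_subset_iff:
  assumes f: "f \<in> M" and g: "g \<in> M"
  shows "principal_right_ideal (cones C) (cone_mult C) (principal_cone C f)
      \<subseteq> principal_right_ideal (cones C) (cone_mult C) (principal_cone C g) \<longleftrightarrow> right_le C f g"
proof -
  have *: "principal_right_ideal (cones C) (cone_mult C) (principal_cone C h)
      = principal_cone C ` {x \<in> M. right_le C x h}" (is "?l h = ?r h") if h: "h \<in> M" for h
  proof
    show "?l h \<subseteq> ?r h"
      using h by (auto simp: principal_right_ideal_def cones_iff cone_mult_principal_cone)
    show "?r h \<subseteq> ?l h"
    proof
      fix \<gamma> assume "\<gamma> \<in> ?r h"
      then obtain y where "y \<in> M" "\<gamma> = principal_cone C (h \<Zcomp> y)" by (auto simp: right_le_def)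
      then have "\<gamma> = cone_mult C (principal_cone C h) (principal_cone C y)" "principal_cone C y \<in> cones C"
        using h by (auto simp: cone_mult_principal_cone cones_iff)
      then show "\<gamma> \<in> ?l h" by (auto simp: principal_right_ideal_def)
    qed
  qed
  show ?thesis
  proof
    assume "?l f \<subseteq> ?l g"
    then have "principal_cone C f \<in> ?r g" using * f g by auto
    then show "right_le C f g" using f by auto
  next
    assume "right_le C f g"
    then show "?l f \<subseteq> ?l g" using * f g right_le_trans by auto
  qed
qed

lemma green_R_class:
  assumes f: "f \<in> M"
  shows "green_R (cones C) (cone_mult C) `` {principal_cone C f} = cone_class C f"
proof -
  have "principal_right_ideal (cones C) (cone_mult C) (principal_cone C f)
      = principal_right_ideal (cones C) (cone_mult C) (principal_cone C g) \<longleftrightarrow>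
      right_le C f g \<and> right_le C g f" if "g \<in> M" for g
    using principal_right_ideal_subset_iff[OF f that] principal_right_ideal_subset_iff[OF that f]
    by blast
  then show ?thesis using f by (auto simp: green_R_def cone_class_def cones_iff)
qed

lemma cone_classes_eq: "cone_classes C = cone_class C ` M"
proof -
  let ?R = "green_R (cones C) (cone_mult C)"
  have "(\<lambda>\<gamma>. ?R `` {\<gamma>}) ` X = cone_class C ` M" if "X = principal_cone C ` M" for X
    by (simp add: that image_image green_R_class)
  then have "(\<lambda>\<gamma>. ?R `` {\<gamma>}) ` cones C = cone_class C ` M" using cones_eq by blast
  moreover have "cone_classes C = (\<lambda>\<gamma>. ?R `` {\<gamma>}) ` cones C"
    by (auto simp: cone_classes_def quotient_def)
  ultimately show ?thesis by simp
qed

lemma cone_class_in [simp]: "f \<in> M \<Longrightarrow> cone_class C f \<in> cone_classes C"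
  by (simp add: cone_classes_eq)

lemma principal_cone_in_class_iff:
  "\<lbrakk>f \<in> M; g \<in> M\<rbrakk> \<Longrightarrow> principal_cone C g \<in> cone_class C f \<longleftrightarrow> right_le C f g \<and> right_le C g f"
  by (auto simp: cone_class_def)

lemma cone_class_eq_iff:
  "\<lbrakk>f \<in> M; g \<in> M\<rbrakk> \<Longrightarrow> cone_class C f = cone_class C g \<longleftrightarrow> right_le C f g \<and> right_le C g f"
proof
  assume f: "f \<in> M" and g: "g \<in> M" and "cone_class C f = cone_class C g"
  then show "right_le C f g \<and> right_le C g f"
    using principal_cone_in_class_iff[OF f f] principal_cone_in_class_iff[OF g f] by simp
next
  assume "f \<in> M" "g \<in> M" "right_le C f g \<and> right_le C g f"
  then show "cone_class C f = cone_class C g"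
    unfolding cone_class_def by (intro arg_cong2[where f = image] refl Collect_cong) (blast intro: right_le_trans)
qed

lemma class_le_iff:
  assumes f: "f \<in> M" and g: "g \<in> M"
  shows "class_le C (cone_class C f) (cone_class C g) \<longleftrightarrow> right_le C f g"
proof
  assume "class_le C (cone_class C f) (cone_class C g)"
  then obtain x y where "x \<in> M" "y \<in> M" "right_le C f x" "right_le C y g" "right_le C x y"
    by (auto simp: class_le_def cone_class_def principal_right_ideal_subset_iff)
  then show "right_le C f g" using g by (blast intro: right_le_trans)
next
  assume "right_le C f g"
  then show "class_le C (cone_class C f) (cone_class C g)"
    unfolding class_le_def using f g
    by (intro bexI[of _ "principal_cone C f"] bexI[of _ "principal_cone C g"])
      (auto simp: principal_right_ideal_subset_iff principal_cone_in_class_iff)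
qed

section \<open>Idempotent cones, images and connectedness\<close>

lemma idempotent_cone_at_iff:
  assumes "e \<in> M" "f \<in> M"
  shows "idempotent_cone_at C c (cone_class C f) (principal_cone C e) \<longleftrightarrow>
    right_le C f e \<and> right_le C e f \<and> image_ob C e = c \<and> e \<Zcomp> e = e"
proof -
  have "is_cone C c (principal_cone C e) \<longleftrightarrow> image_ob C e = c"
    using is_cone_principal_cone[OF assms(1)] vertex_eq assms(1) vertex_principal_cone by metis
  then show ?thesis
    using assms by (auto simp: idempotent_cone_at_def principal_cone_in_class_iff
        cone_mult_principal_cone)
qed

text \<open>With \<open>e = r j\<close> and a section \<open>s\<close> of \<open>r\<close>,
  composing \<open>e e = e\<close> with \<open>s\<close> on the left yields
  \<open>j r j = j\<close>, and the monomorphism \<open>j\<close> cancels.\<close>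

lemma idempotent_image:
  assumes e: "e \<in> M" "e \<Zcomp> e = e"
  shows "\<j> (image_ob C e) \<Zcomp> epi_part C e = Ide C (image_ob C e)"
proof -
  note im = image[OF e(1)]
  let ?c = "image_ob C e"
  obtain s where s: "s \<in> Ar C" "Dom C s = ?c" "Cod C s = d" "s \<Zcomp> epi_part C e = Ide C ?c"
    using split_epiE[OF im(1)] im by metis
  have "s \<Zcomp> (e \<Zcomp> e) = s \<Zcomp> ((epi_part C e \<Zcomp> \<j> ?c) \<Zcomp> (epi_part C e \<Zcomp> \<j> ?c))"
    using im(6) by simp
  also have "\<dots> = (\<j> ?c \<Zcomp> epi_part C e) \<Zcomp> \<j> ?c"
    using im(1-5) s by (simp add: assoc_subst[OF s(4)] assoc)
  finally have 1: "s \<Zcomp> (e \<Zcomp> e) = (\<j> ?c \<Zcomp> epi_part C e) \<Zcomp> \<j> ?c" .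
  have "s \<Zcomp> e = s \<Zcomp> (epi_part C e \<Zcomp> \<j> ?c)" by (simp add: im(6))
  also have "\<dots> = Ide C ?c \<Zcomp> \<j> ?c"
    using im(1-5) s by (simp add: assoc_subst[OF s(4)])
  finally have 2: "s \<Zcomp> e = Ide C ?c \<Zcomp> \<j> ?c" .
  show ?thesis
    by (rule Inc_cancel[of "\<j> ?c"]) (use im 1 2 e in auto)
qed

text \<open>Converse of \<open>idempotent_image\<close>: each retraction of \<open>d\<close> onto
  \<open>c\<close> is the epimorphic part of an idempotent with image \<open>c\<close>.\<close>

lemma idempotent_of_retraction:
  assumes c: "c \<in> Ob C" and r: "r \<in> Ar C" "Dom C r = d" "Cod C r = c" "\<j> c \<Zcomp> r = Ide C c"
  shows "r \<Zcomp> \<j> c \<in> M" "(r \<Zcomp> \<j> c) \<Zcomp> (r \<Zcomp> \<j> c) = r \<Zcomp> \<j> c" "image_ob C (r \<Zcomp> \<j> c) = c"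
    "epi_part C (r \<Zcomp> \<j> c) = r"
proof -
  have "split_epi r" by (rule split_epiI[of _ "\<j> c"]) (use c r in auto)
  then show "image_ob C (r \<Zcomp> \<j> c) = c" "epi_part C (r \<Zcomp> \<j> c) = r" using image_eq r by auto
  show "r \<Zcomp> \<j> c \<in> M" "(r \<Zcomp> \<j> c) \<Zcomp> (r \<Zcomp> \<j> c) = r \<Zcomp> \<j> c"
    using c r by (auto simp: top_end_iff assoc assoc_subst[OF r(4)])
qed

text \<open>\<open>e\<close> restricts to the identity on its image, and \<open>f\<close> ends in
  the same subobject.\<close>

lemma image_cong_idempotent:
  assumes e: "e \<in> M" "e \<Zcomp> e = e" and f: "f \<in> M"
    and c: "image_ob C f = image_ob C e"
  shows "f \<Zcomp> e = f"
proof -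
  note ime = image[OF e(1)] and imf = image[OF f]
  have "f \<Zcomp> e = epi_part C f \<Zcomp> (\<j> (image_ob C e) \<Zcomp> epi_part C e) \<Zcomp> \<j> (image_ob C e)"
  proof -
    have "f \<Zcomp> e = (epi_part C f \<Zcomp> \<j> (image_ob C e)) \<Zcomp> (epi_part C e \<Zcomp> \<j> (image_ob C e))"
      using imf(6) ime(6) c by simp
    then show ?thesis using ime(1-5) imf(1-5) c by (simp add: assoc)
  qed
  also have "\<dots> = f" using idempotent_image[OF e] imf c by simp
  finally show ?thesis .
qed

text \<open>From \<open>f g = f\<close> come two factorisations of \<open>f\<close>, through its own
  image and through that of \<open>g\<close>. The first starts with a split epimorphism, so
  \<open>split_epi_factor\<close> yields the inclusion.\<close>

lemma image_le:
  assumes f: "f \<in> M" and g: "g \<in> M" and fg: "f \<Zcomp> g = f"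
  obtains k where "k \<in> Inc C" "Dom C k = image_ob C f" "Cod C k = image_ob C g"
proof -
  note imf = image[OF f] and img = image[OF g]
  have "(f \<Zcomp> epi_part C g) \<Zcomp> \<j> (image_ob C g) = f \<Zcomp> g"
    using f imf img by (simp add: assoc top_end_iff)
  then have *: "epi_part C f \<Zcomp> \<j> (image_ob C f) = (f \<Zcomp> epi_part C g) \<Zcomp> \<j> (image_ob C g)"
    using fg imf by simp
  have ends: "f \<Zcomp> epi_part C g \<in> Ar C" "\<j> (image_ob C f) \<in> Inc C" "\<j> (image_ob C g) \<in> Inc C"
    "Cod C (epi_part C f) = Dom C (\<j> (image_ob C f))"
    "Cod C (f \<Zcomp> epi_part C g) = Dom C (\<j> (image_ob C g))"
    using imf(1-5) img(1-5) f by (simp_all add: top_end_iff)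
  obtain k where "k \<in> Inc C" "Dom C k = Dom C (\<j> (image_ob C f))" "Cod C k = Dom C (\<j> (image_ob C g))"
    using split_epi_factor[OF imf(1) ends *] .
  then show thesis using that imf(5) img(5) by simp
qed

lemma image_eqI:
  assumes "f \<in> M" "g \<in> M" "f \<Zcomp> g = f" "g \<Zcomp> f = g"
  shows "image_ob C f = image_ob C g"
proof -
  obtain k where "k \<in> Inc C" "Dom C k = image_ob C f" "Cod C k = image_ob C g"
    using image_le assms by metis
  moreover obtain k' where "k' \<in> Inc C" "Dom C k' = image_ob C g" "Cod C k' = image_ob C f"
    using image_le assms by metis
  ultimately show ?thesis using Inc_antisym by metis
qed

text \<open>Resolves the definite description. Another idempotent \<open>g\<close> of the class with
  this image satisfies \<open>g e = e\<close> because the two are R-related, and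
  \<open>g e = g\<close> because their images agree.\<close>

lemma idem_cone_eq:
  assumes e: "e \<in> M" "e \<Zcomp> e = e" and f: "f \<in> M" "right_le C f e" "right_le C e f"
  shows "idem_cone C (image_ob C e) (cone_class C f) = principal_cone C e"
  unfolding idem_cone_def
proof (rule the_equality)
  show "idempotent_cone_at C (image_ob C e) (cone_class C f) (principal_cone C e)"
    using idempotent_cone_at_iff[OF e(1) f(1)] assms by simp
  fix \<gamma> assume \<gamma>: "idempotent_cone_at C (image_ob C e) (cone_class C f) \<gamma>"
  then obtain g where g: "g \<in> M" "\<gamma> = principal_cone C g"
    by (auto simp: idempotent_cone_at_def cone_class_def)
  then have g': "right_le C f g" "right_le C g f" "image_ob C g = image_ob C e" "g \<Zcomp> g = g"
    using \<gamma> idempotent_cone_at_iff[OF g(1) f(1)] by auto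
  have "right_le C e g" using g g' f e by (blast intro: right_le_trans)
  then have "g \<Zcomp> e = e" using right_le_idem_iff[OF g(1) e(1) g'(4)] by simp
  moreover have "g \<Zcomp> e = g" using image_cong_idempotent[OF e g(1) g'(3)] .
  ultimately show "\<gamma> = principal_cone C e" using g by simp
qed

lemma connected_by_iff:
  assumes f: "f \<in> M"
  shows "connected_by C c (cone_class C f) \<longleftrightarrow>
    (\<exists>e \<in> M. e \<Zcomp> e = e \<and> image_ob C e = c \<and> right_le C f e \<and> right_le C e f)"
proof
  assume "connected_by C c (cone_class C f)"
  then obtain \<gamma> where \<gamma>: "idempotent_cone_at C c (cone_class C f) \<gamma>"
    by (auto simp: connected_by_def)
  then obtain g where g: "g \<in> M" "\<gamma> = principal_cone C g"
    by (auto simp: idempotent_cone_at_def cone_class_def)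
  then show "\<exists>e \<in> M. e \<Zcomp> e = e \<and> image_ob C e = c \<and> right_le C f e \<and> right_le C e f"
    using \<gamma> idempotent_cone_at_iff[OF g(1) f] by auto
next
  assume "\<exists>e \<in> M. e \<Zcomp> e = e \<and> image_ob C e = c \<and> right_le C f e \<and> right_le C e f"
  then show "connected_by C c (cone_class C f)"
    unfolding connected_by_def using idempotent_cone_at_iff[OF _ f] by blast
qed

text \<open>The witness is \<open>r s\<close>, with \<open>r\<close> a retraction onto the image and
  \<open>s\<close> a section of the epimorphic part: \<open>f r\<close> is that part and
  \<open>s f\<close> is the inclusion of the image.\<close>

lemma top_end_regular:
  assumes f: "f \<in> M"
  obtains x where "x \<in> M" "f \<Zcomp> x \<Zcomp> f = f"
proof -
  note im = image[OF f]
  obtain s where s: "s \<in> Ar C" "Dom C s = image_ob C f" "Cod C s = d"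
    "s \<Zcomp> epi_part C f = Ide C (image_ob C f)"
    using split_epiE[OF im(1)] im by metis
  obtain r where r: "r \<in> Ar C" "Dom C r = d" "Cod C r = image_ob C f"
    "\<j> (image_ob C f) \<Zcomp> r = Ide C (image_ob C f)"
    using retraction[OF im(5)] .
  have fr: "f \<Zcomp> r = epi_part C f"
  proof -
    have "f \<Zcomp> r = (epi_part C f \<Zcomp> \<j> (image_ob C f)) \<Zcomp> r" using im(6) by simp
    then show ?thesis using im(1-5) r by (simp add: assoc)
  qed
  have sf: "s \<Zcomp> f = \<j> (image_ob C f)"
  proof -
    have "s \<Zcomp> f = s \<Zcomp> (epi_part C f \<Zcomp> \<j> (image_ob C f))" using im(6) by simp
    then show ?thesis using im(1-5) s by (simp add: assoc_subst[OF s(4)])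
  qed
  have "f \<Zcomp> (r \<Zcomp> s) \<Zcomp> f = (f \<Zcomp> r) \<Zcomp> (s \<Zcomp> f)"
    using f r s by (simp add: assoc top_end_iff)
  also have "\<dots> = f" using fr sf im by simp
  finally show thesis using that[of "r \<Zcomp> s"] r s by (simp add: top_end_iff)
qed

text \<open>If \<open>f x f = f\<close>, then \<open>f x\<close> is an idempotent R-related to
  \<open>f\<close>. Maps on classes can thus be computed on idempotents alone.\<close>

lemma cone_class_idempotent:
  assumes "\<dd> \<in> cone_classes C"
  obtains e where "e \<in> M" "e \<Zcomp> e = e" "\<dd> = cone_class C e"
proof -
  obtain f where f: "f \<in> M" "\<dd> = cone_class C f" using assms by (auto simp: cone_classes_eq)
  obtain x where x: "x \<in> M" "f \<Zcomp> x \<Zcomp> f = f" using top_end_regular[OF f(1)] .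
  have "(f \<Zcomp> x) \<Zcomp> (f \<Zcomp> x) = (f \<Zcomp> x \<Zcomp> f) \<Zcomp> x" using f x(1) by (simp add: top_end_iff assoc)
  then have "(f \<Zcomp> x) \<Zcomp> (f \<Zcomp> x) = f \<Zcomp> x" by (simp add: x(2))
  moreover have "right_le C f (f \<Zcomp> x)" "right_le C (f \<Zcomp> x) f"
    unfolding right_le_def by (rule bexI[of _ f]; use f x in simp) (use f x in auto)
  ultimately show thesis using that[of "f \<Zcomp> x"] f x by (simp add: cone_class_eq_iff)
qed

end


section \<open>Composition of CC-morphisms\<close>

text \<open>The hypothesis on \<open>idem_cone\<close> is there because \<open>cc_id\<close> acts as
  the identity only on arrows, while \<open>idem_cone\<close> is a definite description. Bounded
  above categories supply it through their principal cones. \<open>cc_morphism_cc_comp\<close>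
  carries the same hypothesis for the same reason.\<close>

lemma (in connected_category) cc_morphism_cc_id:
  assumes idem_cone_in_Ar: "\<And>c \<dd> c'. \<lbrakk>\<dd> \<in> \<DD>; connected_by C c \<dd>; c' \<in> Ob C\<rbrakk>
    \<Longrightarrow> idem_cone C c \<dd> c' \<in> Ar C"
  shows "cc_morphism C \<DD> C \<DD> (cc_id C \<DD>)"
proof (intro cc_morphism.intro cc_morphism_axioms.intro)
  show "connected_category C \<DD>" "connected_category C \<DD>" by (fact connected_category_axioms)+
  show "is_functor C C (fst (cc_id C \<DD>))"
    by standard (auto simp: cc_id_def Hom_def Dom_closed Cod_closed)
next
  fix c \<dd> c' assume "c \<in> Ob C" "\<dd> \<in> \<DD>" "connected_by C c \<dd>" "c' \<in> Ob C"
  then show "onAr (fst (cc_id C \<DD>)) (idem_cone C c \<dd> c')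
      = idem_cone C (onOb (fst (cc_id C \<DD>)) c) (snd (cc_id C \<DD>) \<dd>) (onOb (fst (cc_id C \<DD>)) c')"
    using idem_cone_in_Ar by (simp add: cc_id_def)
qed (use Inc_Ar in \<open>auto simp: cc_id_def\<close>)

lemma cc_morphism_cc_comp:
  assumes "cc_morphism C \<DD> D \<DD>' FG" "cc_morphism D \<DD>' E \<DD>'' FG'"
    and cone: "\<And>c \<dd> c'. \<lbrakk>\<dd> \<in> \<DD>; connected_by C c \<dd>; c' \<in> Ob C\<rbrakk> \<Longrightarrow> idem_cone C c \<dd> c' \<in> Ar C"
  shows "cc_morphism C \<DD> E \<DD>'' (cc_comp C \<DD> FG FG')"
proof -
  interpret f: cc_morphism C \<DD> D \<DD>' FG by fact
  interpret g: cc_morphism D \<DD>' E \<DD>'' FG' by fact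
  interpret F: is_functor C D "fst FG" by (rule f.functor_F)
  interpret G: is_functor D E "fst FG'" by (rule g.functor_F)
  note simps = cc_comp_def compose_def
  have Ob: "onOb (fst FG) c \<in> Ob D" if "c \<in> Ob C" for c using F.onOb_closed[OF that] .
  have cl: "snd FG \<dd> \<in> \<DD>'" if "\<dd> \<in> \<DD>" for \<dd> using f.G_closed that by blast
  show ?thesis
  proof (intro cc_morphism.intro cc_morphism_axioms.intro)
    show "connected_category C \<DD>" "connected_category E \<DD>''" by unfold_locales
    show "is_functor C E (fst (cc_comp C \<DD> FG FG'))"
    proof
      fix a assume "a \<in> Ob C"
      then show "onOb (fst (cc_comp C \<DD> FG FG')) a \<in> Ob E"
        by (simp add: simps Ob G.onOb_closed)
      then show "onAr (fst (cc_comp C \<DD> FG FG')) (Ide C a)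
          = Ide E (onOb (fst (cc_comp C \<DD> FG FG')) a)"
        using \<open>a \<in> Ob C\<close> by (simp add: simps F.onAr_Ide G.onAr_Ide Ob)
    next
      fix f a b assume f: "f \<in> Hom C a b"
      then have "f \<in> Ar C" "a \<in> Ob C" "b \<in> Ob C"
        using f.source.Dom_closed f.source.Cod_closed by (auto simp: Hom_def)
      then show "onAr (fst (cc_comp C \<DD> FG FG')) f
          \<in> Hom E (onOb (fst (cc_comp C \<DD> FG FG')) a) (onOb (fst (cc_comp C \<DD> FG FG')) b)"
        using G.onAr_Hom[OF F.onAr_Hom[OF f]] by (simp add: simps)
    next
      fix f a b g c assume f: "f \<in> Hom C a b" and g: "g \<in> Hom C b c"
      have "f \<in> Ar C" "g \<in> Ar C" "f \<Zcomp>\<^bsub>C\<^esub> g \<in> Ar C"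
        using f g f.source.Cmp_Hom[OF f g] by (auto simp: Hom_def)
      then show "onAr (fst (cc_comp C \<DD> FG FG')) (f \<Zcomp>\<^bsub>C\<^esub> g)
          = onAr (fst (cc_comp C \<DD> FG FG')) f \<Zcomp>\<^bsub>E\<^esub> onAr (fst (cc_comp C \<DD> FG FG')) g"
        using F.onAr_Cmp[OF f g] G.onAr_Cmp[OF F.onAr_Hom[OF f] F.onAr_Hom[OF g]]
        by (simp add: simps)
    qed
    show "onOb (fst (cc_comp C \<DD> FG FG')) \<in> extensional (Ob C)"
      "onAr (fst (cc_comp C \<DD> FG FG')) \<in> extensional (Ar C)"
      by (simp_all add: simps)
    show "snd (cc_comp C \<DD> FG FG') \<in> \<DD> \<rightarrow>\<^sub>E \<DD>''"
      using cl g.G_closed by (auto simp: simps)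
  next
    fix j assume j: "j \<in> Inc C"
    then have "j \<in> Ar C" using f.source.Inc_Ar by blast
    then show "onAr (fst (cc_comp C \<DD> FG FG')) j \<in> Inc E"
      using g.F_Inc[OF f.F_Inc[OF j]] by (simp add: simps)
  next
    fix \<dd> \<ee> assume "\<dd> \<in> \<DD>" "\<ee> \<in> \<DD>" "class_le C \<dd> \<ee>"
    then show "class_le E (snd (cc_comp C \<DD> FG FG') \<dd>) (snd (cc_comp C \<DD> FG FG') \<ee>)"
      using g.G_mono[OF cl cl f.G_mono] by (simp add: simps)
  next
    fix c \<dd> assume *: "c \<in> Ob C" "\<dd> \<in> \<DD>" "connected_by C c \<dd>"
    note D = f.FG_connected[OF *]
    show "connected_by E (onOb (fst (cc_comp C \<DD> FG FG')) c) (snd (cc_comp C \<DD> FG FG') \<dd>)"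
      using g.FG_connected[OF Ob cl D] * by (simp add: simps)
    fix c' assume c': "c' \<in> Ob C"
    show "onAr (fst (cc_comp C \<DD> FG FG')) (idem_cone C c \<dd> c')
        = idem_cone E (onOb (fst (cc_comp C \<DD> FG FG')) c) (snd (cc_comp C \<DD> FG FG') \<dd>)
            (onOb (fst (cc_comp C \<DD> FG FG')) c')"
      using f.FG_idem_cone[OF * c'] g.FG_idem_cone[OF Ob cl D Ob[OF c']] cone[OF *(2,3) c'] * c'
      by (simp add: simps)
  qed
qed

lemma cc_comp_assoc:
  assumes "is_functor C D (fst FG)" "snd FG \<in> \<DD> \<rightarrow>\<^sub>E \<DD>'"
  shows "cc_comp C \<DD> (cc_comp C \<DD> FG FG') FG'' = cc_comp C \<DD> FG (cc_comp D \<DD>' FG' FG'')"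
proof -
  interpret is_functor C D "fst FG" by fact
  have "onAr (fst FG) f \<in> Ar D" if "f \<in> Ar C" for f
    using onAr_Hom[of f "Dom C f" "Cod C f"] that by (simp add: Hom_def)
  then show ?thesis
    using assms(2) onOb_closed by (auto simp: cc_comp_def compose_def fun_eq_iff)
qed

lemma cc_comp_cc_id:
  assumes "is_functor C D (fst FG)" "onOb (fst FG) \<in> extensional (Ob C)"
    "onAr (fst FG) \<in> extensional (Ar C)" "snd FG \<in> \<DD> \<rightarrow>\<^sub>E \<DD>'"
  shows "cc_comp C \<DD> (cc_id C \<DD>) FG = FG" "cc_comp C \<DD> FG (cc_id D \<DD>') = FG"
proof -
  interpret is_functor C D "fst FG" by fact
  have *: "onAr (fst FG) f \<in> Ar D" if "f \<in> Ar C" for f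
    using onAr_Hom[of f "Dom C f" "Cod C f"] that by (simp add: Hom_def)
  have 1: "compose (Ob C) (onOb (fst FG)) (\<lambda>c \<in> Ob C. c) = onOb (fst FG)"
    "compose (Ob C) (\<lambda>c \<in> Ob D. c) (onOb (fst FG)) = onOb (fst FG)"
    by (rule extensionalityI[of _ "Ob C"]; use assms(2) onOb_closed in \<open>simp add: compose_def\<close>)+
  have 2: "compose (Ar C) (onAr (fst FG)) (\<lambda>c \<in> Ar C. c) = onAr (fst FG)"
    "compose (Ar C) (\<lambda>c \<in> Ar D. c) (onAr (fst FG)) = onAr (fst FG)"
    by (rule extensionalityI[of _ "Ar C"]; use assms(3) * in \<open>simp add: compose_def\<close>)+
  have "snd FG \<in> extensional \<DD>" "\<And>\<dd>. \<dd> \<in> \<DD> \<Longrightarrow> snd FG \<dd> \<in> \<DD>'"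
    using assms(4) by (auto simp: PiE_def)
  then have 3: "compose \<DD> (snd FG) (\<lambda>c \<in> \<DD>. c) = snd FG"
    "compose \<DD> (\<lambda>c \<in> \<DD>'. c) (snd FG) = snd FG"
    by (auto simp: compose_def intro!: extensionalityI[of _ \<DD>])
  have 4: "(\<lparr>onOb = onOb (fst FG), onAr = onAr (fst FG)\<rparr>, snd FG) = FG"
    by (rule prod_eqI) (auto intro: ftor.equality)
  show "cc_comp C \<DD> (cc_id C \<DD>) FG = FG" "cc_comp C \<DD> FG (cc_id D \<DD>') = FG"
    by (simp_all add: cc_comp_def cc_id_def 1 2 3 4)
qed

lemma category_regular_monoids: "category regular_monoids_cat"
proof
  fix f assume "f \<in> Ar regular_monoids_cat"
  then obtain S h T where f: "f = (S, h, T)" "regular_monoid S" "regular_monoid T"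
    "h \<in> hom S T" "h \<in> extensional (carrier S)"
    by (auto simp: regular_monoids_cat_def)
  then show "Dom regular_monoids_cat f \<in> Ob regular_monoids_cat"
    "Cod regular_monoids_cat f \<in> Ob regular_monoids_cat"
    by (auto simp: regular_monoids_cat_def)
  have "compose (carrier S) h (\<lambda>x\<in>carrier S. x) = h" "compose (carrier S) (\<lambda>x\<in>carrier T. x) h = h"
    by (rule extensionalityI[of _ "carrier S"]; use f(4,5) in \<open>auto simp: compose_def hom_def\<close>)+
  then show "Ide regular_monoids_cat (Dom regular_monoids_cat f) \<Zcomp>\<^bsub>regular_monoids_cat\<^esub> f = f"
    "f \<Zcomp>\<^bsub>regular_monoids_cat\<^esub> Ide regular_monoids_cat (Cod regular_monoids_cat f) = f"
    by (simp_all add: regular_monoids_cat_def f(1))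
next
  fix S :: "'a monoid" assume "S \<in> Ob regular_monoids_cat"
  then show "Ide regular_monoids_cat S \<in> Hom regular_monoids_cat S S"
    by (auto simp: regular_monoids_cat_def Hom_def hom_def regular_monoid_def monoid.m_closed)
next
  fix f g and S T U :: "'a monoid"
  assume "f \<in> Hom regular_monoids_cat S T" "g \<in> Hom regular_monoids_cat T U"
  then show "f \<Zcomp>\<^bsub>regular_monoids_cat\<^esub> g \<in> Hom regular_monoids_cat S U"
    by (auto simp: regular_monoids_cat_def Hom_def hom_def compose_def regular_monoid_def
        monoid.m_closed Pi_iff)
next
  fix f g h and S T U V :: "'a monoid"
  assume "f \<in> Hom regular_monoids_cat S T" "g \<in> Hom regular_monoids_cat T U"
    "h \<in> Hom regular_monoids_cat U V"
  then show "f \<Zcomp>\<^bsub>regular_monoids_cat\<^esub> g \<Zcomp>\<^bsub>regular_monoids_cat\<^esub> h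
      = f \<Zcomp>\<^bsub>regular_monoids_cat\<^esub> (g \<Zcomp>\<^bsub>regular_monoids_cat\<^esub> h)"
    by (auto simp: regular_monoids_cat_def Hom_def hom_def compose_def fun_eq_iff Pi_iff)
qed


section \<open>From homomorphisms to CC-morphisms\<close>

definition cc_retraction ::
  "('o, 'm, 'y) subcat_scheme \<Rightarrow> ('p, 'n, 'z) subcat_scheme \<Rightarrow> ('o, 'm, 'p, 'n) cc_pair \<Rightarrow> 'n" where
  "cc_retraction C C' FG = idem_cone C' (onOb (fst FG) (top_ob C))
     (snd FG (cone_class C (Ide C (top_ob C)))) (top_ob C')"

definition end_map ::
  "('o, 'm, 'y) subcat_scheme \<Rightarrow> ('p, 'n, 'z) subcat_scheme \<Rightarrow> ('o, 'm, 'p, 'n) cc_pair \<Rightarrow> 'm \<Rightarrow> 'n" where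
  "end_map C C' FG = (\<lambda>f \<in> top_end C. cc_retraction C C' FG \<Zcomp>\<^bsub>C'\<^esub> onAr (fst FG) f
     \<Zcomp>\<^bsub>C'\<^esub> top_inc C' (onOb (fst FG) (top_ob C)))"

text \<open>An arbitrary retraction of the greatest object onto \<open>c\<close>; by
  \<open>image_h_idem\<close> the object that \<open>lift_ob\<close> assigns to \<open>c\<close>
  does not depend on the choice.\<close>

definition top_ret :: "('o, 'm, 'z) subcat_scheme \<Rightarrow> 'o \<Rightarrow> 'm" where
  "top_ret C c = (SOME r. r \<in> Ar C \<and> Dom C r = top_ob C \<and> Cod C r = c \<and>
     top_inc C c \<Zcomp>\<^bsub>C\<^esub> r = Ide C c)"

definition top_idem :: "('o, 'm, 'z) subcat_scheme \<Rightarrow> 'o \<Rightarrow> 'm" where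
  "top_idem C c = top_ret C c \<Zcomp>\<^bsub>C\<^esub> top_inc C c"

definition lift_ob ::
  "('o, 'm, 'y) subcat_scheme \<Rightarrow> ('p, 'n, 'z) subcat_scheme \<Rightarrow> ('m \<Rightarrow> 'n) \<Rightarrow> 'o \<Rightarrow> 'p" where
  "lift_ob C C' h = (\<lambda>c \<in> Ob C. image_ob C' (h (top_idem C c)))"

text \<open>An arrow \<open>f\<close> from \<open>a\<close> to \<open>b\<close> is extended to the
  endomorphism \<open>r f j\<close> of the greatest object, moved by \<open>h\<close>, and cut down
  again: on the left by the inclusion of the new domain, on the right by the retraction contained in
  the idempotent that \<open>h\<close> assigns to \<open>b\<close>.\<close>

definition lift_ar ::
  "('o, 'm, 'y) subcat_scheme \<Rightarrow> ('p, 'n, 'z) subcat_scheme \<Rightarrow> ('m \<Rightarrow> 'n) \<Rightarrow> 'm \<Rightarrow> 'n" where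
  "lift_ar C C' h = (\<lambda>f \<in> Ar C. top_inc C' (lift_ob C C' h (Dom C f))
     \<Zcomp>\<^bsub>C'\<^esub> h (top_ret C (Dom C f) \<Zcomp>\<^bsub>C\<^esub> f \<Zcomp>\<^bsub>C\<^esub> top_inc C (Cod C f))
     \<Zcomp>\<^bsub>C'\<^esub> epi_part C' (h (top_idem C (Cod C f))))"

definition lift_class ::
  "('o, 'm, 'y) subcat_scheme \<Rightarrow> ('p, 'n, 'z) subcat_scheme \<Rightarrow> ('m \<Rightarrow> 'n)
     \<Rightarrow> ('o \<Rightarrow> 'm) set \<Rightarrow> ('p \<Rightarrow> 'n) set" where
  "lift_class C C' h = (\<lambda>\<dd> \<in> cone_classes C.
     cone_class C' (h (SOME f. f \<in> top_end C \<and> \<dd> = cone_class C f)))"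

text \<open>The inverse of \<open>end_map\<close>, as \<open>end_map_lift\<close> and
  \<open>lift_end_map\<close> show.\<close>

definition lift ::
  "('o, 'm, 'y) subcat_scheme \<Rightarrow> ('p, 'n, 'z) subcat_scheme \<Rightarrow> ('m \<Rightarrow> 'n) \<Rightarrow> ('o, 'm, 'p, 'n) cc_pair"
  where "lift C C' h = (\<lparr>onOb = lift_ob C C' h, onAr = lift_ar C C' h\<rparr>, lift_class C C' h)"

section \<open>Chosen retractions and their idempotents\<close>

context bounded_normal_category
begin

lemma top_ret [simp]:
  assumes "c \<in> Ob C"
  shows "top_ret C c \<in> Ar C" "Dom C (top_ret C c) = d" "Cod C (top_ret C c) = c"
    "\<j> c \<Zcomp> top_ret C c = Ide C c"
proof -
  have "\<exists>r. r \<in> Ar C \<and> Dom C r = d \<and> Cod C r = c \<and> \<j> c \<Zcomp> r = Ide C c"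
    using retraction[OF assms] by metis
  then have "top_ret C c \<in> Ar C \<and> Dom C (top_ret C c) = d \<and> Cod C (top_ret C c) = c \<and>
      \<j> c \<Zcomp> top_ret C c = Ide C c"
    unfolding top_ret_def by (rule someI_ex)
  then show "top_ret C c \<in> Ar C" "Dom C (top_ret C c) = d" "Cod C (top_ret C c) = c"
    "\<j> c \<Zcomp> top_ret C c = Ide C c" by auto
qed

lemma top_ret_subst:
  "\<lbrakk>c \<in> Ob C; f \<in> Ar C; Dom C f = c\<rbrakk> \<Longrightarrow> \<j> c \<Zcomp> (top_ret C c \<Zcomp> f) = f"
  by (simp add: assoc_subst[OF top_ret(4)])

lemma top_idem [simp]:
  assumes "c \<in> Ob C"
  shows "top_idem C c \<in> M" "top_idem C c \<Zcomp> top_idem C c = top_idem C c"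
    "image_ob C (top_idem C c) = c" "epi_part C (top_idem C c) = top_ret C c"
  using idempotent_of_retraction[OF assms top_ret[OF assms]] by (auto simp: top_idem_def)

lemma top_ret_top [simp]: "top_ret C d = Ide C d"
  using top_ret[OF top_ob(1)] by simp

lemma top_idem_top [simp]: "top_idem C d = Ide C d"
  by (simp add: top_idem_def)

lemma Ide_top_M [simp]: "f \<in> M \<Longrightarrow> Ide C d \<Zcomp> f = f" "f \<in> M \<Longrightarrow> f \<Zcomp> Ide C d = f"
  by (simp_all add: top_end_iff)

lemma M_type: "f \<in> M \<Longrightarrow> f \<in> Ar C" "f \<in> M \<Longrightarrow> Dom C f = d" "f \<in> M \<Longrightarrow> Cod C f = d"
  by (simp_all add: top_end_iff)

lemma conjugate_in_M:
  "\<lbrakk>f \<in> Hom C a b; a \<in> Ob C; b \<in> Ob C\<rbrakk> \<Longrightarrow> top_ret C a \<Zcomp> f \<Zcomp> \<j> b \<in> M"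
  by (simp add: top_end_iff Hom_def)

end

text \<open>Only products are respected: \<open>h\<close> may send the identity to another
  idempotent, so the object assigned to the greatest object can be a proper subobject of the
  greatest object of \<open>C'\<close>.\<close>

locale top_end_hom =
  A: bounded_normal_category C + B: bounded_normal_category C'
  for C :: "('o, 'm, 'y) subcat_scheme" and C' :: "('p, 'n, 'z) subcat_scheme" +
  fixes h :: "'m \<Rightarrow> 'n"
  assumes h_closed [simp]: "f \<in> top_end C \<Longrightarrow> h f \<in> top_end C'"
    and h_Cmp: "\<lbrakk>f \<in> top_end C; g \<in> top_end C\<rbrakk> \<Longrightarrow> h (f \<Zcomp>\<^bsub>C\<^esub> g) = h f \<Zcomp>\<^bsub>C'\<^esub> h g"
begin

abbreviation "L \<equiv> lift_ob C C' h"
abbreviation "e \<equiv> \<lambda>c. h (top_idem C c)"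

lemma h_right_le:
  assumes "right_le C f g" "g \<in> top_end C"
  shows "right_le C' (h f) (h g)"
proof -
  obtain x where "x \<in> top_end C" "f = g \<Zcomp>\<^bsub>C\<^esub> x" using assms by (auto simp: right_le_def)
  then show ?thesis using assms by (auto simp: h_Cmp)
qed

lemma cone_class_cong:
  assumes "f \<in> top_end C" "g \<in> top_end C" "cone_class C f = cone_class C g"
  shows "cone_class C' (h f) = cone_class C' (h g)"
  using assms h_right_le by (auto simp: A.cone_class_eq_iff B.cone_class_eq_iff)

lemma lift_class_cone_class [simp]:
  assumes "f \<in> top_end C"
  shows "lift_class C C' h (cone_class C f) = cone_class C' (h f)"
proof -
  let ?P = "\<lambda>g. g \<in> top_end C \<and> cone_class C f = cone_class C g"
  have "?P f" using assms by simp
  then have "?P (SOME g. ?P g)" by (rule someI)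
  then have "cone_class C' (h f) = cone_class C' (h (SOME g. ?P g))"
    using cone_class_cong[OF assms] by blast
  then show ?thesis using assms by (simp add: lift_class_def)
qed

lemma h_idem: "\<lbrakk>f \<in> top_end C; f \<Zcomp>\<^bsub>C\<^esub> f = f\<rbrakk> \<Longrightarrow> h f \<Zcomp>\<^bsub>C'\<^esub> h f = h f"
  using h_Cmp by metis

text \<open>\<open>f\<close> and the chosen idempotent \<open>t\<close> with the same image satisfy
  \<open>f t = f\<close> and \<open>t f = t\<close>. These equations survive \<open>h\<close> and
  force equal images.\<close>

lemma image_h_idem:
  assumes "f \<in> top_end C" "f \<Zcomp>\<^bsub>C\<^esub> f = f"
  shows "image_ob C' (h f) = L (image_ob C f)"
proof -
  let ?c = "image_ob C f"
  have c: "?c \<in> Ob C" using A.image(5)[OF assms(1)] .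
  note t = A.top_idem[OF c]
  have "f \<Zcomp>\<^bsub>C\<^esub> top_idem C ?c = f" "top_idem C ?c \<Zcomp>\<^bsub>C\<^esub> f = top_idem C ?c"
    using A.image_cong_idempotent assms t by auto
  then have "h f \<Zcomp>\<^bsub>C'\<^esub> e ?c = h f" "e ?c \<Zcomp>\<^bsub>C'\<^esub> h f = e ?c"
    using h_Cmp assms t by metis+
  then show ?thesis using B.image_eqI assms t c by (simp add: lift_ob_def)
qed

lemma L_image: "c \<in> Ob C \<Longrightarrow> image_ob C' (e c) = L c"
  by (simp add: lift_ob_def)

lemma L_props:
  assumes c: "c \<in> Ob C"
  shows "L c \<in> Ob C'" "epi_part C' (e c) \<in> Ar C'" "Dom C' (epi_part C' (e c)) = top_ob C'"
    "Cod C' (epi_part C' (e c)) = L c" "epi_part C' (e c) \<Zcomp>\<^bsub>C'\<^esub> top_inc C' (L c) = e c"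
    "top_inc C' (L c) \<Zcomp>\<^bsub>C'\<^esub> epi_part C' (e c) = Ide C' (L c)"
  using B.image[of "e c"] B.idempotent_image[of "e c"] h_idem[of "top_idem C c"] c L_image[OF c]
  by auto

lemma lift_ar_eq:
  assumes "f \<in> Hom C a b"
  shows "lift_ar C C' h f = top_inc C' (L a) \<Zcomp>\<^bsub>C'\<^esub>
    h (top_ret C a \<Zcomp>\<^bsub>C\<^esub> f \<Zcomp>\<^bsub>C\<^esub> top_inc C b) \<Zcomp>\<^bsub>C'\<^esub> epi_part C' (e b)"
  using assms by (auto simp: lift_ar_def Hom_def)

lemma Hom_Ob:
  assumes "f \<in> Hom C a b"
  shows "a \<in> Ob C" "b \<in> Ob C"
  using assms A.Dom_closed A.Cod_closed by (auto simp: Hom_def)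

lemma functor_lift: "is_functor C C' (fst (lift C C' h))"
proof
  fix a assume a: "a \<in> Ob C"
  note L = L_props[OF a]
  show "onOb (fst (lift C C' h)) a \<in> Ob C'" using L by (simp add: lift_def)
  have "lift_ar C C' h (Ide C a) = top_inc C' (L a) \<Zcomp>\<^bsub>C'\<^esub> e a \<Zcomp>\<^bsub>C'\<^esub> epi_part C' (e a)"
    using lift_ar_eq[OF A.Ide_Hom[OF a]] a by (simp add: top_idem_def)
  also have "\<dots> = top_inc C' (L a) \<Zcomp>\<^bsub>C'\<^esub> (epi_part C' (e a) \<Zcomp>\<^bsub>C'\<^esub> top_inc C' (L a))
      \<Zcomp>\<^bsub>C'\<^esub> epi_part C' (e a)"
    using L by simp
  also have "\<dots> = Ide C' (L a)"
    using L(1-4) L(6) by (simp add: B.assoc B.assoc_subst[OF L(6)])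
  finally show "onAr (fst (lift C C' h)) (Ide C a) = Ide C' (onOb (fst (lift C C' h)) a)"
    by (simp add: lift_def)
next
  fix f a b assume f: "f \<in> Hom C a b"
  note ab = Hom_Ob[OF f]
  note m = B.M_type[OF h_closed[OF A.conjugate_in_M[OF f ab]]]
  show "onAr (fst (lift C C' h)) f
      \<in> Hom C' (onOb (fst (lift C C' h)) a) (onOb (fst (lift C C' h)) b)"
    using L_props[OF ab(1)] L_props[OF ab(2)] m by (simp add: lift_def lift_ar_eq[OF f] Hom_def)
next
  fix f a b g c assume f: "f \<in> Hom C a b" and g: "g \<in> Hom C b c"
  have abc: "a \<in> Ob C" "b \<in> Ob C" "c \<in> Ob C" using Hom_Ob f g by auto
  let ?f = "top_ret C a \<Zcomp>\<^bsub>C\<^esub> f \<Zcomp>\<^bsub>C\<^esub> top_inc C b"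
  let ?g = "top_ret C b \<Zcomp>\<^bsub>C\<^esub> g \<Zcomp>\<^bsub>C\<^esub> top_inc C c"
  note fM = A.conjugate_in_M[OF f abc(1,2)] and gM = A.conjugate_in_M[OF g abc(2,3)]
  note m = B.M_type[OF h_closed[OF fM]] B.M_type[OF h_closed[OF gM]]
  have "top_ret C a \<Zcomp>\<^bsub>C\<^esub> (f \<Zcomp>\<^bsub>C\<^esub> g) \<Zcomp>\<^bsub>C\<^esub> top_inc C c = ?f \<Zcomp>\<^bsub>C\<^esub> ?g"
    using f g abc by (simp add: Hom_def A.assoc A.top_ret_subst)
  \<comment> \<open>\<open>?f\<close> ends in the inclusion of \<open>b\<close>, which absorbs the
    idempotent of \<open>b\<close>. Under \<open>h\<close> this puts \<open>e b\<close> between the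
    two factors, and its factorisation into epimorphic part and inclusion is the seam where the
    lifts of \<open>f\<close> and \<open>g\<close> meet.\<close>
  moreover have "?f = ?f \<Zcomp>\<^bsub>C\<^esub> top_idem C b"
    using f abc by (simp add: Hom_def A.assoc A.top_ret_subst top_idem_def)
  then have "h ?f = h ?f \<Zcomp>\<^bsub>C'\<^esub> e b" using h_Cmp[OF fM, of "top_idem C b"] abc by simp
  ultimately have "h (top_ret C a \<Zcomp>\<^bsub>C\<^esub> (f \<Zcomp>\<^bsub>C\<^esub> g) \<Zcomp>\<^bsub>C\<^esub> top_inc C c)
      = (h ?f \<Zcomp>\<^bsub>C'\<^esub> e b) \<Zcomp>\<^bsub>C'\<^esub> h ?g"
    using h_Cmp[OF fM gM] by simp
  also have "\<dots> = (h ?f \<Zcomp>\<^bsub>C'\<^esub> (epi_part C' (e b) \<Zcomp>\<^bsub>C'\<^esub> top_inc C' (L b))) \<Zcomp>\<^bsub>C'\<^esub> h ?g"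
    using L_props[OF abc(2)] by simp
  finally have eq: "h (top_ret C a \<Zcomp>\<^bsub>C\<^esub> (f \<Zcomp>\<^bsub>C\<^esub> g) \<Zcomp>\<^bsub>C\<^esub> top_inc C c)
      = (h ?f \<Zcomp>\<^bsub>C'\<^esub> (epi_part C' (e b) \<Zcomp>\<^bsub>C'\<^esub> top_inc C' (L b))) \<Zcomp>\<^bsub>C'\<^esub> h ?g" .
  have "lift_ar C C' h (f \<Zcomp>\<^bsub>C\<^esub> g) = lift_ar C C' h f \<Zcomp>\<^bsub>C'\<^esub> lift_ar C C' h g"
    unfolding lift_ar_eq[OF A.Cmp_Hom[OF f g]] lift_ar_eq[OF f] lift_ar_eq[OF g] eq
    using L_props(1-4)[OF abc(1)] L_props(1-4)[OF abc(2)] L_props(1-4)[OF abc(3)] m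
    by (simp add: B.assoc)
  then show "onAr (fst (lift C C' h)) (f \<Zcomp>\<^bsub>C\<^esub> g)
      = onAr (fst (lift C C' h)) f \<Zcomp>\<^bsub>C'\<^esub> onAr (fst (lift C C' h)) g"
    by (simp add: lift_def)
qed

text \<open>For \<open>i\<close> from \<open>a\<close> to \<open>b\<close> the extended endomorphism
  is the idempotent of \<open>a\<close>, so the lifted arrow is the inclusion of \<open>L a\<close>
  followed by the retraction onto \<open>L b\<close>. As \<open>e a\<close> absorbs
  \<open>e b\<close> on the right, composing further with the inclusion of \<open>L b\<close> gives
  back the inclusion of \<open>L a\<close>; the factorisation axiom for inclusions applies.\<close>

lemma lift_ar_Inc:
  assumes i: "i \<in> Inc C"
  shows "lift_ar C C' h i \<in> Inc C'"
proof -
  define a b where "a = Dom C i" and "b = Cod C i"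
  have iH: "i \<in> Hom C a b" using i by (simp add: Hom_def a_def b_def)
  note ab = Hom_Ob[OF iH]
  have ij: "i \<Zcomp>\<^bsub>C\<^esub> top_inc C b = top_inc C a" using A.Inc_top_inc[OF i] by (simp add: a_def b_def)
  note La = L_props[OF ab(1)] and Lb = L_props[OF ab(2)]
  have m: "top_ret C a \<Zcomp>\<^bsub>C\<^esub> i \<Zcomp>\<^bsub>C\<^esub> top_inc C b = top_idem C a"
    using iH ab by (simp add: Hom_def A.assoc ij top_idem_def)
  have "lift_ar C C' h i = top_inc C' (L a) \<Zcomp>\<^bsub>C'\<^esub> (epi_part C' (e a) \<Zcomp>\<^bsub>C'\<^esub> top_inc C' (L a))
      \<Zcomp>\<^bsub>C'\<^esub> epi_part C' (e b)"
    using La(5) by (simp add: lift_ar_eq[OF iH] m)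
  also have "\<dots> = top_inc C' (L a) \<Zcomp>\<^bsub>C'\<^esub> epi_part C' (e b)"
    using La(1-4) Lb(1-4) by (simp add: B.assoc B.assoc_subst[OF La(6)])
  finally have eq: "lift_ar C C' h i = top_inc C' (L a) \<Zcomp>\<^bsub>C'\<^esub> epi_part C' (e b)" .
  have "top_inc C a \<Zcomp>\<^bsub>C\<^esub> top_idem C b = top_inc C a"
    by (subst (1 2) ij[symmetric])
      (use iH ab in \<open>simp add: Hom_def A.assoc A.top_ret_subst top_idem_def\<close>)
  then have "top_idem C a \<Zcomp>\<^bsub>C\<^esub> top_idem C b = top_idem C a"
    using ab A.M_type[OF A.top_idem(1)[OF ab(2)]] by (simp add: top_idem_def[of C a] A.assoc)
  then have ee: "e a \<Zcomp>\<^bsub>C'\<^esub> e b = e a" using h_Cmp ab by (metis A.top_idem(1))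
  note ma = B.M_type[OF h_closed[OF A.top_idem(1)[OF ab(1)]]]
    and mb = B.M_type[OF h_closed[OF A.top_idem(1)[OF ab(2)]]]
  have "top_inc C' (L a) = top_inc C' (L a) \<Zcomp>\<^bsub>C'\<^esub> (epi_part C' (e a) \<Zcomp>\<^bsub>C'\<^esub> top_inc C' (L a))"
    using La(1-4) by (simp add: B.assoc_subst[OF La(6)])
  also have "\<dots> = top_inc C' (L a) \<Zcomp>\<^bsub>C'\<^esub> (e a \<Zcomp>\<^bsub>C'\<^esub> e b)" using La(5) ee by simp
  also have "\<dots> = top_inc C' (L a) \<Zcomp>\<^bsub>C'\<^esub> ((epi_part C' (e a) \<Zcomp>\<^bsub>C'\<^esub> top_inc C' (L a))
      \<Zcomp>\<^bsub>C'\<^esub> (epi_part C' (e b) \<Zcomp>\<^bsub>C'\<^esub> top_inc C' (L b)))"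
    using La(5) Lb(5) by simp
  also have "\<dots> = (top_inc C' (L a) \<Zcomp>\<^bsub>C'\<^esub> epi_part C' (e b)) \<Zcomp>\<^bsub>C'\<^esub> top_inc C' (L b)"
    using La(1-4) Lb(1-4) by (simp add: B.assoc B.assoc_subst[OF La(6)])
  finally have "top_inc C' (L a)
      = (top_inc C' (L a) \<Zcomp>\<^bsub>C'\<^esub> epi_part C' (e b)) \<Zcomp>\<^bsub>C'\<^esub> top_inc C' (L b)" .
  then have "top_inc C' (L a) \<Zcomp>\<^bsub>C'\<^esub> epi_part C' (e b) \<in> Inc C'"
    by (rule B.Inc_factor[rotated 4]) (use La(1-4) Lb(1-4) in simp_all)
  then show ?thesis by (simp add: eq)
qed

text \<open>The component at \<open>c'\<close> of the cone of \<open>g\<close> extends to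
  \<open>top_idem C c'\<close> times \<open>g\<close>, which \<open>h\<close> turns into a product.
  Cutting down leaves the component at \<open>L c'\<close> of the cone of
  \<open>h g\<close>.\<close>

lemma lift_idem_cone:
  assumes f: "f \<in> top_end C" and con: "connected_by C c (cone_class C f)" and c': "c' \<in> Ob C"
  shows "connected_by C' (L c) (cone_class C' (h f))"
    "lift_ar C C' h (idem_cone C c (cone_class C f) c')
      = idem_cone C' (L c) (cone_class C' (h f)) (L c')"
proof -
  obtain g where g: "g \<in> top_end C" "g \<Zcomp>\<^bsub>C\<^esub> g = g" "image_ob C g = c" "right_le C f g" "right_le C g f"
    using con A.connected_by_iff[OF f] by auto
  have hg: "h g \<in> top_end C'" "h g \<Zcomp>\<^bsub>C'\<^esub> h g = h g" "image_ob C' (h g) = L c"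
    "right_le C' (h f) (h g)" "right_le C' (h g) (h f)"
    using f g h_idem image_h_idem h_right_le by auto
  then show "connected_by C' (L c) (cone_class C' (h f))"
    using B.connected_by_iff[of "h f"] f by auto
  have c: "c \<in> Ob C" using A.image(5)[OF g(1)] g by simp
  note img = A.image[OF g(1)]
  have gH: "principal_cone C g c' \<in> Hom C c' c"
    using img(1-5) c' g by (simp add: principal_cone_def Hom_def)
  have "top_ret C c' \<Zcomp>\<^bsub>C\<^esub> principal_cone C g c' \<Zcomp>\<^bsub>C\<^esub> top_inc C c
      = top_ret C c' \<Zcomp>\<^bsub>C\<^esub> (top_inc C c' \<Zcomp>\<^bsub>C\<^esub> (epi_part C g \<Zcomp>\<^bsub>C\<^esub> top_inc C c))"
    using img(1-5) c' c g(3) by (simp add: principal_cone_def A.assoc)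
  also have "\<dots> = top_idem C c' \<Zcomp>\<^bsub>C\<^esub> g"
    using img(6) g(3) c' A.M_type[OF g(1)] by (simp add: top_idem_def A.assoc)
  finally have "h (top_ret C c' \<Zcomp>\<^bsub>C\<^esub> principal_cone C g c' \<Zcomp>\<^bsub>C\<^esub> top_inc C c) = e c' \<Zcomp>\<^bsub>C'\<^esub> h g"
    using h_Cmp g c' by simp
  then have "lift_ar C C' h (principal_cone C g c')
      = top_inc C' (L c') \<Zcomp>\<^bsub>C'\<^esub> (e c' \<Zcomp>\<^bsub>C'\<^esub> h g) \<Zcomp>\<^bsub>C'\<^esub> epi_part C' (e c)"
    by (simp add: lift_ar_eq[OF gH])
  also have "\<dots> = top_inc C' (L c') \<Zcomp>\<^bsub>C'\<^esub>
      ((epi_part C' (e c') \<Zcomp>\<^bsub>C'\<^esub> top_inc C' (L c')) \<Zcomp>\<^bsub>C'\<^esub>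
       (epi_part C' (h g) \<Zcomp>\<^bsub>C'\<^esub> top_inc C' (L c))) \<Zcomp>\<^bsub>C'\<^esub> epi_part C' (e c)"
    using L_props(5)[OF c'] B.image(6)[OF hg(1)] hg(3) by simp
  \<comment> \<open>The inclusion coming from \<open>h g\<close> cancels against the retraction
    coming from \<open>e c\<close>, although these idempotents may differ: both have image
    \<open>L c\<close>.\<close>
  also have "\<dots> = top_inc C' (L c') \<Zcomp>\<^bsub>C'\<^esub> epi_part C' (h g)"
    using L_props(1-4)[OF c'] L_props(1-4)[OF c] B.image(1-5)[OF hg(1)] hg(3)
    by (simp add: B.assoc B.assoc_subst[OF L_props(6)[OF c']] B.assoc_subst[OF L_props(6)[OF c]]
        L_props(6)[OF c])
  also have "\<dots> = principal_cone C' (h g) (L c')"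
    using L_props(1)[OF c'] by (simp add: principal_cone_def)
  finally show "lift_ar C C' h (idem_cone C c (cone_class C f) c')
      = idem_cone C' (L c) (cone_class C' (h f)) (L c')"
    using A.idem_cone_eq[OF g(1,2) f g(4,5)] B.idem_cone_eq[OF hg(1,2) _ hg(4,5)] f g(3) hg(3)
    by simp
qed

lemma cc_morphism_lift: "cc_morphism C (cone_classes C) C' (cone_classes C') (lift C C' h)"
proof (intro cc_morphism.intro cc_morphism_axioms.intro)
  show "connected_category C (cone_classes C)" "connected_category C' (cone_classes C')"
    using A.connected_category_all B.connected_category_all .
  show "is_functor C C' (fst (lift C C' h))" by (rule functor_lift)
  show "onOb (fst (lift C C' h)) \<in> extensional (Ob C)" "onAr (fst (lift C C' h)) \<in> extensional (Ar C)"
    by (simp_all add: lift_def lift_ob_def lift_ar_def)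
  show "onAr (fst (lift C C' h)) j \<in> Inc C'" if "j \<in> Inc C" for j
    using lift_ar_Inc[OF that] by (simp add: lift_def)
  show "snd (lift C C' h) \<in> cone_classes C \<rightarrow>\<^sub>E cone_classes C'"
  proof
    show "snd (lift C C' h) \<dd> \<in> cone_classes C'" if "\<dd> \<in> cone_classes C" for \<dd>
      using that by (auto simp: lift_def A.cone_classes_eq)
    show "snd (lift C C' h) \<dd> = undefined" if "\<dd> \<notin> cone_classes C" for \<dd>
      using that by (simp add: lift_def lift_class_def)
  qed
next
  fix \<dd> \<ee> assume "\<dd> \<in> cone_classes C" "\<ee> \<in> cone_classes C" "class_le C \<dd> \<ee>"
  then obtain f g where "f \<in> top_end C" "g \<in> top_end C" "\<dd> = cone_class C f" "\<ee> = cone_class C g"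
    "right_le C f g"
    by (auto simp: A.cone_classes_eq A.class_le_iff)
  then show "class_le C' (snd (lift C C' h) \<dd>) (snd (lift C C' h) \<ee>)"
    using h_right_le by (simp add: lift_def B.class_le_iff)
next
  fix c \<dd> assume "c \<in> Ob C" "\<dd> \<in> cone_classes C" "connected_by C c \<dd>"
  then obtain f where f: "f \<in> top_end C" "\<dd> = cone_class C f" "connected_by C c (cone_class C f)"
    by (auto simp: A.cone_classes_eq)
  then show "connected_by C' (onOb (fst (lift C C' h)) c) (snd (lift C C' h) \<dd>)"
    using lift_idem_cone(1)[OF f(1,3) A.top_ob(1)] by (simp add: lift_def)
  fix c' assume "c' \<in> Ob C"
  then show "onAr (fst (lift C C' h)) (idem_cone C c \<dd> c')
      = idem_cone C' (onOb (fst (lift C C' h)) c) (snd (lift C C' h) \<dd>) (onOb (fst (lift C C' h)) c')"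
    using lift_idem_cone(2)[OF f(1,3)] f by (simp add: lift_def)
qed

text \<open>The retraction of the lifted pair is the epimorphic part of \<open>h 1\<close>, so
  \<open>q F(f) j\<close> becomes the product of \<open>h 1\<close>, \<open>h f\<close> and
  \<open>h 1\<close>, which is \<open>h (1 f 1)\<close>. In this way \<open>h 1\<close> is absorbed
  even when it is not the identity.\<close>

lemma end_map_lift:
  assumes "f \<in> top_end C"
  shows "end_map C C' (lift C C' h) f = h f"
proof -
  let ?d = "top_ob C"
  have d: "?d \<in> Ob C" by simp
  note L = L_props[OF d]
  have I: "Ide C ?d \<in> top_end C" by simp
  have hI: "h (Ide C ?d) \<Zcomp>\<^bsub>C'\<^esub> h (Ide C ?d) = h (Ide C ?d)" "image_ob C' (h (Ide C ?d)) = L ?d"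
    using h_idem[OF I] L_image[OF d] I by auto
  have q: "cc_retraction C C' (lift C C' h) = epi_part C' (e ?d)"
    using B.idem_cone_eq[of "h (Ide C ?d)" "h (Ide C ?d)"] hI I
    by (simp add: cc_retraction_def lift_def)
  have "top_ret C ?d \<Zcomp>\<^bsub>C\<^esub> f \<Zcomp>\<^bsub>C\<^esub> top_inc C ?d = f" using assms by simp
  then have a: "lift_ar C C' h f = top_inc C' (L ?d) \<Zcomp>\<^bsub>C'\<^esub> h f \<Zcomp>\<^bsub>C'\<^esub> epi_part C' (e ?d)"
    using lift_ar_eq[of f ?d ?d] assms by (simp add: top_end_def)
  note m = B.M_type[OF h_closed[OF assms]]
  have "end_map C C' (lift C C' h) f = epi_part C' (e ?d) \<Zcomp>\<^bsub>C'\<^esub>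
      (top_inc C' (L ?d) \<Zcomp>\<^bsub>C'\<^esub> h f \<Zcomp>\<^bsub>C'\<^esub> epi_part C' (e ?d)) \<Zcomp>\<^bsub>C'\<^esub> top_inc C' (L ?d)"
    using assms by (simp add: end_map_def q a) (simp add: lift_def a)
  also have "\<dots> = (epi_part C' (e ?d) \<Zcomp>\<^bsub>C'\<^esub> top_inc C' (L ?d)) \<Zcomp>\<^bsub>C'\<^esub> h f \<Zcomp>\<^bsub>C'\<^esub>
      (epi_part C' (e ?d) \<Zcomp>\<^bsub>C'\<^esub> top_inc C' (L ?d))"
    using L(1-4) m by (simp add: B.assoc)
  also have "\<dots> = h (Ide C ?d \<Zcomp>\<^bsub>C\<^esub> f \<Zcomp>\<^bsub>C\<^esub> Ide C ?d)"
    using L(5) h_Cmp[OF I assms] h_Cmp[OF assms I] assms by simp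
  finally show ?thesis using assms by simp
qed

end


section \<open>The endomorphism monoid of the greatest object as a functor\<close>

locale bounded_cc_morphism =
  A: bounded_normal_category C + B: bounded_normal_category C' +
  cc_morphism C "cone_classes C" C' "cone_classes C'" FG
  for C :: "('o, 'm, 'y) subcat_scheme" and C' :: "('p, 'n, 'z) subcat_scheme"
    and FG :: "('o, 'm, 'p, 'n) cc_pair"
begin

abbreviation "F \<equiv> onOb (fst FG)"
abbreviation "Fa \<equiv> onAr (fst FG)"
abbreviation "G \<equiv> snd FG"
abbreviation "q \<equiv> cc_retraction C C' FG"
abbreviation "h \<equiv> end_map C C' FG"

sublocale F: is_functor C C' "fst FG"
  by (rule functor_F)

lemma F_Ob [simp]: "c \<in> Ob C \<Longrightarrow> F c \<in> Ob C'"
  by (rule F.onOb_closed)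

lemma Fa_type [simp]:
  assumes "f \<in> Ar C"
  shows "Fa f \<in> Ar C'" "Dom C' (Fa f) = F (Dom C f)" "Cod C' (Fa f) = F (Cod C f)"
  using F.onAr_Hom[of f "Dom C f" "Cod C f"] assms by (auto simp: Hom_def)

lemma Fa_Cmp:
  "\<lbrakk>f \<in> Ar C; g \<in> Ar C; Cod C f = Dom C g\<rbrakk> \<Longrightarrow> Fa (f \<Zcomp>\<^bsub>C\<^esub> g) = Fa f \<Zcomp>\<^bsub>C'\<^esub> Fa g"
  using F.onAr_Cmp[of f "Dom C f" "Cod C f" g "Cod C g"] by (simp add: Hom_def)

lemma Fa_top_inc:
  "c \<in> Ob C \<Longrightarrow> Fa (top_inc C c) \<Zcomp>\<^bsub>C'\<^esub> top_inc C' (F (top_ob C)) = top_inc C' (F c)"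
  using B.Inc_top_inc[OF F_Inc[OF A.top_inc(1)]] by simp

lemma G_cone_class_in: "f \<in> top_end C \<Longrightarrow> G (cone_class C f) \<in> cone_classes C'"
  using G_closed by auto

text \<open>Reads the CC-conditions at an idempotent: connectedness provides \<open>e'\<close> with
  the right image and class, and compatibility with idempotent cones carries the cone of
  \<open>e\<close> to that of \<open>e'\<close>. That \<open>e'\<close> is the value of
  \<open>end_map\<close> at \<open>e\<close> is settled in
  \<open>end_map_idempotent\<close>.\<close>

lemma transfer_idempotent:
  assumes e: "e \<in> top_end C" "e \<Zcomp>\<^bsub>C\<^esub> e = e"
  obtains e' where "e' \<in> top_end C'" "e' \<Zcomp>\<^bsub>C'\<^esub> e' = e'" "image_ob C' e' = F (image_ob C e)"
    "G (cone_class C e) = cone_class C' e'"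
    "idem_cone C' (F (image_ob C e)) (G (cone_class C e)) = principal_cone C' e'"
    "\<And>c. c \<in> Ob C \<Longrightarrow> Fa (principal_cone C e c) = principal_cone C' e' (F c)"
proof -
  let ?c = "image_ob C e" and ?D = "cone_class C e"
  have c: "?c \<in> Ob C" using A.image(5)[OF e(1)] .
  have D: "?D \<in> cone_classes C" using e by simp
  have con: "connected_by C ?c ?D" using A.connected_by_iff[OF e(1)] e by auto
  obtain g where g: "g \<in> top_end C'" "G ?D = cone_class C' g"
    using G_cone_class_in[OF e(1)] by (auto simp: B.cone_classes_eq)
  have "connected_by C' (F ?c) (cone_class C' g)" using FG_connected[OF c D con] g(2) by simp
  then obtain e' where e': "e' \<in> top_end C'" "e' \<Zcomp>\<^bsub>C'\<^esub> e' = e'" "image_ob C' e' = F ?c"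
    "right_le C' g e'" "right_le C' e' g"
    using B.connected_by_iff[OF g(1)] by auto
  have ic: "idem_cone C' (F ?c) (G ?D) = principal_cone C' e'"
    using B.idem_cone_eq[OF e'(1,2) g(1) e'(4,5)] e'(3) g(2) by simp
  have "idem_cone C ?c ?D = principal_cone C e"
    using A.idem_cone_eq[OF e e(1)] e(1) by simp
  then have "\<And>c. c \<in> Ob C \<Longrightarrow> Fa (principal_cone C e c) = principal_cone C' e' (F c)"
    using FG_idem_cone[OF c D con] ic by simp
  moreover have "G ?D = cone_class C' e'" using B.cone_class_eq_iff g e' by auto
  ultimately show thesis using that e' ic by blast
qed

text \<open>The case of the identity of \<open>d\<close> in \<open>transfer_idempotent\<close>: the
  idempotent obtained has image \<open>F d\<close>, so its epimorphic part \<open>q\<close> is a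
  retraction onto \<open>F d\<close>.\<close>

lemma base:
  shows "q \<in> Ar C'" "Dom C' q = top_ob C'" "Cod C' q = F (top_ob C)"
    "top_inc C' (F (top_ob C)) \<Zcomp>\<^bsub>C'\<^esub> q = Ide C' (F (top_ob C))"
    "G (cone_class C (Ide C (top_ob C))) = cone_class C' (q \<Zcomp>\<^bsub>C'\<^esub> top_inc C' (F (top_ob C)))"
proof -
  let ?d = "top_ob C"
  have I: "Ide C ?d \<in> top_end C" "Ide C ?d \<Zcomp>\<^bsub>C\<^esub> Ide C ?d = Ide C ?d" by simp_all
  have im: "image_ob C (Ide C ?d) = ?d" using A.top_idem(3)[OF A.top_ob(1)] by simp
  obtain e' where e': "e' \<in> top_end C'" "e' \<Zcomp>\<^bsub>C'\<^esub> e' = e'" "image_ob C' e' = F ?d"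
    "G (cone_class C (Ide C ?d)) = cone_class C' e'"
    "idem_cone C' (F ?d) (G (cone_class C (Ide C ?d))) = principal_cone C' e'"
    using transfer_idempotent[OF I] unfolding im by metis
  have q: "q = epi_part C' e'" using e' by (simp add: cc_retraction_def)
  show "q \<in> Ar C'" "Dom C' q = top_ob C'" "Cod C' q = F (top_ob C)"
    "top_inc C' (F (top_ob C)) \<Zcomp>\<^bsub>C'\<^esub> q = Ide C' (F (top_ob C))"
    "G (cone_class C (Ide C (top_ob C))) = cone_class C' (q \<Zcomp>\<^bsub>C'\<^esub> top_inc C' (F (top_ob C)))"
    unfolding q using B.image[OF e'(1)] B.idempotent_image[OF e'(1,2)] e' by simp_all
qed

lemma base_idempotent:
  shows "q \<Zcomp>\<^bsub>C'\<^esub> top_inc C' (F (top_ob C)) \<in> top_end C'"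
    "(q \<Zcomp>\<^bsub>C'\<^esub> top_inc C' (F (top_ob C))) \<Zcomp>\<^bsub>C'\<^esub> (q \<Zcomp>\<^bsub>C'\<^esub> top_inc C' (F (top_ob C)))
      = q \<Zcomp>\<^bsub>C'\<^esub> top_inc C' (F (top_ob C))"
  using B.idempotent_of_retraction[OF F_Ob[OF A.top_ob(1)] base(1-4)] by auto

lemma end_map_eq:
  "f \<in> top_end C \<Longrightarrow> h f = q \<Zcomp>\<^bsub>C'\<^esub> (Fa f \<Zcomp>\<^bsub>C'\<^esub> top_inc C' (F (top_ob C)))"
  using base A.M_type[of f] by (simp add: end_map_def B.assoc)

text \<open>In \<open>q F(f) j q F(g) j\<close> the middle \<open>j q\<close> is an
  identity.\<close>

sublocale hom: top_end_hom C C' h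
proof
  fix f assume f: "f \<in> top_end C"
  then show "h f \<in> top_end C'"
    using base A.M_type[OF f] by (simp add: end_map_eq B.top_end_iff)
  fix g assume g: "g \<in> top_end C"
  show "h (f \<Zcomp>\<^bsub>C\<^esub> g) = h f \<Zcomp>\<^bsub>C'\<^esub> h g"
    using base(1-3) A.M_type[OF f] A.M_type[OF g] f g
    by (simp add: end_map_eq Fa_Cmp B.assoc B.assoc_subst[OF base(4)])
qed

text \<open>Order preservation of the class map enters here: the transferred idempotent lies below the
  one attached to the class of the identity, which is therefore a left identity for it.\<close>

lemma end_map_idempotent:
  assumes e: "e \<in> top_end C" "e \<Zcomp>\<^bsub>C\<^esub> e = e"
  shows "image_ob C' (h e) = F (image_ob C e)" "G (cone_class C e) = cone_class C' (h e)"
    "epi_part C' (h e) = q \<Zcomp>\<^bsub>C'\<^esub> Fa (epi_part C e)"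
proof -
  let ?d = "top_ob C" and ?c = "image_ob C e"
  let ?j = "top_inc C' (F (top_ob C))"
  note im = A.image[OF e(1)]
  obtain e' where e': "e' \<in> top_end C'" "e' \<Zcomp>\<^bsub>C'\<^esub> e' = e'" "image_ob C' e' = F ?c"
    "G (cone_class C e) = cone_class C' e'"
    "\<And>c. c \<in> Ob C \<Longrightarrow> Fa (principal_cone C e c) = principal_cone C' e' (F c)"
    using transfer_idempotent[OF e] by metis
  note im' = B.image[OF e'(1)]
  have I: "Ide C ?d \<in> top_end C" by simp
  have "class_le C (cone_class C e) (cone_class C (Ide C ?d))"
    using A.class_le_iff[OF e(1) I] e(1) by simp
  then have "right_le C' e' (q \<Zcomp>\<^bsub>C'\<^esub> ?j)"
    using G_mono[of "cone_class C e" "cone_class C (Ide C ?d)"] e(1) I e'(4) base(5)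
      B.class_le_iff[OF e'(1) base_idempotent(1)] by simp
  then have le: "(q \<Zcomp>\<^bsub>C'\<^esub> ?j) \<Zcomp>\<^bsub>C'\<^esub> e' = e'"
    using B.right_le_idem_iff[OF base_idempotent(1) e'(1) base_idempotent(2)] by simp
  \<comment> \<open>Compatibility at the object \<open>d\<close>. As \<open>F d\<close> need not be
    greatest, the right side is only the restriction of \<open>epi_part C' e'\<close> to
    \<open>F d\<close>; composing with \<open>q\<close> and using \<open>le\<close> recovers all of
    it.\<close>
  have Fe: "Fa (epi_part C e) = ?j \<Zcomp>\<^bsub>C'\<^esub> epi_part C' e'"
    using e'(5)[of ?d] e(1) by (simp add: principal_cone_def im)
  have "(q \<Zcomp>\<^bsub>C'\<^esub> Fa (epi_part C e)) \<Zcomp>\<^bsub>C'\<^esub> top_inc C' (F ?c)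
      = (q \<Zcomp>\<^bsub>C'\<^esub> ?j) \<Zcomp>\<^bsub>C'\<^esub> (epi_part C' e' \<Zcomp>\<^bsub>C'\<^esub> top_inc C' (F ?c))"
    unfolding Fe using base(1-3) im'(1-5) e'(3) by (simp add: B.assoc)
  also have "\<dots> = epi_part C' e' \<Zcomp>\<^bsub>C'\<^esub> top_inc C' (F ?c)"
    using le im'(6) e'(3) by simp
  finally have eq: "(q \<Zcomp>\<^bsub>C'\<^esub> Fa (epi_part C e)) \<Zcomp>\<^bsub>C'\<^esub> top_inc C' (F ?c)
      = epi_part C' e' \<Zcomp>\<^bsub>C'\<^esub> top_inc C' (F ?c)" .
  have epi: "epi_part C' e' = q \<Zcomp>\<^bsub>C'\<^esub> Fa (epi_part C e)"
    by (rule sym, rule B.Inc_cancel[OF _ _ _ _ _ _ eq])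
      (use base(1-3) im(1-5) im'(1-5) e'(3) in simp_all)
  have "Fa (epi_part C e \<Zcomp>\<^bsub>C\<^esub> top_inc C ?c) = Fa (epi_part C e) \<Zcomp>\<^bsub>C'\<^esub> Fa (top_inc C ?c)"
    by (rule Fa_Cmp) (use im in auto)
  then have Fae: "Fa e = Fa (epi_part C e) \<Zcomp>\<^bsub>C'\<^esub> Fa (top_inc C ?c)" using im(6) by simp
  have "h e = (q \<Zcomp>\<^bsub>C'\<^esub> Fa (epi_part C e)) \<Zcomp>\<^bsub>C'\<^esub> top_inc C' (F ?c)"
    unfolding end_map_eq[OF e(1)] Fae
    using base(1-3) im(1-5) by (simp add: B.assoc Fa_top_inc)
  also have "\<dots> = e'" using epi im'(6) e'(3) by simp
  finally have "h e = e'" .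
  then show "image_ob C' (h e) = F ?c" "G (cone_class C e) = cone_class C' (h e)"
    "epi_part C' (h e) = q \<Zcomp>\<^bsub>C'\<^esub> Fa (epi_part C e)"
    using e' epi by simp_all
qed

lemma lift_ob_end_map: "c \<in> Ob C \<Longrightarrow> lift_ob C C' h c = F c"
  by (simp add: lift_ob_def end_map_idempotent)

text \<open>By \<open>end_map_idempotent\<close> the retraction used for \<open>b\<close> is
  \<open>q\<close> followed by \<open>F\<close> of the chosen retraction, and the inclusion of
  \<open>F a\<close> is \<open>F\<close> of the inclusion of \<open>a\<close> followed by
  \<open>j\<close>. Both occurrences of \<open>j q\<close> then vanish, and what remains is
  \<open>F\<close> applied to the extension of \<open>f\<close> cut down again, which is
  \<open>f\<close>.\<close>

lemma lift_ar_end_map: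
  assumes f: "f \<in> Hom C a b"
  shows "lift_ar C C' h f = Fa f"
proof -
  note ab = hom.Hom_Ob[OF f]
  let ?j = "top_inc C' (F (top_ob C))"
  have f': "f \<in> Ar C" "Dom C f = a" "Cod C f = b" using f by (auto simp: Hom_def)
  have "epi_part C' (h (top_idem C b)) = q \<Zcomp>\<^bsub>C'\<^esub> Fa (top_ret C b)"
    using end_map_idempotent(3)[of "top_idem C b"] ab by simp
  then have "lift_ar C C' h f = top_inc C' (F a) \<Zcomp>\<^bsub>C'\<^esub>
      (q \<Zcomp>\<^bsub>C'\<^esub> (Fa (top_ret C a \<Zcomp>\<^bsub>C\<^esub> f \<Zcomp>\<^bsub>C\<^esub> top_inc C b) \<Zcomp>\<^bsub>C'\<^esub> ?j)) \<Zcomp>\<^bsub>C'\<^esub>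
      (q \<Zcomp>\<^bsub>C'\<^esub> Fa (top_ret C b))"
    using hom.lift_ar_eq[OF f] end_map_eq[OF A.conjugate_in_M[OF f ab]] ab
    by (simp add: lift_ob_end_map)
  also have "\<dots> = (Fa (top_inc C a) \<Zcomp>\<^bsub>C'\<^esub> ?j) \<Zcomp>\<^bsub>C'\<^esub>
      (q \<Zcomp>\<^bsub>C'\<^esub> (Fa (top_ret C a \<Zcomp>\<^bsub>C\<^esub> f \<Zcomp>\<^bsub>C\<^esub> top_inc C b) \<Zcomp>\<^bsub>C'\<^esub> ?j)) \<Zcomp>\<^bsub>C'\<^esub>
      (q \<Zcomp>\<^bsub>C'\<^esub> Fa (top_ret C b))"
    by (simp add: Fa_top_inc ab)
  also have "\<dots> = Fa (top_inc C a) \<Zcomp>\<^bsub>C'\<^esub>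
      (Fa (top_ret C a \<Zcomp>\<^bsub>C\<^esub> f \<Zcomp>\<^bsub>C\<^esub> top_inc C b) \<Zcomp>\<^bsub>C'\<^esub> Fa (top_ret C b))"
    using base(1-3) f' ab
    by (simp add: B.assoc B.assoc_subst[OF base(4)])
  also have "\<dots> = Fa (top_inc C a \<Zcomp>\<^bsub>C\<^esub>
      ((top_ret C a \<Zcomp>\<^bsub>C\<^esub> f \<Zcomp>\<^bsub>C\<^esub> top_inc C b) \<Zcomp>\<^bsub>C\<^esub> top_ret C b))"
    using f' ab by (simp add: Fa_Cmp B.assoc)
  also have "\<dots> = Fa f" using f' ab by (simp add: A.assoc A.top_ret_subst)
  finally show ?thesis .
qed

lemma lift_end_map: "lift C C' h = FG"
proof (rule prod_eqI)
  have "lift_ob C C' h = F"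
    by (rule extensionalityI[of _ "Ob C"])
      (use F_extensional lift_ob_end_map in \<open>auto simp: lift_ob_def\<close>)
  moreover have "lift_ar C C' h = Fa"
  proof (rule extensionalityI[of _ "Ar C"])
    show "lift_ar C C' h f = Fa f" if "f \<in> Ar C" for f
      using lift_ar_end_map[of f "Dom C f" "Cod C f"] that by (simp add: Hom_def)
  qed (use F_extensional in \<open>simp_all add: lift_ar_def\<close>)
  ultimately show "fst (lift C C' h) = fst FG" by (simp add: lift_def)
  \<comment> \<open>Each class has an idempotent representative, and on those
    \<open>end_map_idempotent\<close> gives the value of \<open>G\<close>.\<close>
  have "lift_class C C' h = G"
  proof (rule extensionalityI[of _ "cone_classes C"])
    fix \<dd> assume "\<dd> \<in> cone_classes C"
    then obtain e where e: "e \<in> top_end C" "e \<Zcomp>\<^bsub>C\<^esub> e = e" "\<dd> = cone_class C e"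
      using A.cone_class_idempotent by blast
    then show "lift_class C C' h \<dd> = G \<dd>" using end_map_idempotent(2) by simp
  qed (use G_closed in \<open>auto simp: lift_class_def PiE_def\<close>)
  then show "snd (lift C C' h) = snd FG" by (simp add: lift_def)
qed

end

text \<open>The retraction of the composite is what has to be found. The composite attaches to the
  class of 1 the value of the second homomorphism at the idempotent \<open>?e = q j\<close>, and by
  \<open>end_map_idempotent\<close> its epimorphic part is the second retraction followed by the
  image of \<open>q\<close> under the second functor.\<close>

lemma end_map_cc_comp:
  assumes "bounded_cc_morphism C D FG" "bounded_cc_morphism D E FG'"
  shows "end_map C E (cc_comp C (cone_classes C) FG FG')
    = compose (top_end C) (end_map D E FG') (end_map C D FG)"
proof -
  interpret f: bounded_cc_morphism C D FG by fact
  interpret g: bounded_cc_morphism D E FG' by fact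
  let ?c = "top_ob C" and ?d = "top_ob D" and ?H = "cc_comp C (cone_classes C) FG FG'"
  let ?e = "f.q \<Zcomp>\<^bsub>D\<^esub> top_inc D (f.F ?c)"
  note e = f.base_idempotent
  have c: "?c \<in> Ob C" "f.F ?c \<in> Ob D" by simp_all
  have im: "image_ob D ?e = f.F ?c" "epi_part D ?e = f.q"
    using f.B.idempotent_of_retraction[OF f.F_Ob[OF f.A.top_ob(1)] f.base(1-4)] by auto
  note he = g.end_map_idempotent[OF e]
  have "g.G (f.G (cone_class C (Ide C ?c))) = cone_class E (g.h ?e)" using he(2) f.base(5) by simp
  moreover have "g.h ?e \<Zcomp>\<^bsub>E\<^esub> g.h ?e = g.h ?e" using g.hom.h_idem[OF e] .
  moreover have "g.h ?e \<in> top_end E" using g.hom.h_closed[OF e(1)] .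
  moreover have "g.F (f.F ?c) = image_ob E (g.h ?e)" using he(1) im(1) by simp
  ultimately have "idem_cone E (g.F (f.F ?c)) (g.G (f.G (cone_class C (Ide C ?c))))
      = principal_cone E (g.h ?e)"
    using g.B.idem_cone_eq[of "g.h ?e" "g.h ?e"] by simp
  then have q: "cc_retraction C E ?H = g.q \<Zcomp>\<^bsub>E\<^esub> g.Fa f.q"
    using he(3) im(2) g.hom.h_closed[OF e(1)] by (simp add: cc_retraction_def cc_comp_def compose_def)
  show ?thesis
  proof (rule extensionalityI[of _ "top_end C"])
    fix f assume f: "f \<in> top_end C"
    note f' = f.A.M_type[OF f]
    have "end_map C E ?H f = (g.q \<Zcomp>\<^bsub>E\<^esub> g.Fa f.q) \<Zcomp>\<^bsub>E\<^esub> g.Fa (f.Fa f)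
        \<Zcomp>\<^bsub>E\<^esub> top_inc E (g.F (f.F ?c))"
    proof -
      have "onAr (fst ?H) f = g.Fa (f.Fa f)" "onOb (fst ?H) ?c = g.F (f.F ?c)"
        using f' by (simp_all add: cc_comp_def compose_def)
      then show ?thesis using f by (simp add: end_map_def q)
    qed
    \<comment> \<open>\<open>Fa_top_inc\<close> splits the last inclusion into an image under the
      second functor and the inclusion of \<open>g.F ?d\<close>, which brings the whole of
      \<open>f.h f\<close> under that functor.\<close>
    also have "\<dots> = g.q \<Zcomp>\<^bsub>E\<^esub> (g.Fa (f.q \<Zcomp>\<^bsub>D\<^esub> (f.Fa f \<Zcomp>\<^bsub>D\<^esub> top_inc D (f.F ?c)))
        \<Zcomp>\<^bsub>E\<^esub> top_inc E (g.F ?d))"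
      using f' f.base(1-3) g.base(1-3) c
      by (simp add: g.Fa_Cmp g.B.assoc g.Fa_top_inc)
    also have "\<dots> = compose (top_end C) (end_map D E FG') (end_map C D FG) f"
      using f by (simp add: compose_def f.end_map_eq[symmetric] g.end_map_eq[symmetric])
    finally show "end_map C E ?H f = compose (top_end C) (end_map D E FG') (end_map C D FG) f" .
  qed (simp_all add: end_map_def compose_def)
qed

context bounded_normal_category
begin

lemma idem_cone_in_Ar:
  assumes \<dd>: "\<dd> \<in> cone_classes C" and con: "connected_by C c \<dd>" and c': "c' \<in> Ob C"
  shows "idem_cone C c \<dd> c' \<in> Ar C"
proof -
  obtain f where f: "f \<in> M" "\<dd> = cone_class C f" using \<dd> by (auto simp: cone_classes_eq)
  then obtain e where e: "e \<in> M" "e \<Zcomp> e = e" "image_ob C e = c" "right_le C f e" "right_le C e f"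
    using con connected_by_iff by auto
  have "idem_cone C c \<dd> = principal_cone C e" using idem_cone_eq[OF e(1,2) f(1) e(4,5)] e(3) f(2) by simp
  then show ?thesis using c' image(1-5)[OF e(1)] by (simp add: principal_cone_def)
qed

lemma cc_morphism_id: "cc_morphism C (cone_classes C) C (cone_classes C) (cc_id C (cone_classes C))"
  by (rule connected_category.cc_morphism_cc_id[OF connected_category_all idem_cone_in_Ar])

lemma end_map_cc_id: "end_map C C (cc_id C (cone_classes C)) = (\<lambda>f \<in> M. f)"
proof -
  interpret bounded_cc_morphism C C "cc_id C (cone_classes C)"
    by (intro bounded_cc_morphism.intro bounded_normal_category_axioms cc_morphism_id)
  have I: "Ide C d \<in> M" by simp
  have "image_ob C (Ide C d) = d" "epi_part C (Ide C d) = Ide C d"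
    using top_idem(3,4)[OF top_ob(1)] by simp_all
  then have "idem_cone C d (cone_class C (Ide C d)) = principal_cone C (Ide C d)"
    using idem_cone_eq[OF I _ I] by simp
  then have "cc_retraction C C (cc_id C (cone_classes C)) = Ide C d"
    by (simp add: cc_retraction_def cc_id_def epi_part_Ide)
  then show ?thesis
    unfolding end_map_def by (intro restrict_ext) (simp add: cc_id_def M_type)
qed

end

section \<open>The functor to regular monoids and its full faithfulness\<close>

definition end_monoid :: "('o, 'm, 'z) subcat_scheme \<Rightarrow> 'm monoid" where
  "end_monoid C = \<lparr>carrier = top_end C, mult = Cmp C, one = Ide C (top_ob C)\<rparr>"

definition end_functor :: "('u small_subcat, 'u cc_arrow, 'u monoid, 'u monoid_arrow) ftor" where
  "end_functor = \<lparr>onOb = end_monoid,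
     onAr = (\<lambda>(C, FG, C'). (end_monoid C, end_map C C' FG, end_monoid C'))\<rparr>"

lemma (in bounded_normal_category) regular_end_monoid: "regular_monoid (end_monoid C)"
  unfolding regular_monoid_def
proof
  show "monoid (end_monoid C)"
    by unfold_locales (auto simp: end_monoid_def M_type assoc)
  show "\<forall>a \<in> carrier (end_monoid C). \<exists>x \<in> carrier (end_monoid C).
      a \<otimes>\<^bsub>end_monoid C\<^esub> x \<otimes>\<^bsub>end_monoid C\<^esub> a = a"
    using top_end_regular by (simp add: end_monoid_def) metis
qed

lemma bounded_normal_category_iff:
  "bounded_normal_category C \<longleftrightarrow> normal_category C \<and> bounded_above C"
  by (simp add: bounded_normal_category_def bounded_normal_category_axioms_def)

lemma bounded_normal_categories_Ob:
  "C \<in> Ob bounded_normal_categories_cat \<longleftrightarrow> bounded_normal_category C"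
  by (simp add: bounded_normal_categories_cat_def bounded_normal_category_iff)

lemma bounded_normal_categories_Hom:
  "\<phi> \<in> Hom bounded_normal_categories_cat C C'
    \<longleftrightarrow> (\<exists>FG. \<phi> = (C, FG, C') \<and> bounded_cc_morphism C C' FG)"
  by (auto simp: bounded_normal_categories_cat_def Hom_def bounded_cc_morphism_def
      bounded_normal_category_iff)

lemma bounded_cc_morphism_comp:
  assumes "bounded_cc_morphism C D FG" "bounded_cc_morphism D E FG'"
  shows "bounded_cc_morphism C E (cc_comp C (cone_classes C) FG FG')"
proof -
  interpret f: bounded_cc_morphism C D FG by fact
  interpret g: bounded_cc_morphism D E FG' by fact
  show ?thesis
    by (intro bounded_cc_morphism.intro f.A.bounded_normal_category_axioms
        g.B.bounded_normal_category_axioms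
        cc_morphism_cc_comp[OF f.cc_morphism_axioms g.cc_morphism_axioms f.A.idem_cone_in_Ar])
qed

lemma category_bounded_normal_categories: "category bounded_normal_categories_cat"
proof
  let ?B = "bounded_normal_categories_cat :: ('a small_subcat, 'a cc_arrow) cat"
  fix \<phi> assume "\<phi> \<in> Ar ?B"
  then have "\<phi> \<in> Hom ?B (Dom ?B \<phi>) (Cod ?B \<phi>)" by (simp add: Hom_def)
  then obtain C FG C' where \<phi>: "\<phi> = (C, FG, C')" "bounded_cc_morphism C C' FG"
    unfolding bounded_normal_categories_Hom by (auto simp: bounded_normal_categories_cat_def)
  then interpret bounded_cc_morphism C C' FG by simp
  show "Dom ?B \<phi> \<in> Ob ?B" "Cod ?B \<phi> \<in> Ob ?B"
    unfolding bounded_normal_categories_Ob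
    using A.bounded_normal_category_axioms B.bounded_normal_category_axioms
    by (simp_all add: \<phi> bounded_normal_categories_cat_def)
  show "Ide ?B (Dom ?B \<phi>) \<Zcomp>\<^bsub>?B\<^esub> \<phi> = \<phi>" "\<phi> \<Zcomp>\<^bsub>?B\<^esub> Ide ?B (Cod ?B \<phi>) = \<phi>"
    using cc_comp_cc_id[OF functor_F F_extensional G_closed]
    by (simp_all add: \<phi> bounded_normal_categories_cat_def)
next
  fix C :: "'a small_subcat"
  let ?B = "bounded_normal_categories_cat :: ('a small_subcat, 'a cc_arrow) cat"
  assume "C \<in> Ob ?B"
  then interpret bounded_normal_category C by (simp add: bounded_normal_categories_Ob)
  show "Ide ?B C \<in> Hom ?B C C"
    unfolding bounded_normal_categories_Hom
    by (simp add: bounded_normal_categories_cat_def bounded_cc_morphism_def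
        bounded_normal_category_axioms cc_morphism_id)
next
  fix \<phi> \<psi> and C D E :: "'a small_subcat"
  let ?B = "bounded_normal_categories_cat :: ('a small_subcat, 'a cc_arrow) cat"
  assume "\<phi> \<in> Hom ?B C D" "\<psi> \<in> Hom ?B D E"
  then show "\<phi> \<Zcomp>\<^bsub>?B\<^esub> \<psi> \<in> Hom ?B C E"
    unfolding bounded_normal_categories_Hom
    by (auto simp: bounded_normal_categories_cat_def bounded_cc_morphism_comp
        simp del: split_paired_Ex)
next
  fix \<phi> \<psi> \<chi> and C D E K :: "'a small_subcat"
  let ?B = "bounded_normal_categories_cat :: ('a small_subcat, 'a cc_arrow) cat"
  assume "\<phi> \<in> Hom ?B C D" "\<psi> \<in> Hom ?B D E" "\<chi> \<in> Hom ?B E K"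
  then obtain FG FG' FG'' where *: "\<phi> = (C, FG, D)" "\<psi> = (D, FG', E)" "\<chi> = (E, FG'', K)"
    "bounded_cc_morphism C D FG"
    unfolding bounded_normal_categories_Hom by blast
  then interpret bounded_cc_morphism C D FG by simp
  show "\<phi> \<Zcomp>\<^bsub>?B\<^esub> \<psi> \<Zcomp>\<^bsub>?B\<^esub> \<chi> = \<phi> \<Zcomp>\<^bsub>?B\<^esub> (\<psi> \<Zcomp>\<^bsub>?B\<^esub> \<chi>)"
    using cc_comp_assoc[OF functor_F G_closed] by (simp add: * bounded_normal_categories_cat_def)
qed

lemma regular_monoids_Hom:
  "\<phi> \<in> Hom regular_monoids_cat S T \<longleftrightarrow> regular_monoid S \<and> regular_monoid T \<and>
    (\<exists>h. \<phi> = (S, h, T) \<and> h \<in> hom S T \<and> h \<in> extensional (carrier S))"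
  by (auto simp: regular_monoids_cat_def Hom_def)

lemma functor_end: "is_functor bounded_normal_categories_cat regular_monoids_cat end_functor"
proof
  fix C :: "'a small_subcat"
  assume "C \<in> Ob bounded_normal_categories_cat"
  then interpret bounded_normal_category C by (simp add: bounded_normal_categories_Ob)
  show "onOb end_functor C \<in> Ob regular_monoids_cat"
    using regular_end_monoid by (simp add: end_functor_def regular_monoids_cat_def)
  show "onAr end_functor (Ide bounded_normal_categories_cat C)
      = Ide regular_monoids_cat (onOb end_functor C)"
    using end_map_cc_id
    by (simp add: end_functor_def regular_monoids_cat_def bounded_normal_categories_cat_def
        end_monoid_def)
next
  fix \<phi> and C C' :: "'a small_subcat"
  assume "\<phi> \<in> Hom bounded_normal_categories_cat C C'"
  then obtain FG where \<phi>: "\<phi> = (C, FG, C')" "bounded_cc_morphism C C' FG"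
    unfolding bounded_normal_categories_Hom by blast
  then interpret bounded_cc_morphism C C' FG by simp
  show "onAr end_functor \<phi> \<in> Hom regular_monoids_cat (onOb end_functor C) (onOb end_functor C')"
    unfolding regular_monoids_Hom
    using A.regular_end_monoid B.regular_end_monoid hom.h_closed hom.h_Cmp
    by (auto simp: \<phi> end_functor_def end_monoid_def hom_def end_map_def[of C C' FG])
next
  fix \<phi> \<psi> and C D E :: "'a small_subcat"
  assume "\<phi> \<in> Hom bounded_normal_categories_cat C D" "\<psi> \<in> Hom bounded_normal_categories_cat D E"
  then obtain FG FG' where *: "\<phi> = (C, FG, D)" "\<psi> = (D, FG', E)"
    "bounded_cc_morphism C D FG" "bounded_cc_morphism D E FG'"
    unfolding bounded_normal_categories_Hom by blast
  then show "onAr end_functor (\<phi> \<Zcomp>\<^bsub>bounded_normal_categories_cat\<^esub> \<psi>)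
      = onAr end_functor \<phi> \<Zcomp>\<^bsub>regular_monoids_cat\<^esub> onAr end_functor \<psi>"
    using end_map_cc_comp[OF *(3,4)]
    by (simp add: end_functor_def regular_monoids_cat_def bounded_normal_categories_cat_def
        end_monoid_def)
qed

lemma faithful_end:
  assumes "\<phi> \<in> Hom bounded_normal_categories_cat C C'" "\<psi> \<in> Hom bounded_normal_categories_cat C C'"
    and eq: "onAr end_functor \<phi> = onAr end_functor \<psi>"
  shows "\<phi> = \<psi>"
proof -
  obtain FG FG' where *: "\<phi> = (C, FG, C')" "\<psi> = (C, FG', C')"
    "bounded_cc_morphism C C' FG" "bounded_cc_morphism C C' FG'"
    using assms(1,2) unfolding bounded_normal_categories_Hom by blast
  then have "end_map C C' FG = end_map C C' FG'" using eq by (simp add: end_functor_def)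
  then have "FG = FG'" using *(3,4)[THEN bounded_cc_morphism.lift_end_map] by metis
  then show ?thesis using * by simp
qed

lemma full_end:
  assumes C: "C \<in> Ob bounded_normal_categories_cat" and C': "C' \<in> Ob bounded_normal_categories_cat"
    and \<phi>: "\<phi> \<in> Hom regular_monoids_cat (onOb end_functor C) (onOb end_functor C')"
  shows "\<exists>\<psi> \<in> Hom bounded_normal_categories_cat C C'. onAr end_functor \<psi> = \<phi>"
proof -
  interpret A: bounded_normal_category C using C by (simp add: bounded_normal_categories_Ob)
  interpret B: bounded_normal_category C' using C' by (simp add: bounded_normal_categories_Ob)
  obtain h where h: "\<phi> = (end_monoid C, h, end_monoid C')" "h \<in> hom (end_monoid C) (end_monoid C')"
    "h \<in> extensional (top_end C)"
    using \<phi> unfolding regular_monoids_Hom by (auto simp: end_functor_def end_monoid_def)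
  interpret top_end_hom C C' h
    by unfold_locales (use h(2) in \<open>auto simp: hom_def end_monoid_def\<close>)
  have "end_map C C' (lift C C' h) = h"
    by (rule extensionalityI[of _ "top_end C"])
      (use h(3) end_map_lift in \<open>simp_all add: end_map_def\<close>)
  then have "onAr end_functor (C, lift C C' h, C') = \<phi>" by (simp add: end_functor_def h(1))
  moreover have "(C, lift C C' h, C') \<in> Hom bounded_normal_categories_cat C C'"
    unfolding bounded_normal_categories_Hom bounded_cc_morphism_def
    using A.bounded_normal_category_axioms B.bounded_normal_category_axioms cc_morphism_lift
    by simp
  ultimately show ?thesis by blast
qed


section \<open>The category of principal left ideals of a regular monoid\<close>

context monoid
begin

definition idem :: "'a \<Rightarrow> bool" where
  "idem e \<longleftrightarrow> e \<in> carrier G \<and> e \<otimes> e = e"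

text \<open>The predicate is the same for all idempotents generating the left ideal of
  \<open>e\<close>, so the choice picks one generator per principal left ideal
  (\<open>left_rep_cong\<close>). With all idempotents as objects, two distinct objects could
  include each other, which a strict preorder forbids.\<close>

definition left_rep :: "'a \<Rightarrow> 'a" where
  "left_rep e = (SOME f. idem f \<and> e \<otimes> f = e \<and> f \<otimes> e = f)"

definition left_reps :: "'a set" where
  "left_reps = {e. idem e \<and> left_rep e = e}"

definition left_arrow :: "'a \<Rightarrow> 'a \<Rightarrow> 'a \<Rightarrow> bool" where
  "left_arrow e u f \<longleftrightarrow> e \<in> left_reps \<and> f \<in> left_reps \<and> u \<in> carrier G \<and> e \<otimes> u = u \<and> u \<otimes> f = u"

text \<open>The arrow \<open>enc (e, u, f)\<close> is right translation by \<open>u\<close> from \<open>Ge\<close> to \<open>Gf\<close>; it is an inclusion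
  when \<open>Ge \<subseteq> Gf\<close> and \<open>u = e\<close>. A principal left ideal is represented by one of its idempotent
  generators.\<close>

definition left_ideal_cat :: "('a \<times> 'a \<times> 'a \<Rightarrow> 'a) \<Rightarrow> ('a, 'a) subcat" where
  "left_ideal_cat enc =
     \<lparr>Ob = left_reps,
      Ar = {enc (e, u, f) | e u f. left_arrow e u f},
      Dom = (\<lambda>m. fst (inv_into UNIV enc m)),
      Cod = (\<lambda>m. snd (snd (inv_into UNIV enc m))),
      Ide = (\<lambda>e. enc (e, e, e)),
      Cmp = (\<lambda>m n. enc (fst (inv_into UNIV enc m), fst (snd (inv_into UNIV enc m)) \<otimes> fst (snd (inv_into UNIV enc n)),
                        snd (snd (inv_into UNIV enc n)))),
      Inc = {enc (e, e, f) | e f. left_arrow e e f}\<rparr>"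

lemma m_subst:
  "\<lbrakk>x \<otimes> y = z; x \<in> carrier G; y \<in> carrier G; w \<in> carrier G\<rbrakk> \<Longrightarrow> x \<otimes> (y \<otimes> w) = z \<otimes> w"
  using m_assoc by metis

lemma left_rep:
  assumes "idem e"
  shows "idem (left_rep e)" "e \<otimes> left_rep e = e" "left_rep e \<otimes> e = left_rep e"
proof -
  have "\<exists>f. idem f \<and> e \<otimes> f = e \<and> f \<otimes> e = f" using assms by (auto simp: idem_def)
  then have "idem (left_rep e) \<and> e \<otimes> left_rep e = e \<and> left_rep e \<otimes> e = left_rep e"
    unfolding left_rep_def by (rule someI_ex)
  then show "idem (left_rep e)" "e \<otimes> left_rep e = e" "left_rep e \<otimes> e = left_rep e" by auto
qed

lemma left_rep_cong:
  assumes "idem e" "idem f" "e \<otimes> f = e" "f \<otimes> e = f"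
  shows "left_rep e = left_rep f"
proof -
  have "(e \<otimes> g = e \<and> g \<otimes> e = g) \<longleftrightarrow> (f \<otimes> g = f \<and> g \<otimes> f = g)" if "idem g" for g
    using that assms m_assoc unfolding idem_def by metis
  then show ?thesis unfolding left_rep_def by (intro arg_cong[where f = Eps] ext) blast
qed

lemma left_repsD: "e \<in> left_reps \<Longrightarrow> e \<in> carrier G" "e \<in> left_reps \<Longrightarrow> e \<otimes> e = e"
  by (auto simp: left_reps_def idem_def)

lemma left_rep_in_reps: "idem e \<Longrightarrow> left_rep e \<in> left_reps"
  using left_rep left_rep_cong by (simp add: left_reps_def)

lemma left_reps_eqI:
  "\<lbrakk>e \<in> left_reps; f \<in> left_reps; e \<otimes> f = e; f \<otimes> e = f\<rbrakk> \<Longrightarrow> e = f"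
  using left_rep_cong[of e f] by (auto simp: left_reps_def)

text \<open>An idempotent \<open>f\<close> with \<open>\<one> \<otimes> f = \<one>\<close> is
  \<open>\<one>\<close>, so the choice is forced. This keeps the identity as an object, standing for
  the left ideal \<open>G\<close>.\<close>

lemma one_in_left_reps: "\<one> \<in> left_reps"
proof -
  have "idem \<one>" by (simp add: idem_def)
  then have "left_rep \<one> = \<one>" using left_rep[of \<one>] by (simp add: idem_def)
  then show ?thesis using \<open>idem \<one>\<close> by (simp add: left_reps_def)
qed

end

text \<open>\<open>enc\<close> brings the arrows, which are triples, into the type of the monoid
  elements, as the common universe of the two categories requires.\<close>

locale encoded_regular_monoid = monoid G for G :: "'a monoid" (structure) +
  fixes enc :: "'a \<times> 'a \<times> 'a \<Rightarrow> 'a"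
  assumes regular: "a \<in> carrier G \<Longrightarrow> \<exists>x \<in> carrier G. a \<otimes> x \<otimes> a = a"
    and inj_enc: "inj enc"
begin

abbreviation "L \<equiv> left_ideal_cat enc"

lemma enc_eq [simp]: "enc x = enc y \<longleftrightarrow> x = y"
  using inj_enc by (auto dest: injD)

lemma L_simps [simp]:
  "Ob L = left_reps" "Dom L (enc (e, u, f)) = e" "Cod L (enc (e, u, f)) = f"
  "Ide L e = enc (e, e, e)" "enc (e, u, f) \<Zcomp>\<^bsub>L\<^esub> enc (g, v, k) = enc (e, u \<otimes> v, k)"
  by (simp_all add: left_ideal_cat_def inv_f_f[OF inj_enc])

lemma Ar_iff: "m \<in> Ar L \<longleftrightarrow> (\<exists>e u f. m = enc (e, u, f) \<and> left_arrow e u f)"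
  by (simp add: left_ideal_cat_def)

lemma Inc_iff: "m \<in> Inc L \<longleftrightarrow> (\<exists>e f. m = enc (e, e, f) \<and> left_arrow e e f)"
  by (simp add: left_ideal_cat_def)

lemma Hom_iff: "m \<in> Hom L e f \<longleftrightarrow> (\<exists>u. m = enc (e, u, f) \<and> left_arrow e u f)"
  by (auto simp: Hom_def Ar_iff)

lemma enc_in_Ar [simp]: "enc (e, u, f) \<in> Ar L \<longleftrightarrow> left_arrow e u f"
  by (simp add: Ar_iff)

lemma enc_in_Hom [simp]: "enc (e, u, f) \<in> Hom L g k \<longleftrightarrow> e = g \<and> f = k \<and> left_arrow e u f"
  by (auto simp: Hom_iff)

lemma left_arrowD:
  assumes "left_arrow e u f"
  shows "e \<in> left_reps" "f \<in> left_reps" "e \<in> carrier G" "f \<in> carrier G" "u \<in> carrier G"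
    "e \<otimes> u = u" "u \<otimes> f = u" "e \<otimes> e = e" "f \<otimes> f = f"
  using assms left_repsD by (auto simp: left_arrow_def)

lemma left_arrow_Ide: "e \<in> left_reps \<Longrightarrow> left_arrow e e e"
  using left_repsD by (simp add: left_arrow_def)

lemma left_arrow_Cmp:
  assumes "left_arrow e u f" "left_arrow f v g"
  shows "left_arrow e (u \<otimes> v) g"
proof -
  note D = left_arrowD[OF assms(1)] and D' = left_arrowD[OF assms(2)]
  have "e \<otimes> (u \<otimes> v) = u \<otimes> v" using m_subst[OF D(6)] D D' by simp
  moreover have "(u \<otimes> v) \<otimes> g = u \<otimes> v" using D D' by (simp add: m_assoc)
  ultimately show ?thesis using D D' by (simp add: left_arrow_def)
qed

lemma category_L: "category L"
proof
  fix m assume "m \<in> Ar L"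
  then obtain e u f where m: "m = enc (e, u, f)" "left_arrow e u f" by (auto simp: Ar_iff)
  note D = left_arrowD[OF m(2)]
  show "Dom L m \<in> Ob L" "Cod L m \<in> Ob L" "Ide L (Dom L m) \<Zcomp>\<^bsub>L\<^esub> m = m"
    "m \<Zcomp>\<^bsub>L\<^esub> Ide L (Cod L m) = m"
    using D by (simp_all add: m)
next
  show "Ide L e \<in> Hom L e e" if "e \<in> Ob L" for e using that left_arrow_Ide by simp
next
  show "m \<Zcomp>\<^bsub>L\<^esub> n \<in> Hom L e g" if "m \<in> Hom L e f" "n \<in> Hom L f g" for m n e f g
    using that left_arrow_Cmp by (auto simp: Hom_iff)
next
  show "m \<Zcomp>\<^bsub>L\<^esub> n \<Zcomp>\<^bsub>L\<^esub> k = m \<Zcomp>\<^bsub>L\<^esub> (n \<Zcomp>\<^bsub>L\<^esub> k)"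
    if "m \<in> Hom L a b" "n \<in> Hom L b c" "k \<in> Hom L c d" for m n k a b c d
    using that by (auto simp: Hom_iff m_assoc dest!: left_arrowD(5))
qed

lemma inc_cat_simps [simp]:
  "Ob (inc_cat L) = Ob L" "Ar (inc_cat L) = Inc L" "Dom (inc_cat L) = Dom L"
  "Cod (inc_cat L) = Cod L" "Ide (inc_cat L) = Ide L" "Cmp (inc_cat L) = Cmp L"
  by (simp_all add: inc_cat_def)

lemma Hom_inc_iff: "m \<in> Hom (inc_cat L) e f \<longleftrightarrow> m = enc (e, e, f) \<and> left_arrow e e f"
  by (auto simp: Hom_def Inc_iff)

lemma category_inc_cat: "category (inc_cat L)"
proof
  fix m assume "m \<in> Ar (inc_cat L)"
  then obtain e f where m: "m = enc (e, e, f)" "left_arrow e e f" by (auto simp: Inc_iff)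
  note D = left_arrowD[OF m(2)]
  show "Dom (inc_cat L) m \<in> Ob (inc_cat L)" "Cod (inc_cat L) m \<in> Ob (inc_cat L)"
    "Ide (inc_cat L) (Dom (inc_cat L) m) \<Zcomp>\<^bsub>inc_cat L\<^esub> m = m"
    "m \<Zcomp>\<^bsub>inc_cat L\<^esub> Ide (inc_cat L) (Cod (inc_cat L) m) = m"
    using D by (simp_all add: m)
next
  show "Ide (inc_cat L) e \<in> Hom (inc_cat L) e e" if "e \<in> Ob (inc_cat L)" for e
    using that left_arrow_Ide by (simp add: Hom_inc_iff)
next
  show "m \<Zcomp>\<^bsub>inc_cat L\<^esub> n \<in> Hom (inc_cat L) e g"
    if "m \<in> Hom (inc_cat L) e f" "n \<in> Hom (inc_cat L) f g" for m n e f g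
    using that left_arrow_Cmp[of e e f f g] left_arrowD(7)[of e e f] by (simp add: Hom_inc_iff)
next
  show "m \<Zcomp>\<^bsub>inc_cat L\<^esub> n \<Zcomp>\<^bsub>inc_cat L\<^esub> k = m \<Zcomp>\<^bsub>inc_cat L\<^esub> (n \<Zcomp>\<^bsub>inc_cat L\<^esub> k)"
    if "m \<in> Hom (inc_cat L) a b" "n \<in> Hom (inc_cat L) b c" "k \<in> Hom (inc_cat L) c d"
    for m n k a b c d
    using that m_assoc[of a b c] left_arrowD(3,4)[of a a b] left_arrowD(4)[of b b c]
    by (simp add: Hom_inc_iff)
qed

lemma category_with_subobjects_L: "category_with_subobjects L"
proof (intro category_with_subobjects.intro category_L category_with_subobjects_axioms.intro)
  show "Inc L \<subseteq> Ar L" by (auto simp: Inc_iff)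
  show "strict_preorder (inc_cat L)"
    unfolding strict_preorder_def
  proof (intro conjI category_inc_cat allI ballI impI)
    show "m = n" if "m \<in> Hom (inc_cat L) e f" "n \<in> Hom (inc_cat L) e f" for m n e f
      using that by (simp add: Hom_inc_iff)
    fix m assume "is_iso (inc_cat L) m"
    then obtain e f where m: "m = enc (e, e, f)" "left_arrow e e f" "left_arrow f f e"
      by (auto simp: is_iso_def Inc_iff Hom_inc_iff)
    then have "e = f" using left_arrowD[OF m(2)] left_arrowD[OF m(3)] left_reps_eqI by simp
    then show "m = Ide (inc_cat L) (Dom (inc_cat L) m)" by (simp add: m)
  qed
next
  fix m assume "m \<in> Inc L"
  then obtain e f where m: "m = enc (e, e, f)" "left_arrow e e f" by (auto simp: Inc_iff)
  \<comment> \<open>Composing with an inclusion of \<open>Ge\<close> changes the target and not the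
    translating element: \<open>u \<otimes> e = u\<close>.\<close>
  then show "is_mono L m"
    by (auto simp: is_mono_def Hom_iff left_arrowD)
next
  fix m n k assume "m \<in> Inc L" "n \<in> Inc L" "k \<in> Ar L" "Cod L k = Dom L n" and eq: "m = k \<Zcomp>\<^bsub>L\<^esub> n"
  then obtain e f g u where *: "n = enc (f, f, g)" "k = enc (e, u, f)" "left_arrow e u f"
    "m = enc (e, e, g)"
    by (auto simp: Inc_iff Ar_iff)
  \<comment> \<open>Injectivity of \<open>enc\<close> extracts \<open>e = u \<otimes> f\<close>, and
    \<open>u \<otimes> f = u\<close> because \<open>k\<close> ends at \<open>f\<close>.\<close>
  then have "u = e" using eq left_arrowD(7)[OF *(3)] by simp
  then show "k \<in> Inc L" using * by (auto simp: Inc_iff)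
qed

lemma left_arrow_retraction:
  assumes "left_arrow e e f"
  shows "left_arrow f (f \<otimes> e) e" "e \<otimes> (f \<otimes> e) = e"
  using left_arrowD[OF assms] by (simp_all add: left_arrow_def m_assoc m_subst)

lemma retraction_L:
  assumes "left_arrow e e f" "left_arrow f u e" "e \<otimes> u = e"
  shows "retraction_of L (enc (e, e, f)) (enc (f, u, e))"
  using assms by (auto simp: retraction_of_def Inc_iff)

text \<open>For an inverse \<open>x\<close> of \<open>u\<close> with \<open>eu = u\<close>, the idempotent \<open>uxe\<close> generates the left ideal onto
  which \<open>Ge\<close> is retracted and \<open>xu\<close> generates the image \<open>Gu\<close>.\<close>

lemma ex_normal_factorisation_L:
  assumes "m \<in> Ar L"
  shows "\<exists>q i j. normal_factorisation L m q i j"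
proof -
  obtain e u f where m: "m = enc (e, u, f)" "left_arrow e u f" using assms by (auto simp: Ar_iff)
  note D = left_arrowD[OF m(2)]
  obtain x where x: "x \<in> carrier G" "u \<otimes> x \<otimes> u = u" using regular D by blast
  then have uxu: "u \<otimes> (x \<otimes> u) = u" using m_assoc D by simp
  have uxu': "u \<otimes> (x \<otimes> (u \<otimes> w)) = u \<otimes> w" if "w \<in> carrier G" for w
    using that x D m_assoc[of "u \<otimes> x" u w] by (simp add: m_assoc)
  have eu': "e \<otimes> (u \<otimes> w) = u \<otimes> w" if "w \<in> carrier G" for w
    using m_subst[OF D(6)] that D by simp
  \<comment> \<open>\<open>u \<otimes> x\<close> is idempotent but need not lie in
    \<open>Ge\<close>. The factor \<open>e\<close> on the right forces this, and
    \<open>e \<otimes> u = u\<close> keeps \<open>p\<close> idempotent with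
    \<open>p \<otimes> u = u\<close>.\<close>
  define p where "p = u \<otimes> x \<otimes> e"
  have p: "idem p" "p \<in> carrier G" "e \<otimes> p = p" "p \<otimes> e = p" "p \<otimes> u = u"
    using D x by (simp_all add: idem_def p_def m_assoc eu' uxu uxu')
  have xu: "idem (x \<otimes> u)" using D x by (simp add: idem_def m_assoc uxu)
  define g where "g = left_rep p"
  define k where "k = left_rep (x \<otimes> u)"
  have g: "g \<in> left_reps" "g \<in> carrier G" "p \<otimes> g = p" "g \<otimes> p = g" "g \<otimes> g = g"
    using left_rep[OF p(1)] left_rep_in_reps[OF p(1)] left_repsD unfolding g_def by auto
  have k: "k \<in> left_reps" "k \<in> carrier G" "(x \<otimes> u) \<otimes> k = x \<otimes> u" "k \<otimes> (x \<otimes> u) = k" "k \<otimes> k = k"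
    using left_rep[OF xu] left_rep_in_reps[OF xu] left_repsD unfolding k_def by auto
  note carrier = D(3-5) x(1) p(2) g(2) k(2)
  have ge: "g \<otimes> e = g" using g p D by (metis m_assoc)
  have uk: "u \<otimes> k = u"
  proof -
    have "u \<otimes> k = (u \<otimes> (x \<otimes> u)) \<otimes> k" using uxu by simp
    also have "\<dots> = u \<otimes> ((x \<otimes> u) \<otimes> k)" using carrier by (simp add: m_assoc)
    also have "\<dots> = u" using k uxu by simp
    finally show ?thesis .
  qed
  have kf: "k \<otimes> f = k"
  proof -
    have "k \<otimes> f = k \<otimes> (x \<otimes> u) \<otimes> f" using k by simp
    also have "\<dots> = k \<otimes> (x \<otimes> (u \<otimes> f))" using carrier by (simp add: m_assoc)
    also have "\<dots> = k" using D k by simp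
    finally show ?thesis .
  qed
  have kxp: "k \<otimes> (x \<otimes> (p \<otimes> u)) = k" using k p by simp
  have inc_g: "left_arrow g g e" using g ge D by (simp add: left_arrow_def)
  have arrow_p: "left_arrow e p g" using g p D by (simp add: left_arrow_def)
  \<comment> \<open>The isomorphism from \<open>Gg\<close> to \<open>Gk\<close> is right translation
    by \<open>u\<close>, its inverse right translation by \<open>x \<otimes> p\<close>. The factors
    \<open>g\<close> and \<open>k\<close> in front normalise the translating elements to the form
    that \<open>left_arrow\<close> demands.\<close>
  have arrow_u: "left_arrow g (g \<otimes> u) k" using g k D uk by (simp add: left_arrow_def m_assoc m_subst)
  have arrow_v: "left_arrow k (k \<otimes> (x \<otimes> p)) g"
  proof -
    have "k \<otimes> (k \<otimes> (x \<otimes> p)) = k \<otimes> (x \<otimes> p)" using m_subst[OF k(5)] carrier by simp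
    moreover have "(k \<otimes> (x \<otimes> p)) \<otimes> g = k \<otimes> (x \<otimes> (p \<otimes> g))" using carrier by (simp add: m_assoc)
    ultimately show ?thesis using g(1,3) k(1) carrier by (simp add: left_arrow_def)
  qed
  have inc_k: "left_arrow k k f" using k kf D by (simp add: left_arrow_def)
  have "(g \<otimes> u) \<otimes> (k \<otimes> (x \<otimes> p)) = g \<otimes> ((u \<otimes> k) \<otimes> (x \<otimes> p))"
    using carrier by (simp add: m_assoc)
  also have "\<dots> = g \<otimes> (u \<otimes> (x \<otimes> p))" using uk by simp
  also have "u \<otimes> (x \<otimes> p) = p" using D x by (simp add: p_def m_assoc uxu')
  finally have uv: "(g \<otimes> u) \<otimes> (k \<otimes> (x \<otimes> p)) = g" using g by simp
  have "(k \<otimes> (x \<otimes> p)) \<otimes> (g \<otimes> u) = k \<otimes> (x \<otimes> ((p \<otimes> g) \<otimes> u))"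
    using carrier by (simp add: m_assoc)
  also have "\<dots> = k" using g kxp by simp
  finally have vu: "(k \<otimes> (x \<otimes> p)) \<otimes> (g \<otimes> u) = k" .
  have "is_iso L (enc (g, g \<otimes> u, k))"
    unfolding is_iso_def
    by (intro conjI bexI[of _ "enc (k, k \<otimes> (x \<otimes> p), g)"])
      (use arrow_u arrow_v uv vu in simp_all)
  moreover have "p \<otimes> (g \<otimes> u) \<otimes> k = (p \<otimes> g) \<otimes> (u \<otimes> k)" using carrier by (simp add: m_assoc)
  then have "m = enc (e, p, g) \<Zcomp>\<^bsub>L\<^esub> enc (g, g \<otimes> u, k) \<Zcomp>\<^bsub>L\<^esub> enc (k, k, f)"
    using g p uk by (simp add: m)
  moreover have "retraction_of L (enc (g, g, e)) (enc (e, p, g))"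
    using retraction_L[OF inc_g arrow_p] g by simp
  ultimately have "normal_factorisation L m (enc (e, p, g)) (enc (g, g \<otimes> u, k)) (enc (k, k, f))"
    unfolding normal_factorisation_def using inc_k by (auto simp: Inc_iff)
  then show ?thesis by blast
qed

text \<open>Right translation by \<open>e\<close> is defined on all of \<open>G\<close>; its
  restrictions to the left ideals are compatible with inclusions, and on \<open>Ge\<close> it is the
  identity.\<close>

lemma ex_cone_L:
  assumes e: "e \<in> Ob L"
  shows "\<exists>\<mu>. is_cone L e \<mu> \<and> \<mu> e = Ide L e"
proof (intro exI[of _ "\<lambda>f \<in> left_reps. enc (f, f \<otimes> e, e)"] conjI)
  let ?\<mu> = "\<lambda>f \<in> left_reps. enc (f, f \<otimes> e, e)"
  have eD: "e \<in> left_reps" "e \<in> carrier G" "e \<otimes> e = e" using e left_repsD by auto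
  then show "?\<mu> e = Ide L e" by simp
  show "is_cone L e ?\<mu>"
    unfolding is_cone_def
  proof (intro conjI ballI)
    show "e \<in> Ob L" by fact
    show "?\<mu> \<in> extensional (Ob L)" by simp
    show "?\<mu> f \<in> Hom L f e" if "f \<in> Ob L" for f
      using that eD left_repsD[of f] by (simp add: left_arrow_def m_assoc m_subst)
    show "j \<Zcomp>\<^bsub>L\<^esub> ?\<mu> (Cod L j) = ?\<mu> (Dom L j)" if "j \<in> Inc L" for j
      using that eD by (auto simp: Inc_iff left_arrowD m_subst)
    show "\<exists>c \<in> Ob L. is_iso L (?\<mu> c)"
      unfolding is_iso_def
      by (intro bexI[of _ e] conjI bexI[of _ "Ide L e"]) (use eD left_arrow_Ide in simp_all)
  qed
qed

lemma normal_category_L: "normal_category L"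
proof (intro normal_category.intro category_with_subobjects_L normal_category_axioms.intro)
  fix j assume "j \<in> Inc L"
  then obtain e f where j: "j = enc (e, e, f)" "left_arrow e e f" by (auto simp: Inc_iff)
  then show "\<exists>q. retraction_of L j q"
    using retraction_L[OF j(2) left_arrow_retraction[OF j(2)]] by blast
qed (use ex_normal_factorisation_L ex_cone_L in blast)+

section \<open>The greatest object and its endomorphism monoid\<close>

lemma subobj_one:
  assumes "e \<in> Ob L"
  shows "subobj L e \<one>"
proof -
  have "left_arrow e e \<one>"
    using assms one_in_left_reps left_repsD[of e] by (simp add: left_arrow_def)
  then have "enc (e, e, \<one>) \<in> Inc L \<inter> Hom L e \<one>" by (simp add: Inc_iff)
  then show ?thesis unfolding subobj_def by blast
qed

lemma bounded_normal_category_L: "bounded_normal_category L"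
  unfolding bounded_normal_category_iff bounded_above_def
  using normal_category_L subobj_one one_in_left_reps by auto

lemma top_ob_L: "top_ob L = \<one>"
  using category_with_subobjects.top_ob_eq[OF category_with_subobjects_L] subobj_one
    one_in_left_reps by simp

lemma top_end_L: "top_end L = (\<lambda>u. enc (\<one>, u, \<one>)) ` carrier G"
  using one_in_left_reps by (auto simp: top_end_def top_ob_L Hom_iff left_arrow_def)

text \<open>The endomorphisms of the left ideal \<open>G\<close> are the right translations by its
  elements. Composed from left to right they multiply in the order of \<open>G\<close>, so the
  monoid is recovered and not its opposite.\<close>

lemma iso_end_monoid_L:
  "\<exists>\<eta> \<in> Hom regular_monoids_cat G (end_monoid L). is_iso regular_monoids_cat \<eta>"
proof -
  let ?h = "\<lambda>u \<in> carrier G. enc (\<one>, u, \<one>)" and ?k = "\<lambda>m \<in> top_end L. fst (snd (inv_into UNIV enc m))"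
  have reg: "regular_monoid G" "regular_monoid (end_monoid L)"
    using regular monoid_axioms bounded_normal_category.regular_end_monoid[OF bounded_normal_category_L]
    by (simp_all add: regular_monoid_def)
  have h: "(G, ?h, end_monoid L) \<in> Hom regular_monoids_cat G (end_monoid L)"
    using reg by (auto simp: regular_monoids_Hom hom_def end_monoid_def top_end_L)
  have k: "(end_monoid L, ?k, G) \<in> Hom regular_monoids_cat (end_monoid L) G"
    using reg by (auto simp: regular_monoids_Hom hom_def end_monoid_def top_end_L inv_f_f[OF inj_enc])
  have "compose (carrier G) ?k ?h = (\<lambda>x \<in> carrier G. x)"
    by (auto simp: compose_def top_end_L inv_f_f[OF inj_enc] intro!: restrict_ext)
  moreover have "compose (top_end L) ?h ?k = (\<lambda>x \<in> top_end L. x)"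
    by (auto simp: compose_def top_end_L inv_f_f[OF inj_enc] intro!: restrict_ext)
  ultimately have "is_iso regular_monoids_cat (G, ?h, end_monoid L)"
    by (intro category.is_isoI[OF category_regular_monoids h k])
      (simp_all add: regular_monoids_cat_def end_monoid_def)
  with h show ?thesis by blast
qed

end

text \<open>An infinite set is equinumerous with its square; using such a pairing function twice
  encodes triples.\<close>

lemma ex_encoding:
  assumes "infinite (UNIV :: 'u set)"
  shows "\<exists>enc :: 'u \<times> 'u \<times> 'u \<Rightarrow> 'u. inj enc"
proof -
  have "\<exists>f :: 'u \<times> 'u \<Rightarrow> 'u. bij_betw f (UNIV \<times> UNIV) UNIV"
    using card_of_Times_same_infinite[OF assms] unfolding card_of_ordIso .
  then obtain f :: "'u \<times> 'u \<Rightarrow> 'u" where f: "inj f" by (auto simp: bij_betw_def)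
  have "inj (\<lambda>(x, y). f (x, f y))"
    by (auto intro!: injI simp: inj_eq[OF f])
  then show ?thesis by blast
qed

theorem theorem7p8:
  assumes "infinite (UNIV :: 'u set)"
  shows "equivalent_categories
           (regular_monoids_cat :: ('u monoid, 'u monoid_arrow) cat)
           (bounded_normal_categories_cat :: ('u small_subcat, 'u cc_arrow) cat)"
proof (rule fully_faithful_surjective_equivalence[OF category_regular_monoids
      category_bounded_normal_categories functor_end])
  fix C D :: "'u small_subcat" and \<phi> \<psi>
  assume "\<phi> \<in> Hom bounded_normal_categories_cat C D" "\<psi> \<in> Hom bounded_normal_categories_cat C D"
    "onAr end_functor \<phi> = onAr end_functor \<psi>"
  then show "\<phi> = \<psi>" by (rule faithful_end)
next
  fix C D :: "'u small_subcat" and \<phi>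
  assume "C \<in> Ob bounded_normal_categories_cat" "D \<in> Ob bounded_normal_categories_cat"
    "\<phi> \<in> Hom regular_monoids_cat (onOb end_functor C) (onOb end_functor D)"
  then show "\<exists>\<psi> \<in> Hom bounded_normal_categories_cat C D. onAr end_functor \<psi> = \<phi>"
    by (rule full_end)
next
  fix S :: "'u monoid" assume "S \<in> Ob regular_monoids_cat"
  then have S: "monoid S" "\<And>a. a \<in> carrier S \<Longrightarrow> \<exists>x \<in> carrier S. a \<otimes>\<^bsub>S\<^esub> x \<otimes>\<^bsub>S\<^esub> a = a"
    by (auto simp: regular_monoids_cat_def regular_monoid_def)
  \<comment> \<open>Infinity of the universe enters here: arrows between principal left ideals are
    triples over \<open>'u\<close> and have to be coded as elements of \<open>'u\<close>.\<close>
  obtain enc :: "'u \<times> 'u \<times> 'u \<Rightarrow> 'u" where "inj enc" using ex_encoding[OF assms] by blast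
  then interpret encoded_regular_monoid S enc
    by (intro encoded_regular_monoid.intro encoded_regular_monoid_axioms.intro S)
  show "\<exists>C \<in> Ob bounded_normal_categories_cat.
      \<exists>\<eta> \<in> Hom regular_monoids_cat S (onOb end_functor C). is_iso regular_monoids_cat \<eta>"
    using iso_end_monoid_L bounded_normal_category_L
    by (auto simp: bounded_normal_categories_Ob end_functor_def)
qed

end
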